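(* Let $\Omega\subset\mathbb{R}^N$ be an open bounded set with Lipschitz boundary, $p\in(1,+\infty)$, $s\in(0,1)$. Then for every $k\in\mathbb{N}$, $\lambda_{k}^{\delta,s,p}\to\lambda_{k}^{\infty,s,p}$ as $\delta\to+\infty$. Moreover, if for each $\delta>0$, $\varphi_{k}^{\delta,s,p}$ is an eigenfunction of the peridynamic problem associated to $\lambda_{k}^{\delta,s,p}$ with $\|\varphi_{k}^{\delta,s,p}\|_{L^p(\Omega)}=1$, then there exist $\delta_j\to+\infty$ and an eigenfunction $\varphi_{k}^{\infty,s,p}$ of the fractional $p$-Laplacian associated to $\lambda_k^{\infty,s,p}$ with $\|\varphi_{k}^{\infty,s,p}\|_{L^p(\Omega)}=1$ such that $\varphi_{k}^{\delta_j,s,p}\to\varphi_{k}^{\infty,s,p}$ in $L^p(\Omega)$ as $j\to +\infty$.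
   Context: For $\delta>0$ let $\partial_\delta\Omega=\{y\in\mathbb{R}^N\setminus\Omega: |x-y|<\delta \text{ for some } x\in\Omega\}$, $\Omega_\delta=\Omega\cup\partial_\delta\Omega$, $[u]_{W^{\delta,s,p}(\Omega_{\delta})}^p=\int_{\Omega_{\delta}}\int_{\Omega_{\delta}\cap B(x,\delta)}\frac{|u(x)-u(y)|^p}{|x-y|^{N+sp}}dydx$, $\mathcal{X}_0^{\delta,s,p}(\Omega)=\{u\in L^p(\Omega_\delta): [u]_{W^{\delta,s,p}(\Omega_{\delta})}<\infty,\ u=0 \text{ a.e. on }\partial_\delta\Omega\}$; $[u]_{W^{s,p}(\mathbb{R}^N)}^p=\int_{\mathbb{R}^N}\int_{\mathbb{R}^N}\frac{|u(x)-u(y)|^p}{|x-y|^{N+sp}}dydx$ and $\mathcal{X}_0^{\infty,s,p}(\Omega)=\{u:\mathbb{R}^N\to\mathbb{R}: [u]_{W^{s,p}(\mathbb{R}^N)}<\infty,\ u=0 \text{ a.e. in }\mathbb{R}^N\setminus\Omega\}$. The Krasnosel'skii genus $i(A)$ of a symmetric compact set $A$ is the least $k$ with a continuous odd map $A\to\mathbb{S}^{k-1}$ ($+\infty$ if none). The variational eigenvalues are $\lambda_k^{\delta,s,p}=\inf\{\max_{v\in A}[v]^p_{W^{\delta,s,p}(\Omega_\delta)}: A\subset\{u\in\mathcal{X}_0^{\delta,s,p}(\Omega):\|u\|_{L^p(\Omega)}=1\}$ symmetric compact, $i(A)\ge k\}$ and $\lambda_k^{\infty,s,p}=\inf\{\max_{v\in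 A}[v]^p_{W^{s,p}(\mathbb{R}^N)}: A\subset\{u\in\mathcal{X}_0^{\infty,s,p}(\Omega):\|u\|_{L^p(\Omega)}=1\}$ symmetric compact, $i(A)\ge k\}$. An eigenfunction of the peridynamic problem for $\lambda$ is $\varphi\in\mathcal{X}_0^{\delta,s,p}(\Omega)\setminus\{0\}$ with $\int_{\Omega_\delta}\int_{\Omega_\delta\cap B(x,\delta)}\frac{|\varphi(x)-\varphi(y)|^{p-2}(\varphi(x)-\varphi(y))(v(x)-v(y))}{|x-y|^{N+ps}}dydx=\lambda\int_\Omega|\varphi|^{p-2}\varphi v\,dx$ for all $v\in\mathcal{X}_0^{\delta,s,p}(\Omega)$. An eigenfunction of the fractional $p$-Laplacian for $\lambda$ is $\varphi\in\mathcal{X}_0^{\infty,s,p}(\Omega)\setminus\{0\}$ satisfying the same identity with both integrals over $\mathbb{R}^N$, for all $v\in\mathcal{X}_0^{\infty,s,p}(\Omega)$. *)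

theory Defs
  imports "HOL-Analysis.Analysis"
begin

definition lipschitz_boundary :: "'a::euclidean_space set \<Rightarrow> bool" where
  "lipschitz_boundary \<Omega> \<longleftrightarrow>
     (\<forall>x\<in>frontier \<Omega>. \<exists>r>0. \<exists>e::'a. norm e = 1 \<and>
        (\<exists>g::'a \<Rightarrow> real. (\<exists>L. L-lipschitz_on UNIV g) \<and>
           \<Omega> \<inter> ball x r = {y \<in> ball x r. y \<bullet> e < g (y - (y \<bullet> e) *\<^sub>R e)}))"

definition bdry_delta :: "'a::euclidean_space set \<Rightarrow> real \<Rightarrow> 'a set" where
  "bdry_delta \<Omega> \<delta> = {y. y \<notin> \<Omega> \<and> (\<exists>x\<in>\<Omega>. dist x y < \<delta>)}"

definition Omega_delta :: "'a::euclidean_space set \<Rightarrow> real \<Rightarrow> 'a set" where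
  "Omega_delta \<Omega> \<delta> = \<Omega> \<union> bdry_delta \<Omega> \<delta>"

definition Lp_pow :: "'a::euclidean_space set \<Rightarrow> real \<Rightarrow> ('a \<Rightarrow> real) \<Rightarrow> ennreal" where
  "Lp_pow E p u = (\<integral>\<^sup>+ x. indicator E x * ennreal (\<bar>u x\<bar> powr p) \<partial>lebesgue)"

definition seminorm_delta_pow ::
  "real \<Rightarrow> real \<Rightarrow> real \<Rightarrow> 'a::euclidean_space set \<Rightarrow> ('a \<Rightarrow> real) \<Rightarrow> ennreal" where
  "seminorm_delta_pow \<delta> s p \<Omega> u =
     (\<integral>\<^sup>+ x. indicator (Omega_delta \<Omega> \<delta>) x *
        (\<integral>\<^sup>+ y. indicator (Omega_delta \<Omega> \<delta> \<inter> ball x \<delta>) y *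
           ennreal (\<bar>u x - u y\<bar> powr p / dist x y powr (real DIM('a) + s * p)) \<partial>lebesgue) \<partial>lebesgue)"

definition seminorm_inf_pow ::
  "real \<Rightarrow> real \<Rightarrow> ('a::euclidean_space \<Rightarrow> real) \<Rightarrow> ennreal" where
  "seminorm_inf_pow s p u =
     (\<integral>\<^sup>+ x. (\<integral>\<^sup>+ y.
           ennreal (\<bar>u x - u y\<bar> powr p / dist x y powr (real DIM('a) + s * p)) \<partial>lebesgue) \<partial>lebesgue)"

definition X0_delta :: "real \<Rightarrow> real \<Rightarrow> real \<Rightarrow> 'a::euclidean_space set \<Rightarrow> ('a \<Rightarrow> real) set" where
  "X0_delta \<delta> s p \<Omega> = {u. u \<in> borel_measurable lebesgue \<and>
       Lp_pow (Omega_delta \<Omega> \<delta>) p u < \<infinity> \<and> seminorm_delta_pow \<delta> s p \<Omega> u < \<infinity> \<and>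
       (AE x in lebesgue. x \<in> bdry_delta \<Omega> \<delta> \<longrightarrow> u x = 0)}"

definition X0_inf :: "real \<Rightarrow> real \<Rightarrow> 'a::euclidean_space set \<Rightarrow> ('a \<Rightarrow> real) set" where
  "X0_inf s p \<Omega> = {u. u \<in> borel_measurable lebesgue \<and> seminorm_inf_pow s p u < \<infinity> \<and>
       (AE x in lebesgue. x \<notin> \<Omega> \<longrightarrow> u x = 0)}"

definition dist_delta :: "real \<Rightarrow> real \<Rightarrow> real \<Rightarrow> 'a::euclidean_space set \<Rightarrow>
     ('a \<Rightarrow> real) \<Rightarrow> ('a \<Rightarrow> real) \<Rightarrow> real" where
  "dist_delta \<delta> s p \<Omega> u v =
     enn2real (Lp_pow (Omega_delta \<Omega> \<delta>) p (\<lambda>x. u x - v x)) powr (1 / p) +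
     enn2real (seminorm_delta_pow \<delta> s p \<Omega> (\<lambda>x. u x - v x)) powr (1 / p)"

definition dist_inf :: "real \<Rightarrow> real \<Rightarrow> ('a::euclidean_space \<Rightarrow> real) \<Rightarrow> ('a \<Rightarrow> real) \<Rightarrow> real" where
  "dist_inf s p u v = enn2real (seminorm_inf_pow s p (\<lambda>x. u x - v x)) powr (1 / p)"

definition symmetric_set :: "('a \<Rightarrow> real) set \<Rightarrow> bool" where
  "symmetric_set A \<longleftrightarrow> (\<forall>u\<in>A. (\<lambda>x. - u x) \<in> A)"

definition compact_wrt :: "(('a \<Rightarrow> real) \<Rightarrow> ('a \<Rightarrow> real) \<Rightarrow> real) \<Rightarrow> ('a \<Rightarrow> real) set \<Rightarrow> bool" where
  "compact_wrt d A \<longleftrightarrow> (\<forall>f. (\<forall>n. f n \<in> A) \<longrightarrow>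
      (\<exists>(r::nat \<Rightarrow> nat) u. strict_mono r \<and> u \<in> A \<and> (\<lambda>n. d (f (r n)) u) \<longlonglongrightarrow> 0))"

text \<open>continuous odd map A \<rightarrow> S^{k-1} \<subseteq> R^k (points of R^k as nat \<Rightarrow> real vanishing from index k on)\<close>
definition odd_sphere_map ::
  "(('a \<Rightarrow> real) \<Rightarrow> ('a \<Rightarrow> real) \<Rightarrow> real) \<Rightarrow> ('a \<Rightarrow> real) set \<Rightarrow> nat \<Rightarrow>
    (('a \<Rightarrow> real) \<Rightarrow> nat \<Rightarrow> real) \<Rightarrow> bool" where
  "odd_sphere_map d A k h \<longleftrightarrow>
     (\<forall>u\<in>A. (\<forall>i\<ge>k. h u i = 0) \<and> (\<Sum>i<k. (h u i)\<^sup>2) = 1 \<and> h (\<lambda>x. - u x) = (\<lambda>i. - h u i)) \<and>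
     (\<forall>f u. (\<forall>n. f n \<in> A) \<longrightarrow> u \<in> A \<longrightarrow> (\<lambda>n. d (f n) u) \<longlonglongrightarrow> 0 \<longrightarrow>
        (\<forall>i<k. (\<lambda>n. h (f n) i) \<longlonglongrightarrow> h u i))"

definition genus :: "(('a \<Rightarrow> real) \<Rightarrow> ('a \<Rightarrow> real) \<Rightarrow> real) \<Rightarrow> ('a \<Rightarrow> real) set \<Rightarrow> enat" where
  "genus d A = (if \<exists>k h. odd_sphere_map d A k h
                then enat (LEAST k. \<exists>h. odd_sphere_map d A k h) else \<infinity>)"

definition lambda_delta :: "real \<Rightarrow> real \<Rightarrow> real \<Rightarrow> 'a::euclidean_space set \<Rightarrow> nat \<Rightarrow> real" where
  "lambda_delta \<delta> s p \<Omega> k = Inf {m. \<exists>A. A \<subseteq> {u \<in> X0_delta \<delta> s p \<Omega>. Lp_pow \<Omega> p u = 1} \<and>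
       symmetric_set A \<and> compact_wrt (dist_delta \<delta> s p \<Omega>) A \<and>
       genus (dist_delta \<delta> s p \<Omega>) A \<ge> enat k \<and>
       m = (SUP v\<in>A. enn2real (seminorm_delta_pow \<delta> s p \<Omega> v))}"

definition lambda_inf :: "real \<Rightarrow> real \<Rightarrow> 'a::euclidean_space set \<Rightarrow> nat \<Rightarrow> real" where
  "lambda_inf s p \<Omega> k = Inf {m. \<exists>A. A \<subseteq> {u \<in> X0_inf s p \<Omega>. Lp_pow \<Omega> p u = 1} \<and>
       symmetric_set A \<and> compact_wrt (dist_inf s p) A \<and>
       genus (dist_inf s p) A \<ge> enat k \<and>
       m = (SUP v\<in>A. enn2real (seminorm_inf_pow s p v))}"

definition eigenfunction_delta ::
  "real \<Rightarrow> real \<Rightarrow> real \<Rightarrow> 'a::euclidean_space set \<Rightarrow> real \<Rightarrow> ('a \<Rightarrow> real) \<Rightarrow> bool" where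
  "eigenfunction_delta \<delta> s p \<Omega> lam \<phi> \<longleftrightarrow>
     \<phi> \<in> X0_delta \<delta> s p \<Omega> \<and> \<not> (AE x in lebesgue. \<phi> x = 0) \<and>
     (\<forall>v\<in>X0_delta \<delta> s p \<Omega>.
        (LINT x:Omega_delta \<Omega> \<delta>|lebesgue. LINT y:(Omega_delta \<Omega> \<delta> \<inter> ball x \<delta>)|lebesgue.
           \<bar>\<phi> x - \<phi> y\<bar> powr (p - 2) * (\<phi> x - \<phi> y) * (v x - v y)
             / dist x y powr (real DIM('a) + p * s))
        = lam * (LINT x:\<Omega>|lebesgue. \<bar>\<phi> x\<bar> powr (p - 2) * \<phi> x * v x))"

definition eigenfunction_inf ::
  "real \<Rightarrow> real \<Rightarrow> 'a::euclidean_space set \<Rightarrow> real \<Rightarrow> ('a \<Rightarrow> real) \<Rightarrow> bool" where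
  "eigenfunction_inf s p \<Omega> lam \<phi> \<longleftrightarrow>
     \<phi> \<in> X0_inf s p \<Omega> \<and> \<not> (AE x in lebesgue. \<phi> x = 0) \<and>
     (\<forall>v\<in>X0_inf s p \<Omega>.
        (LINT x|lebesgue. LINT y|lebesgue.
           \<bar>\<phi> x - \<phi> y\<bar> powr (p - 2) * (\<phi> x - \<phi> y) * (v x - v y)
             / dist x y powr (real DIM('a) + p * s))
        = lam * (LINT x:\<Omega>|lebesgue. \<bar>\<phi> x\<bar> powr (p - 2) * \<phi> x * v x))"

end

theory Submission
  imports Defs "HOL-Complex_Analysis.Great_Picard"
begin

text \<open>
  Once \<open>\<delta>\<close> exceeds the diameter of \<open>\<Omega>\<close>, no limit is needed to compare the two problems: two points at
  distance at least \<open>\<delta>\<close> cannot both lie in \<open>\<Omega>\<close>, so for the zero extension \<open>w\<close> of \<open>u\<close>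
  the Gagliardo energy of \<open>w\<close> over the whole space equals the \<open>\<delta>\<close>-energy of \<open>u\<close> plus
  \<open>2 T(\<delta>)\<close> times the \<open>p\<close>-th power of the norm of \<open>u\<close>, where \<open>T(\<delta>)\<close> is the integral of
  \<open>norm z powr (- N - s p)\<close> over \<open>norm z \<ge> \<delta>\<close> and decays like \<open>\<delta> powr (- s p)\<close>. The weak forms satisfy
  the same identity. Hence the minimax values for \<open>\<delta>\<close> and \<open>\<infinity>\<close> differ by the constant \<open>2 T(\<delta>)\<close>, and the
  zero extension of an eigenfunction for \<open>\<lambda>\<close> solves the fractional problem with \<open>\<lambda> + 2 T(\<delta>)\<close>.

  The zero extensions of the normalised eigenfunctions are therefore bounded in the Gagliardo seminorm.
  Replacing functions by their means on a grid of cubes of side \<open>h\<close> costs at most a multiple of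
  \<open>h powr (s p)\<close> times the energy, so they are precompact in \<open>L\<^sup>p\<close>; almost everywhere convergence and
  Young's inequality then allow the passage to the limit in the weak formulation.
\<close>

section \<open>Signed powers and the singular kernel\<close>

text \<open>The obstacle is that the two problems live in different function spaces with different
  distances. The identity with \<open>T(\<delta>) > 0\<close> resolves this. It bounds the norm on
  \<open>\<Omega>\<close> by the Gagliardo energy, thus serving as the Poincare inequality of the
  fractional space. Applied to differences, it shows that zero extension preserves and reflects null
  sequences, and null sequences are all that compactness and the genus see. On normalised functions
  the correction is the same number for every competitor, so it commutes with supremum and infimum.
  The same identity, tested with the eigenfunction itself, makes the energy of the extension equal
  to the shifted eigenvalue. Convergence of the eigenvalues is therefore also the bound that starts
  the compactness argument. Most inequalities come from one device with a free parameter: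
  distinguish which of two quantities is larger. It stands in for Young, Hoelder and Jensen at the
  price of unsharp constants. The norm of the limit is the exception, since there a factor has to
  tend to 1, and convexity is used.\<close>

lemma sigma_finite_lebesgue: "sigma_finite_measure (lebesgue :: 'a::euclidean_space measure)"
proof
  let ?A = "range (\<lambda>n::nat. ball (0::'a) (real n))"
  have "\<Union>?A = UNIV"
    by (auto simp: dist_norm intro: reals_Archimedean2)
  moreover have "\<forall>a\<in>?A. emeasure lebesgue a \<noteq> \<infinity>"
    using emeasure_lborel_ball_finite by (auto simp: less_top)
  ultimately show "\<exists>A. countable A \<and> A \<subseteq> sets (lebesgue :: 'a measure) \<and> \<Union>A = space lebesgue \<and>
      (\<forall>a\<in>A. emeasure lebesgue a \<noteq> \<infinity>)"
    by (intro exI[of _ ?A]) auto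
qed

interpretation leb: sigma_finite_measure "lebesgue :: 'a::euclidean_space measure"
  by (rule sigma_finite_lebesgue)

interpretation leb2: pair_sigma_finite "lebesgue :: 'a::euclidean_space measure" "lebesgue :: 'b::euclidean_space measure" ..

text \<open>The product of the two completions, not the completion of the product. For merely
  Lebesgue measurable functions of one variable it is the measure for which Tonelli and Fubini
  return the iterated integrals of the definitions.\<close>

abbreviation lebesgue2 :: "('a::euclidean_space \<times> 'a) measure" where
  "lebesgue2 \<equiv> lebesgue \<Otimes>\<^sub>M lebesgue"

lemma fst_lebesgue2_borel [measurable]: "fst \<in> borel_measurable lebesgue2"
proof -
  have "(\<lambda>z. id (fst z)) \<in> borel_measurable lebesgue2"
    by (rule measurable_compose[OF measurable_fst]) (simp add: measurable_completion)
  then show ?thesis by (simp add: id_def)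
qed

lemma snd_lebesgue2_borel [measurable]: "snd \<in> borel_measurable lebesgue2"
proof -
  have "(\<lambda>z. id (snd z)) \<in> borel_measurable lebesgue2"
    by (rule measurable_compose[OF measurable_snd]) (simp add: measurable_completion)
  then show ?thesis by (simp add: id_def)
qed

lemma AE_lebesgue2_fst:
  assumes "AE x in lebesgue. P x"
  shows "AE z in lebesgue2. P (fst z)"
proof -
  obtain N where N: "{x \<in> space lebesgue. \<not> P x} \<subseteq> N" "N \<in> null_sets lebesgue"
    using assms by (auto elim!: AE_E simp: null_sets_def)
  have [measurable]: "N \<in> sets lebesgue" using N(2) by auto
  have "AE z in lebesgue2. fst z \<notin> N"
  proof (rule leb2.AE_pair_measure)
    show "AE x in lebesgue. AE y in lebesgue. fst (x, y) \<notin> N"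
      using AE_not_in[OF N(2)] by eventually_elim auto
  qed measurable
  then show ?thesis using N(1) by (elim AE_mp) (auto intro!: AE_I2)
qed

lemma AE_lebesgue2_snd:
  assumes "AE x in lebesgue. P x"
  shows "AE z in lebesgue2. P (snd z)"
proof -
  obtain N where N: "{x \<in> space lebesgue. \<not> P x} \<subseteq> N" "N \<in> null_sets lebesgue"
    using assms by (auto elim!: AE_E simp: null_sets_def)
  have [measurable]: "N \<in> sets lebesgue" using N(2) by auto
  have "AE z in lebesgue2. snd z \<notin> N"
  proof (rule leb2.AE_pair_measure)
    show "AE x in lebesgue. AE y in lebesgue. snd (x, y) \<notin> N"
      using AE_not_in[OF N(2)] by (auto intro!: AE_I2)
  qed measurable
  then show ?thesis using N(1) by (elim AE_mp) (auto intro!: AE_I2)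
qed

text \<open>The nonlinearity of both weak formulations, the derivative of
  \<open>\<bar>a\<bar> powr p / p\<close>. Its value at 0 is 0 for every \<open>p\<close>, also in
  the singular range \<open>p < 2\<close>.\<close>

definition signed_powr :: "real \<Rightarrow> real \<Rightarrow> real" where
  "signed_powr p a = \<bar>a\<bar> powr (p - 2) * a"

lemma signed_powr_measurable [measurable]: "signed_powr p \<in> borel_measurable borel"
  unfolding signed_powr_def by measurable

lemma signed_powr_0 [simp]: "signed_powr p 0 = 0"
  by (simp add: signed_powr_def)

lemma signed_powr_minus: "signed_powr p (- a) = - signed_powr p a"
  by (simp add: signed_powr_def)

lemma signed_powr_mult_self: "signed_powr p a * a = \<bar>a\<bar> powr p"
proof (cases "a = 0")
  case False
  have "\<bar>a\<bar> powr (p - 2) * \<bar>a\<bar>\<^sup>2 = \<bar>a\<bar> powr (p - 2) * \<bar>a\<bar> powr 2"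
    using False by simp
  also have "\<dots> = \<bar>a\<bar> powr p"
    by (subst powr_add[symmetric]) simp
  finally show ?thesis by (simp add: signed_powr_def power2_eq_square mult.assoc)
qed simp

lemma abs_signed_powr: "\<bar>signed_powr p a\<bar> = \<bar>a\<bar> powr (p - 1)"
proof (cases "a = 0")
  case False
  have "\<bar>a\<bar> powr (p - 2) * \<bar>a\<bar> powr 1 = \<bar>a\<bar> powr (p - 1)"
    by (subst powr_add[symmetric]) simp
  then show ?thesis using False by (simp add: signed_powr_def abs_mult)
qed simp

text \<open>The factor \<open>\<bar>a\<bar> powr (p - 2)\<close> can blow up at 0, so continuity
  there is read off the modulus \<open>\<bar>a\<bar> powr (p - 1)\<close>, whose exponent is
  positive.\<close>

lemma tendsto_signed_powr:
  assumes "1 < p" "f \<longlonglongrightarrow> l"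
  shows "(\<lambda>n. signed_powr p (f n)) \<longlonglongrightarrow> signed_powr p l"
proof (cases "l = 0")
  case True
  have "(\<lambda>n. \<bar>f n\<bar> powr (p - 1)) \<longlonglongrightarrow> 0 powr (p - 1)"
    using assms True by (intro tendsto_powr') (auto intro!: tendsto_eq_intros)
  then have "(\<lambda>n. \<bar>signed_powr p (f n)\<bar>) \<longlonglongrightarrow> 0"
    by (simp add: abs_signed_powr)
  then show ?thesis using True by (simp add: tendsto_rabs_zero_iff)
next
  case False
  then show ?thesis unfolding signed_powr_def
    using assms(2) by (intro tendsto_intros) auto
qed

text \<open>Both summands are at most the larger modulus, which yields the crude constant
  \<open>2 powr p\<close>. This quasi-triangle inequality suffices wherever only finiteness or
  convergence to 0 matters.\<close>

lemma powr_abs_add_le: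
  fixes a b p :: real
  assumes "0 \<le> p"
  shows "\<bar>a + b\<bar> powr p \<le> 2 powr p * (\<bar>a\<bar> powr p + \<bar>b\<bar> powr p)"
proof -
  have "\<bar>a + b\<bar> powr p \<le> (2 * max \<bar>a\<bar> \<bar>b\<bar>) powr p"
    by (rule powr_mono2) (use assms in auto)
  also have "\<dots> = 2 powr p * (max \<bar>a\<bar> \<bar>b\<bar>) powr p"
    by (simp add: powr_mult)
  also have "\<dots> \<le> 2 powr p * (\<bar>a\<bar> powr p + \<bar>b\<bar> powr p)"
    by (intro mult_left_mono) (auto simp: max_def)
  finally show ?thesis .
qed

text \<open>If \<open>\<bar>b\<bar> \<le> e * \<bar>a\<bar>\<close>, the first term alone dominates;
  otherwise \<open>\<bar>a\<bar>\<close> is below \<open>\<bar>b\<bar> / e\<close> and the second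
  one does. The weight of \<open>a\<close> can be made arbitrarily small at the cost of
  \<open>b\<close>, which later will be the fixed test function.\<close>

lemma signed_powr_young:
  assumes p: "1 < p" and e: "0 < e"
  shows "\<bar>signed_powr p a * b\<bar> \<le> e * \<bar>a\<bar> powr p + e powr (1 - p) * \<bar>b\<bar> powr p"
proof (cases "\<bar>b\<bar> \<le> e * \<bar>a\<bar>")
  case True
  have "\<bar>signed_powr p a * b\<bar> \<le> \<bar>signed_powr p a\<bar> * (e * \<bar>a\<bar>)"
    using True by (simp add: abs_mult mult_left_mono)
  also have "\<dots> = e * \<bar>signed_powr p a * a\<bar>" by (simp add: abs_mult)
  also have "\<dots> = e * \<bar>a\<bar> powr p" by (simp add: signed_powr_mult_self)
  finally show ?thesis using add_increasing2[of "e powr (1 - p) * \<bar>b\<bar> powr p"] by simp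
next
  case False
  then have "\<bar>a\<bar> \<le> \<bar>b\<bar> / e" using e by (simp add: field_simps)
  then have "\<bar>a\<bar> powr (p - 1) \<le> (\<bar>b\<bar> / e) powr (p - 1)"
    using p by (intro powr_mono2) auto
  then have "\<bar>signed_powr p a * b\<bar> \<le> (\<bar>b\<bar> / e) powr (p - 1) * \<bar>b\<bar>"
    by (simp add: abs_mult abs_signed_powr mult_right_mono)
  also have "\<dots> = e powr (1 - p) * \<bar>signed_powr p b * b\<bar>"
    using e by (simp add: abs_mult abs_signed_powr powr_divide powr_minus[of e "p - 1", simplified] field_simps)
  also have "\<dots> = e powr (1 - p) * \<bar>b\<bar> powr p" by (simp add: signed_powr_mult_self)
  finally show ?thesis using add_increasing[of "e * \<bar>a\<bar> powr p"] e by simp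
qed

text \<open>Write \<open>a + b\<close> as the convex combination of \<open>a / (1 - t)\<close> and
  \<open>b / t\<close>. The constant in front of \<open>a\<close> tends to 1 as \<open>t\<close>
  tends to 0, so no factor is lost when norms pass to a strong limit.\<close>

lemma powr_abs_add_convex:
  fixes a b p t :: real
  assumes p: "1 \<le> p" and t: "0 < t" "t < 1"
  shows "\<bar>a + b\<bar> powr p \<le> (1 - t) powr (1 - p) * \<bar>a\<bar> powr p + t powr (1 - p) * \<bar>b\<bar> powr p"
proof -
  have key: "(x + y) powr p \<le> (1 - t) powr (1 - p) * x powr p + t powr (1 - p) * y powr p"
    if xy: "0 < x" "0 < y" for x y :: real
  proof -
    have "((1 - t) *\<^sub>R (x / (1 - t)) + t *\<^sub>R (y / t)) powr p
        \<le> (1 - t) * (x / (1 - t)) powr p + t * (y / t) powr p"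
      by (rule convex_onD[OF powr_convex[OF p]]) (use t xy in auto)
    moreover have "(1 - t) * (x / (1 - t)) powr p = (1 - t) powr (1 - p) * x powr p"
      using t xy by (simp add: powr_divide powr_diff)
    moreover have "t * (y / t) powr p = t powr (1 - p) * y powr p"
      using t xy by (simp add: powr_divide powr_diff)
    ultimately show ?thesis using t by simp
  qed
  have ge1: "1 \<le> c powr (1 - p)" if "0 < c" "c < 1" for c :: real
    using powr_mono'[of "1 - p" 0 c] that p by simp
  have "\<bar>a + b\<bar> powr p \<le> (\<bar>a\<bar> + \<bar>b\<bar>) powr p"
    by (rule powr_mono2) (use p in auto)
  also have "\<dots> \<le> (1 - t) powr (1 - p) * \<bar>a\<bar> powr p + t powr (1 - p) * \<bar>b\<bar> powr p"
  \<comment> \<open>The estimate \<open>key\<close> is for positive arguments; a vanishing one is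
    handled by both constants being at least 1.\<close>
  proof (cases "a = 0 \<or> b = 0")
    case True
    have "\<bar>a\<bar> powr p \<le> (1 - t) powr (1 - p) * \<bar>a\<bar> powr p"
      using mult_right_mono[OF ge1[of "1 - t"], of "\<bar>a\<bar> powr p"] t by simp
    moreover have "\<bar>b\<bar> powr p \<le> t powr (1 - p) * \<bar>b\<bar> powr p"
      using mult_right_mono[OF ge1[of t], of "\<bar>b\<bar> powr p"] t by simp
    ultimately show ?thesis using True by auto
  next
    case False
    then show ?thesis by (intro key) auto
  qed
  finally show ?thesis .
qed

text \<open>On the diagonal the value is 0, because \<open>0 powr a = 0\<close> and division by 0
  gives 0. The order \<open>a\<close> will be \<open>real DIM('a) + s * p\<close>.\<close>

definition riesz_ker :: "real \<Rightarrow> 'a::euclidean_space \<Rightarrow> 'a \<Rightarrow> real" where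
  "riesz_ker a x y = 1 / dist x y powr a"

lemma riesz_ker_nonneg [simp]: "0 \<le> riesz_ker a x y"
  by (simp add: riesz_ker_def)

lemma riesz_ker_commute: "riesz_ker a x y = riesz_ker a y x"
  by (simp add: riesz_ker_def dist_commute)

lemma riesz_ker_measurable [measurable]:
  "(\<lambda>z. riesz_ker a (fst z) (snd z)) \<in> borel_measurable lebesgue2"
  unfolding riesz_ker_def by measurable

text \<open>This is the constant \<open>T(\<delta>)\<close>. The type argument carries the
  dimension, which the other arguments do not determine; the centre 0 stands for any point, by
  translation invariance.\<close>

definition kernel_tail :: "'a::euclidean_space itself \<Rightarrow> real \<Rightarrow> real \<Rightarrow> ennreal" where
  "kernel_tail _ a \<delta> = (\<integral>\<^sup>+ (z::'a). indicator {z. \<delta> \<le> norm z} z * ennreal (riesz_ker a 0 z) \<partial>lebesgue)"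

lemma nn_integral_riesz_ker_far:
  fixes x :: "'a::euclidean_space"
  shows "(\<integral>\<^sup>+ y. indicator {y. \<delta> \<le> dist x y} y * ennreal (riesz_ker a x y) \<partial>lebesgue) = kernel_tail TYPE('a) a \<delta>"
proof -
  let ?f = "\<lambda>y. indicator {y. \<delta> \<le> dist x y} y * ennreal (riesz_ker a x y)"
  have m: "?f \<in> borel_measurable borel" unfolding riesz_ker_def by measurable
  have "(\<integral>\<^sup>+ y. ?f y \<partial>lebesgue) = (\<integral>\<^sup>+ y. ?f y \<partial>distr lborel borel ((+) x))"
    by (simp add: nn_integral_completion lborel_distr_plus)
  also have "\<dots> = (\<integral>\<^sup>+ z. ?f (x + z) \<partial>lborel)"
    using m by (subst nn_integral_distr) auto
  also have "\<dots> = (\<integral>\<^sup>+ (z::'a). indicator {z. \<delta> \<le> norm z} z * ennreal (riesz_ker a 0 z) \<partial>lborel)"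
    by (intro nn_integral_cong) (auto simp: riesz_ker_def dist_norm split: split_indicator)
  finally show ?thesis by (simp add: nn_integral_completion kernel_tail_def)
qed

text \<open>Dyadic shells: for \<open>2^k * \<delta> \<le> norm z < 2^(k+1) * \<delta>\<close> the
  kernel is at most \<open>(2^k * \<delta>) powr (- a)\<close>, and the surrounding ball has volume
  \<open>V\<close> times the \<open>N\<close>-th power of its radius. With
  \<open>a = N + \<sigma>\<close> the shells contribute a geometric series of ratio
  \<open>q = 2 powr (- \<sigma>)\<close>, whence the constant
  \<open>2^N * V / (1 - q)\<close>.\<close>

lemma kernel_tail_bound:
  assumes s: "0 < \<sigma>"
  shows "\<exists>K\<ge>0. \<forall>\<delta>>0. kernel_tail TYPE('a::euclidean_space) (real DIM('a) + \<sigma>) \<delta> \<le> ennreal (K * \<delta> powr (- \<sigma>))"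
proof -
  let ?N = "DIM('a)"
  define a where "a = real ?N + \<sigma>"
  define V where "V = measure lborel (ball (0::'a) 1)"
  define q where "q = 2 powr (- \<sigma>)"
  have q: "0 < q" "q < 1" using s by (auto simp: q_def powr_minus_divide)
  define K where "K = 2 ^ ?N * V * (1 / (1 - q))"
  have V0: "0 \<le> V" by (simp add: V_def)
  have "kernel_tail TYPE('a) a \<delta> \<le> ennreal (K * \<delta> powr (- \<sigma>))" if d: "0 < \<delta>" for \<delta>
  proof -
    define g where "g = (\<lambda>k z. ennreal ((2^k * \<delta>) powr (- a)) * indicator (ball (0::'a) (2^(Suc k) * \<delta>)) z)"
    have g[measurable]: "g k \<in> borel_measurable lebesgue" for k
      unfolding g_def
      by (intro borel_measurable_times_ennreal borel_measurable_const borel_measurable_indicator) auto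
    have le: "indicator {z. \<delta> \<le> norm z} z * ennreal (riesz_ker a 0 z) \<le> (\<Sum>k. g k z)" for z :: 'a
    proof (cases "\<delta> \<le> norm z")
      case True
      \<comment> \<open>The index of the shell containing \<open>z\<close>. The logarithm is
        nonnegative since \<open>norm z \<ge> \<delta>\<close>, so \<open>nat\<close> loses
        nothing.\<close>
      define k where "k = nat \<lfloor>log 2 (norm z / \<delta>)\<rfloor>"
      have nz: "1 \<le> norm z / \<delta>" "norm z > 0" using True d by (auto simp: field_simps)
      have lg: "0 \<le> log 2 (norm z / \<delta>)" using nz by (subst zero_le_log_cancel_iff) (use nz d in auto)
      have k1: "real k \<le> log 2 (norm z / \<delta>)" "log 2 (norm z / \<delta>) < real (Suc k)"
        unfolding k_def using lg by linarith+
      have "2 ^ k \<le> norm z / \<delta>" "norm z / \<delta> < 2 ^ Suc k"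
        using k1 nz d le_log_iff[of 2 "norm z / \<delta>" "real k"] log_less_iff[of 2 "norm z / \<delta>" "real (Suc k)"]
        by (simp_all add: powr_realpow del: power_Suc of_nat_Suc)
      then have k2: "2 ^ k * \<delta> \<le> norm z" "norm z < 2 ^ Suc k * \<delta>"
        using d by (auto simp: field_simps)
      have a0: "0 < a" using s by (simp add: a_def add_pos_pos)
      have "riesz_ker a 0 z = norm z powr (- a)" by (simp add: riesz_ker_def powr_minus_divide)
      also have "\<dots> \<le> (2^k * \<delta>) powr (- a)"
        by (rule powr_mono2') (use a0 d k2 in auto)
      finally have "ennreal (riesz_ker a 0 z) \<le> g k z"
        using k2 by (simp add: g_def ennreal_leI)
      also have "\<dots> \<le> (\<Sum>k. g k z)"
        using sum_le_suminf[of "\<lambda>k. g k z" "{k}"] by simp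
      finally show ?thesis using True by simp
    qed simp
    have ig: "(\<integral>\<^sup>+ z. g k z \<partial>lebesgue) = ennreal (2 ^ ?N * V * \<delta> powr (- \<sigma>) * q ^ k)" for k
    proof -
      have "(\<integral>\<^sup>+ z. g k z \<partial>lebesgue) = ennreal ((2^k * \<delta>) powr (- a)) * emeasure lebesgue (ball (0::'a) (2^(Suc k) * \<delta>))"
        unfolding g_def by (subst nn_integral_cmult_indicator) auto
      also have "emeasure lebesgue (ball (0::'a) (2^(Suc k) * \<delta>)) = ennreal (measure lborel (ball (0::'a) (2^(Suc k) * \<delta>)))"
        using emeasure_lborel_ball_finite[of "0::'a"] by (subst emeasure_eq_ennreal_measure) (auto simp: less_top)
      also have "measure lborel (ball (0::'a) (2^(Suc k) * \<delta>)) = (2^(Suc k) * \<delta>) ^ ?N * V"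
        unfolding V_def using d by (intro content_ball_conv_unit_ball) auto
      also have "ennreal ((2^k * \<delta>) powr (- a)) * ennreal ((2^(Suc k) * \<delta>) ^ ?N * V) =
         ennreal ((2^k * \<delta>) powr (- a) * ((2^(Suc k) * \<delta>) ^ ?N * V))"
        by (subst ennreal_mult) (use V0 d in auto)
      also have "(2^k * \<delta>) powr (- a) * ((2^(Suc k) * \<delta>) ^ ?N * V) =
          2 ^ ?N * V * ((2^k * \<delta>) powr (- a) * (2^k * \<delta>) powr (real ?N))"
        using d by (subst powr_realpow) (auto simp: power_mult_distrib)
      also have "(2^k * \<delta>) powr (- a) * (2^k * \<delta>) powr (real ?N) = (2^k * \<delta>) powr (- \<sigma>)"
        by (subst powr_add[symmetric]) (simp add: a_def)
      also have "(2^k * \<delta>) powr (- \<sigma>) = \<delta> powr (- \<sigma>) * q ^ k"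
      proof -
        have "((2::real)^k) powr (- \<sigma>) = q ^ k"
          unfolding q_def by (simp add: powr_power powr_powr[of 2 "real k", unfolded powr_realpow[OF zero_less_numeral]] mult.commute)
        then show ?thesis using d by (simp add: powr_mult)
      qed
      finally show ?thesis by (simp add: mult_ac)
    qed
    have "kernel_tail TYPE('a) a \<delta> \<le> (\<integral>\<^sup>+ z. (\<Sum>k. g k z) \<partial>lebesgue)"
      unfolding kernel_tail_def by (rule nn_integral_mono) (rule le)
    also have "\<dots> = (\<Sum>k. ennreal (2 ^ ?N * V * \<delta> powr (- \<sigma>) * q ^ k))"
      by (subst nn_integral_suminf) (auto simp: ig)
    also have "\<dots> = ennreal (2 ^ ?N * V * \<delta> powr (- \<sigma>) * (1 / (1 - q)))"
      using q V0 by (intro suminf_ennreal_eq sums_mult geometric_sums) auto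
    finally show ?thesis by (simp add: K_def mult_ac)
  qed
  moreover have "0 \<le> K" using V0 q by (simp add: K_def)
  ultimately show ?thesis unfolding a_def by blast
qed

text \<open>The kernel is positive outside the ball, so a vanishing tail would give the whole space
  the finite measure of that ball. Positivity is what lets the energy control the norm in
  \<open>X0_inf_subset\<close>.\<close>

lemma kernel_tail_pos:
  assumes "0 < \<delta>"
  shows "0 < kernel_tail TYPE('a::euclidean_space) a \<delta>"
proof (rule ccontr)
  assume "\<not> ?thesis"
  then have "kernel_tail TYPE('a) a \<delta> = 0" by simp
  then have "(\<integral>\<^sup>+ (z::'a). indicator {z. \<delta> \<le> norm z} z * ennreal (riesz_ker a 0 z) \<partial>lborel) = 0"
    by (simp add: kernel_tail_def nn_integral_completion)
  then have "AE z in lborel. indicator {z. \<delta> \<le> norm z} z * ennreal (riesz_ker a (0::'a) z) = 0"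
    by (subst (asm) nn_integral_0_iff_AE) (auto simp: riesz_ker_def)
  then have "AE z::'a in lborel. z \<in> ball 0 \<delta>"
    by eventually_elim (use assms in \<open>auto simp: riesz_ker_def indicator_def split: if_splits\<close>)
  then have "emeasure lborel (UNIV :: 'a set) = emeasure lborel (ball (0::'a) \<delta>)"
    by (intro emeasure_eq_AE) auto
  then show False using emeasure_lborel_ball_finite[of "0::'a" \<delta>] by simp
qed

section \<open>Energy and weak-form densities on pairs of points, and their integrals over distant
  pairs\<close>

definition gagliardo :: "real \<Rightarrow> real \<Rightarrow> ('a::euclidean_space \<Rightarrow> real) \<Rightarrow> 'a \<times> 'a \<Rightarrow> real" where
  "gagliardo p a u z = \<bar>u (fst z) - u (snd z)\<bar> powr p * riesz_ker a (fst z) (snd z)"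

definition weak_density :: "real \<Rightarrow> real \<Rightarrow> ('a::euclidean_space \<Rightarrow> real) \<Rightarrow> ('a \<Rightarrow> real) \<Rightarrow> 'a \<times> 'a \<Rightarrow> real" where
  "weak_density p a u v z = signed_powr p (u (fst z) - u (snd z)) * (v (fst z) - v (snd z)) * riesz_ker a (fst z) (snd z)"

definition near_diag :: "real \<Rightarrow> ('a::euclidean_space \<times> 'a) set" where
  "near_diag \<delta> = {z. dist (fst z) (snd z) < \<delta>}"

text \<open>A member of \<open>X0_delta\<close> is arbitrary outside
  \<open>Omega_delta \<Omega> \<delta>\<close> and vanishes on the collar only almost everywhere.
  This picks the version that vanishes at every point off \<open>\<Omega>\<close>.\<close>

definition zero_ext :: "'a set \<Rightarrow> ('a \<Rightarrow> real) \<Rightarrow> 'a \<Rightarrow> real" where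
  "zero_ext \<Omega> u x = indicator \<Omega> x * u x"

lemma measurable_fst_lebesgue2 [measurable]:
  "u \<in> borel_measurable lebesgue \<Longrightarrow> (\<lambda>z. u (fst z)) \<in> borel_measurable lebesgue2"
  by (rule measurable_compose[OF measurable_fst])

lemma measurable_snd_lebesgue2 [measurable]:
  "u \<in> borel_measurable lebesgue \<Longrightarrow> (\<lambda>z. u (snd z)) \<in> borel_measurable lebesgue2"
  by (rule measurable_compose[OF measurable_snd])

lemma gagliardo_nonneg [simp]: "0 \<le> gagliardo p a u z"
  by (simp add: gagliardo_def)

lemma gagliardo_measurable [measurable]:
  assumes [measurable]: "u \<in> borel_measurable lebesgue"
  shows "gagliardo p a u \<in> borel_measurable lebesgue2"
  unfolding gagliardo_def by measurable

lemma weak_density_measurable [measurable]: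
  assumes [measurable]: "u \<in> borel_measurable lebesgue" "v \<in> borel_measurable lebesgue"
  shows "weak_density p a u v \<in> borel_measurable lebesgue2"
  unfolding weak_density_def by measurable

lemma near_diag_sets [measurable]: "near_diag \<delta> \<in> sets lebesgue2"
proof -
  have "{z \<in> space lebesgue2. dist (fst z) (snd z :: 'a) < \<delta>} \<in> sets lebesgue2"
    by measurable
  then show ?thesis by (simp add: near_diag_def space_pair_measure)
qed

lemma far_sets [measurable]: "- near_diag \<delta> \<in> sets lebesgue2"
  using sets.compl_sets[OF near_diag_sets] by (simp add: space_pair_measure Compl_eq_Diff_UNIV)

lemma weak_density_self: "weak_density p a u u z = gagliardo p a u z"
  by (simp add: weak_density_def gagliardo_def signed_powr_mult_self)

lemma abs_weak_density_le:
  assumes "1 < p"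
  shows "\<bar>weak_density p a u v z\<bar> \<le> gagliardo p a u z + gagliardo p a v z"
proof -
  have "\<bar>weak_density p a u v z\<bar> = \<bar>signed_powr p (u (fst z) - u (snd z)) * (v (fst z) - v (snd z))\<bar> * riesz_ker a (fst z) (snd z)"
    by (simp add: weak_density_def abs_mult)
  also have "\<dots> \<le> (\<bar>u (fst z) - u (snd z)\<bar> powr p + \<bar>v (fst z) - v (snd z)\<bar> powr p) * riesz_ker a (fst z) (snd z)"
    using signed_powr_young[OF assms, of 1] by (intro mult_right_mono) auto
  finally show ?thesis by (simp add: gagliardo_def algebra_simps)
qed

lemma gagliardo_add_le:
  assumes "0 \<le> p"
  shows "gagliardo p a (\<lambda>x. u x + v x) z \<le> 2 powr p * (gagliardo p a u z + gagliardo p a v z)"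
proof -
  have "\<bar>(u (fst z) - u (snd z)) + (v (fst z) - v (snd z))\<bar> powr p \<le>
     2 powr p * (\<bar>u (fst z) - u (snd z)\<bar> powr p + \<bar>v (fst z) - v (snd z)\<bar> powr p)"
    using assms by (rule powr_abs_add_le)
  from mult_right_mono[OF this, of "riesz_ker a (fst z) (snd z)"] show ?thesis
    by (simp add: gagliardo_def algebra_simps)
qed

text \<open>The domain \<open>D\<close> is free because three occur: the domain of the peridynamic
  form, the pairs closer than \<open>\<delta>\<close>, and the whole space.\<close>

lemma integrable_weak_density:
  assumes p: "1 < p" and [measurable]: "u \<in> borel_measurable lebesgue" "v \<in> borel_measurable lebesgue"
    "D \<in> sets lebesgue2"
    and fin: "(\<integral>\<^sup>+ z. indicator D z * ennreal (gagliardo p a u z) \<partial>lebesgue2) < \<infinity>"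
      "(\<integral>\<^sup>+ z. indicator D z * ennreal (gagliardo p a v z) \<partial>lebesgue2) < \<infinity>"
  shows "integrable lebesgue2 (\<lambda>z. indicator D z * weak_density p a u v z)"
proof (rule integrableI_bounded)
  have "(\<integral>\<^sup>+ z. ennreal (norm (indicator D z * weak_density p a u v z)) \<partial>lebesgue2) \<le>
     (\<integral>\<^sup>+ z. indicator D z * ennreal (gagliardo p a u z) + indicator D z * ennreal (gagliardo p a v z) \<partial>lebesgue2)"
    by (intro nn_integral_mono)
      (use abs_weak_density_le[OF p] in \<open>auto simp: abs_mult ennreal_plus[symmetric] simp del: ennreal_plus intro!: ennreal_leI split: split_indicator\<close>)
  also have "\<dots> = (\<integral>\<^sup>+ z. indicator D z * ennreal (gagliardo p a u z) \<partial>lebesgue2) +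
      (\<integral>\<^sup>+ z. indicator D z * ennreal (gagliardo p a v z) \<partial>lebesgue2)"
    by (rule nn_integral_add) measurable
  also have "\<dots> < \<infinity>" using fin by (simp add: ennreal_add_eq_top less_top)
  finally show "(\<integral>\<^sup>+ z. ennreal (norm (indicator D z * weak_density p a u v z)) \<partial>lebesgue2) < \<infinity>" .
qed measurable

text \<open>By Tonelli the inner integral is the mass of the kernel at distance at least
  \<open>\<delta>\<close> from \<open>x\<close>, which is the same for every \<open>x\<close> and
  factors out.\<close>

lemma nn_integral_far_fst:
  fixes g :: "'a::euclidean_space \<Rightarrow> ennreal"
  assumes [measurable]: "g \<in> borel_measurable lebesgue"
  shows "(\<integral>\<^sup>+ z. indicator (- near_diag \<delta>) z * (ennreal (riesz_ker a (fst z) (snd z)) * g (fst z)) \<partial>lebesgue2)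
    = kernel_tail TYPE('a) a \<delta> * (\<integral>\<^sup>+ x. g x \<partial>lebesgue)"
proof -
  have "(\<integral>\<^sup>+ z. indicator (- near_diag \<delta>) z * (ennreal (riesz_ker a (fst z) (snd z)) * g (fst z)) \<partial>lebesgue2)
     = (\<integral>\<^sup>+ x. \<integral>\<^sup>+ y. indicator (- near_diag \<delta>) (x, y) * (ennreal (riesz_ker a x y) * g x) \<partial>lebesgue \<partial>lebesgue)"
    by (subst leb.nn_integral_fst[symmetric]) auto
  also have "\<dots> = (\<integral>\<^sup>+ x. g x * (\<integral>\<^sup>+ y. indicator {y. \<delta> \<le> dist x y} y * ennreal (riesz_ker a x y) \<partial>lebesgue) \<partial>lebesgue)"
  proof (intro nn_integral_cong)
    fix x :: 'a
    have m: "(\<lambda>y. indicator {y. \<delta> \<le> dist x y} y * ennreal (riesz_ker a x y)) \<in> borel_measurable lebesgue"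
      unfolding riesz_ker_def by (intro measurable_completion) measurable
    have "(\<integral>\<^sup>+ y. indicator (- near_diag \<delta>) (x, y) * (ennreal (riesz_ker a x y) * g x) \<partial>lebesgue) =
       (\<integral>\<^sup>+ y. g x * (indicator {y. \<delta> \<le> dist x y} y * ennreal (riesz_ker a x y)) \<partial>lebesgue)"
      by (intro nn_integral_cong) (auto simp: near_diag_def mult_ac split: split_indicator)
    also have "\<dots> = g x * (\<integral>\<^sup>+ y. indicator {y. \<delta> \<le> dist x y} y * ennreal (riesz_ker a x y) \<partial>lebesgue)"
      using m by (rule nn_integral_cmult)
    finally show "(\<integral>\<^sup>+ y. indicator (- near_diag \<delta>) (x, y) * (ennreal (riesz_ker a x y) * g x) \<partial>lebesgue) = \<dots>" .
  qed
  also have "\<dots> = kernel_tail TYPE('a) a \<delta> * (\<integral>\<^sup>+ x. g x \<partial>lebesgue)"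
    unfolding nn_integral_riesz_ker_far by (simp add: nn_integral_multc mult.commute)
  finally show ?thesis .
qed

lemma nn_integral_lebesgue2_swap:
  assumes [measurable]: "f \<in> borel_measurable (lebesgue2 :: ('a::euclidean_space \<times> 'a) measure)"
  shows "(\<integral>\<^sup>+ z. f (prod.swap z) \<partial>lebesgue2) = (\<integral>\<^sup>+ z. f z \<partial>lebesgue2)"
proof -
  have "(\<integral>\<^sup>+ z. f z \<partial>lebesgue2) = (\<integral>\<^sup>+ z. f z \<partial>distr lebesgue2 lebesgue2 (\<lambda>(x, y). (y, x)))"
    by (subst leb2.distr_pair_swap) simp
  also have "\<dots> = (\<integral>\<^sup>+ z. f (prod.swap z) \<partial>lebesgue2)"
    by (subst nn_integral_distr) (auto simp: case_prod_beta prod.swap_def)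
  finally show ?thesis by simp
qed

lemma near_diag_swap [simp]: "prod.swap z \<in> near_diag \<delta> \<longleftrightarrow> z \<in> near_diag \<delta>"
  by (simp add: near_diag_def dist_commute)

lemma nn_integral_far_snd:
  fixes g :: "'a::euclidean_space \<Rightarrow> ennreal"
  assumes [measurable]: "g \<in> borel_measurable lebesgue"
  shows "(\<integral>\<^sup>+ z. indicator (- near_diag \<delta>) z * (ennreal (riesz_ker a (fst z) (snd z)) * g (snd z)) \<partial>lebesgue2)
    = kernel_tail TYPE('a) a \<delta> * (\<integral>\<^sup>+ x. g x \<partial>lebesgue)"
proof -
  have [measurable]: "(\<lambda>z. g (snd z)) \<in> borel_measurable lebesgue2" 
    by (rule measurable_compose[OF measurable_snd]) simp
  have "(\<integral>\<^sup>+ z. indicator (- near_diag \<delta>) z * (ennreal (riesz_ker a (fst z) (snd z)) * g (snd z)) \<partial>lebesgue2)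
    = (\<integral>\<^sup>+ z. indicator (- near_diag \<delta>) (prod.swap z) * (ennreal (riesz_ker a (fst (prod.swap z)) (snd (prod.swap z))) * g (snd (prod.swap z))) \<partial>lebesgue2)"
    by (rule nn_integral_lebesgue2_swap[symmetric]) measurable
  also have "\<dots> = (\<integral>\<^sup>+ z. indicator (- near_diag \<delta>) z * (ennreal (riesz_ker a (fst z) (snd z)) * g (fst z)) \<partial>lebesgue2)"
    by (intro nn_integral_cong) (simp add: riesz_ker_commute indicator_def)
  finally show ?thesis using nn_integral_far_fst[OF assms] by simp
qed

text \<open>The signed counterpart of \<open>nn_integral_far_fst\<close>, for the weak form. That
  lemma applied to the modulus of \<open>g\<close> supplies the integrability on which Fubini
  rests.\<close>

lemma
  fixes g :: "'a::euclidean_space \<Rightarrow> real"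
  assumes g: "integrable lebesgue g" and T: "kernel_tail TYPE('a) a \<delta> < \<infinity>"
  shows integrable_far_fst:
      "integrable lebesgue2 (\<lambda>z. indicator (- near_diag \<delta>) z * (riesz_ker a (fst z) (snd z) * g (fst z)))"
    and integral_far_fst:
      "(\<integral> z. indicator (- near_diag \<delta>) z * (riesz_ker a (fst z) (snd z) * g (fst z)) \<partial>lebesgue2)
         = enn2real (kernel_tail TYPE('a) a \<delta>) * (\<integral> x. g x \<partial>lebesgue)"
proof -
  let ?f = "\<lambda>z::'a\<times>'a. indicator (- near_diag \<delta>) z * (riesz_ker a (fst z) (snd z) * g (fst z))"
  have [measurable]: "g \<in> borel_measurable lebesgue" using g by auto
  have "(\<integral>\<^sup>+ z. ennreal (norm (?f z)) \<partial>lebesgue2) =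
     (\<integral>\<^sup>+ z. indicator (- near_diag \<delta>) z * (ennreal (riesz_ker a (fst z) (snd z)) * ennreal (norm (g (fst z)))) \<partial>lebesgue2)"
    by (intro nn_integral_cong) (auto simp: abs_mult ennreal_mult split: split_indicator)
  also have "\<dots> = kernel_tail TYPE('a) a \<delta> * (\<integral>\<^sup>+ x. norm (g x) \<partial>lebesgue)"
    by (rule nn_integral_far_fst) measurable
  also have "\<dots> < \<infinity>"
    using T g by (auto simp: ennreal_mult_less_top integrable_iff_bounded)
  finally show int: "integrable lebesgue2 ?f"
    by (intro integrableI_bounded) auto
  have inner: "(\<integral> y. indicator {y. \<delta> \<le> dist x y} y * riesz_ker a x y \<partial>lebesgue) = enn2real (kernel_tail TYPE('a) a \<delta>)" for x :: 'a
  proof -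
    have m: "(\<lambda>y. indicator {y. \<delta> \<le> dist x y} y * riesz_ker a x y) \<in> borel_measurable lebesgue"
      unfolding riesz_ker_def by (intro measurable_completion) measurable
    have "(\<integral> y. indicator {y. \<delta> \<le> dist x y} y * riesz_ker a x y \<partial>lebesgue) =
        enn2real (\<integral>\<^sup>+ y. ennreal (indicator {y. \<delta> \<le> dist x y} y * riesz_ker a x y) \<partial>lebesgue)"
      by (rule integral_eq_nn_integral[OF m]) simp
    also have "(\<integral>\<^sup>+ y. ennreal (indicator {y. \<delta> \<le> dist x y} y * riesz_ker a x y) \<partial>lebesgue) = kernel_tail TYPE('a) a \<delta>"
      unfolding nn_integral_riesz_ker_far[of \<delta> x a, symmetric]
      by (intro nn_integral_cong) (auto split: split_indicator)
    finally show ?thesis .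
  qed
  have "(\<integral> z. ?f z \<partial>lebesgue2) = (\<integral> x. \<integral> y. ?f (x, y) \<partial>lebesgue \<partial>lebesgue)"
    using leb2.integral_fst'[OF int] by simp
  also have "\<dots> = (\<integral> x. enn2real (kernel_tail TYPE('a) a \<delta>) * g x \<partial>lebesgue)"
  proof (intro Bochner_Integration.integral_cong refl)
    fix x :: 'a
    have "(\<integral> y. ?f (x, y) \<partial>lebesgue) = (\<integral> y. (indicator {y. \<delta> \<le> dist x y} y * riesz_ker a x y) * g x \<partial>lebesgue)"
      by (intro Bochner_Integration.integral_cong refl) (auto simp: near_diag_def split: split_indicator)
    also have "\<dots> = enn2real (kernel_tail TYPE('a) a \<delta>) * g x"
      by (simp add: inner)
    finally show "(\<integral> y. ?f (x, y) \<partial>lebesgue) = \<dots>" .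
  qed
  finally show "(\<integral> z. ?f z \<partial>lebesgue2) = enn2real (kernel_tail TYPE('a) a \<delta>) * (\<integral> x. g x \<partial>lebesgue)"
    by simp
qed

lemma
  fixes g :: "'a::euclidean_space \<Rightarrow> real"
  assumes g: "integrable lebesgue g" and T: "kernel_tail TYPE('a) a \<delta> < \<infinity>"
  shows integrable_far_snd:
      "integrable lebesgue2 (\<lambda>z. indicator (- near_diag \<delta>) z * (riesz_ker a (fst z) (snd z) * g (snd z)))"
    and integral_far_snd:
      "(\<integral> z. indicator (- near_diag \<delta>) z * (riesz_ker a (fst z) (snd z) * g (snd z)) \<partial>lebesgue2)
         = enn2real (kernel_tail TYPE('a) a \<delta>) * (\<integral> x. g x \<partial>lebesgue)"
proof -
  let ?f = "\<lambda>z::'a\<times>'a. indicator (- near_diag \<delta>) z * (riesz_ker a (fst z) (snd z) * g (fst z))"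
  have eq: "(\<lambda>(x, y). ?f (y, x)) = (\<lambda>z. indicator (- near_diag \<delta>) z * (riesz_ker a (fst z) (snd z) * g (snd z)))"
    by (auto simp: fun_eq_iff near_diag_def riesz_ker_commute dist_commute split: split_indicator)
  show "integrable lebesgue2 (\<lambda>z. indicator (- near_diag \<delta>) z * (riesz_ker a (fst z) (snd z) * g (snd z)))"
    using leb2.integrable_product_swap[OF integrable_far_fst[OF g T]] unfolding eq .
  have "(\<integral>(x,y). ?f (y, x) \<partial>lebesgue2) = integral\<^sup>L lebesgue2 ?f"
    by (rule leb2.integral_product_swap) (rule borel_measurable_integrable[OF integrable_far_fst[OF g T]])
  then show "(\<integral> z. indicator (- near_diag \<delta>) z * (riesz_ker a (fst z) (snd z) * g (snd z)) \<partial>lebesgue2)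
         = enn2real (kernel_tail TYPE('a) a \<delta>) * (\<integral> x. g x \<partial>lebesgue)"
    unfolding eq integral_far_fst[OF g T] .
qed

section \<open>Zero extension beyond a large horizon\<close>

lemma zero_ext_measurable [measurable]:
  assumes [measurable]: "\<Omega> \<in> sets lebesgue" "u \<in> borel_measurable lebesgue"
  shows "zero_ext \<Omega> u \<in> borel_measurable lebesgue"
  unfolding zero_ext_def by measurable

lemma zero_ext_in [simp]: "x \<in> \<Omega> \<Longrightarrow> zero_ext \<Omega> u x = u x"
  and zero_ext_out [simp]: "x \<notin> \<Omega> \<Longrightarrow> zero_ext \<Omega> u x = 0"
  by (simp_all add: zero_ext_def)

lemma zero_ext_zero_ext: "zero_ext \<Omega> (zero_ext \<Omega> u) = zero_ext \<Omega> u"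
  by (auto simp: zero_ext_def fun_eq_iff split: split_indicator)

lemma zero_ext_diff: "zero_ext \<Omega> (\<lambda>x. u x - v x) = (\<lambda>x. zero_ext \<Omega> u x - zero_ext \<Omega> v x)"
  by (auto simp: zero_ext_def algebra_simps)

lemma zero_ext_uminus: "zero_ext \<Omega> (\<lambda>x. - u x) = (\<lambda>x. - zero_ext \<Omega> u x)"
  by (auto simp: zero_ext_def)

lemma Lp_pow_zero_ext: "Lp_pow \<Omega> p (zero_ext \<Omega> u) = Lp_pow \<Omega> p u"
  unfolding Lp_pow_def by (intro nn_integral_cong) (auto split: split_indicator)

lemma Lp_pow_eq_zero_ext: "Lp_pow \<Omega> p u = (\<integral>\<^sup>+ x. ennreal (\<bar>zero_ext \<Omega> u x\<bar> powr p) \<partial>lebesgue)"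
  unfolding Lp_pow_def by (intro nn_integral_cong) (auto simp: zero_ext_def split: split_indicator)

section \<open>The iterated integrals of the definitions as integrals over pairs of points\<close>

lemma seminorm_inf_gagliardo:
  fixes u :: "'a::euclidean_space \<Rightarrow> real"
  assumes [measurable]: "u \<in> borel_measurable lebesgue"
  shows "seminorm_inf_pow s p u = (\<integral>\<^sup>+ z. ennreal (gagliardo p (real DIM('a) + s * p) u z) \<partial>lebesgue2)"
  unfolding seminorm_inf_pow_def
  by (subst leb.nn_integral_fst[symmetric]) (auto simp: gagliardo_def riesz_ker_def)

lemma seminorm_inf_cong_AE:
  assumes "AE x in lebesgue. u x = v x"
  shows "seminorm_inf_pow s p u = seminorm_inf_pow s p v"
  unfolding seminorm_inf_pow_def
proof (intro nn_integral_cong_AE)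
  show "AE x in lebesgue.
       (\<integral>\<^sup>+ y. ennreal (\<bar>u x - u y\<bar> powr p / dist x y powr (real DIM('a) + s * p)) \<partial>lebesgue) =
       (\<integral>\<^sup>+ y. ennreal (\<bar>v x - v y\<bar> powr p / dist x y powr (real DIM('a) + s * p)) \<partial>lebesgue)"
    using assms
  proof eventually_elim
    case (elim x)
    show ?case
      by (intro nn_integral_cong_AE, use assms in eventually_elim) (simp add: elim)
  qed
qed

text \<open>Kept as an iterated Bochner integral, exactly as in \<open>eigenfunction_inf\<close>, so
  that unfolding matches the definition. The passage to pairs of points is made in
  \<open>weak_inf_eq\<close>.\<close>

definition weak_inf :: "real \<Rightarrow> real \<Rightarrow> ('a::euclidean_space \<Rightarrow> real) \<Rightarrow> ('a \<Rightarrow> real) \<Rightarrow> real" where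
  "weak_inf s p u v = (LINT x|lebesgue. LINT y|lebesgue.
           \<bar>u x - u y\<bar> powr (p - 2) * (u x - u y) * (v x - v y) / dist x y powr (real DIM('a) + p * s))"

definition weak_delta :: "real \<Rightarrow> real \<Rightarrow> real \<Rightarrow> 'a::euclidean_space set \<Rightarrow> ('a \<Rightarrow> real) \<Rightarrow> ('a \<Rightarrow> real) \<Rightarrow> real" where
  "weak_delta \<delta> s p \<Omega> u v =
    (LINT x:Omega_delta \<Omega> \<delta>|lebesgue. LINT y:(Omega_delta \<Omega> \<delta> \<inter> ball x \<delta>)|lebesgue.
           \<bar>u x - u y\<bar> powr (p - 2) * (u x - u y) * (v x - v y) / dist x y powr (real DIM('a) + p * s))"

definition weak_rhs :: "real \<Rightarrow> 'a::euclidean_space set \<Rightarrow> ('a \<Rightarrow> real) \<Rightarrow> ('a \<Rightarrow> real) \<Rightarrow> real" where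
  "weak_rhs p \<Omega> u v = (LINT x:\<Omega>|lebesgue. \<bar>u x\<bar> powr (p - 2) * u x * v x)"

lemma weak_rhs_eq: "weak_rhs p \<Omega> u v = (\<integral> x. signed_powr p (zero_ext \<Omega> u x) * zero_ext \<Omega> v x \<partial>lebesgue)"
  unfolding weak_rhs_def set_lebesgue_integral_def signed_powr_def
  by (intro Bochner_Integration.integral_cong refl) (auto simp: zero_ext_def split: split_indicator)

lemma integrable_weak_density_inf:
  fixes u :: "'a::euclidean_space \<Rightarrow> real"
  assumes "1 < p" and u: "u \<in> borel_measurable lebesgue" "seminorm_inf_pow s p u < \<infinity>"
    and v: "v \<in> borel_measurable lebesgue" "seminorm_inf_pow s p v < \<infinity>"
  shows "integrable lebesgue2 (weak_density p (real DIM('a) + s * p) u v)"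
  using integrable_weak_density[of p u v UNIV "real DIM('a) + s * p"] assms
    sets.top[of "lebesgue2 :: ('a \<times> 'a) measure"]
  by (auto simp: seminorm_inf_gagliardo space_pair_measure)

text \<open>A Bochner integral of a non-integrable function is 0 by convention, so the iterated
  integral may be replaced only after integrability over pairs is known; the two finite energies
  provide it.\<close>

lemma weak_inf_eq:
  fixes u :: "'a::euclidean_space \<Rightarrow> real"
  assumes "1 < p" and u: "u \<in> borel_measurable lebesgue" "seminorm_inf_pow s p u < \<infinity>"
    and v: "v \<in> borel_measurable lebesgue" "seminorm_inf_pow s p v < \<infinity>"
  shows "weak_inf s p u v = (\<integral> z. weak_density p (real DIM('a) + s * p) u v z \<partial>lebesgue2)"
  unfolding weak_inf_def leb2.integral_fst'[OF integrable_weak_density_inf[OF assms], symmetric]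
  by (simp add: weak_density_def signed_powr_def riesz_ker_def mult.commute)

lemma weak_inf_self:
  fixes u :: "'a::euclidean_space \<Rightarrow> real"
  assumes "1 < p" and u: "u \<in> borel_measurable lebesgue" "seminorm_inf_pow s p u < \<infinity>"
  shows "weak_inf s p u u = enn2real (seminorm_inf_pow s p u)"
proof -
  have "weak_inf s p u u = (\<integral> z. gagliardo p (real DIM('a) + s * p) u z \<partial>lebesgue2)"
    using weak_inf_eq[OF assms u] by (simp add: weak_density_self)
  also have "\<dots> = enn2real (seminorm_inf_pow s p u)"
    unfolding seminorm_inf_gagliardo[OF u(1)] using u by (intro integral_eq_nn_integral) auto
  finally show ?thesis .
qed

lemma integrable_signed_powr_mult:
  assumes p: "1 < p" and [measurable]: "u \<in> borel_measurable M" "v \<in> borel_measurable M"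
    and fin: "(\<integral>\<^sup>+ x. ennreal (\<bar>u x\<bar> powr p) \<partial>M) < \<infinity>" "(\<integral>\<^sup>+ x. ennreal (\<bar>v x\<bar> powr p) \<partial>M) < \<infinity>"
  shows "integrable M (\<lambda>x. signed_powr p (u x) * v x)"
proof (rule integrableI_bounded)
  have "(\<integral>\<^sup>+ x. ennreal (norm (signed_powr p (u x) * v x)) \<partial>M) \<le> (\<integral>\<^sup>+ x. ennreal (\<bar>u x\<bar> powr p) + ennreal (\<bar>v x\<bar> powr p) \<partial>M)"
    using signed_powr_young[OF p, of 1] by (intro nn_integral_mono)
      (auto simp: ennreal_plus[symmetric] simp del: ennreal_plus intro!: ennreal_leI)
  also have "\<dots> < \<infinity>"
    using fin by (subst nn_integral_add) (auto simp: ennreal_add_eq_top less_top)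
  finally show "(\<integral>\<^sup>+ x. ennreal (norm (signed_powr p (u x) * v x)) \<partial>M) < \<infinity>" .
qed measurable

text \<open>The hypothesis \<open>diam\<close> says that a pair at distance \<open>\<delta>\<close>
  or more has at most one point in \<open>\<Omega>\<close>. It acts through \<open>far_cases\<close>
  and is the source of exact identities instead of estimates.\<close>

locale large_horizon =
  fixes \<Omega> :: "'a::euclidean_space set" and p s \<delta> :: real
  assumes open_\<Omega>: "open \<Omega>" and p: "1 < p" and s: "0 < s" and \<delta>: "0 < \<delta>"
    and diam: "\<And>x y. x \<in> \<Omega> \<Longrightarrow> y \<in> \<Omega> \<Longrightarrow> dist x y < \<delta>"
begin

abbreviation \<Omega>\<delta> :: "'a set" where "\<Omega>\<delta> \<equiv> Omega_delta \<Omega> \<delta>"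

definition E :: "('a \<times> 'a) set" where
  "E = {z. fst z \<in> \<Omega>\<delta> \<and> snd z \<in> \<Omega>\<delta> \<and> dist (fst z) (snd z) < \<delta>}"

lemma kernel_tail_finite: "kernel_tail TYPE('a) (real DIM('a) + s * p) \<delta> < \<infinity>"
proof -
  obtain K where "kernel_tail TYPE('a) (real DIM('a) + s * p) \<delta> \<le> ennreal (K * \<delta> powr (- (s * p)))"
    using kernel_tail_bound[of "s * p"] s p \<delta> by auto
  then show ?thesis by (auto intro: le_less_trans)
qed

lemma kernel_tail_positive: "0 < kernel_tail TYPE('a) (real DIM('a) + s * p) \<delta>"
  using \<delta> by (rule kernel_tail_pos)

lemma sets_\<Omega> [measurable]: "\<Omega> \<in> sets lebesgue"
  using open_\<Omega> by auto

lemma Omega_delta_eq: "\<Omega>\<delta> = (\<Union>x\<in>\<Omega>. ball x \<delta>)"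
  using \<delta> by (auto simp: Omega_delta_def bdry_delta_def)

lemma sets_\<Omega>\<delta> [measurable]: "\<Omega>\<delta> \<in> sets lebesgue"
proof -
  have "open \<Omega>\<delta>" unfolding Omega_delta_eq by blast
  then show ?thesis by auto
qed

lemma sets_E [measurable]: "E \<in> sets lebesgue2"
proof -
  have "{z \<in> space lebesgue2. fst z \<in> \<Omega>\<delta> \<and> snd z \<in> \<Omega>\<delta> \<and> dist (fst z) (snd z :: 'a) < \<delta>} \<in> sets lebesgue2"
    by measurable
  then show ?thesis by (simp add: E_def space_pair_measure)
qed

lemma E_imp_near_diag: "z \<in> E \<Longrightarrow> z \<in> near_diag \<delta>"
  by (simp add: E_def near_diag_def)

text \<open>A point within \<open>\<delta>\<close> of a point of \<open>\<Omega>\<close> lies in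
  \<open>\<Omega>\<close> or in its collar. Hence \<open>E\<close> and
  \<open>near_diag \<delta>\<close> differ only by pairs at which a zero extension vanishes
  twice.\<close>

lemma near_diag_not_E: "z \<in> near_diag \<delta> \<Longrightarrow> z \<notin> E \<Longrightarrow> fst z \<notin> \<Omega> \<and> snd z \<notin> \<Omega>"
  by (auto simp: E_def near_diag_def Omega_delta_def bdry_delta_def dist_commute)

lemma AE_E_zero_ext:
  assumes "AE x in lebesgue. x \<in> bdry_delta \<Omega> \<delta> \<longrightarrow> u x = 0"
  shows "AE z in lebesgue2. z \<in> E \<longrightarrow> u (fst z) = zero_ext \<Omega> u (fst z) \<and> u (snd z) = zero_ext \<Omega> u (snd z)"
  using AE_lebesgue2_fst[OF assms] AE_lebesgue2_snd[OF assms]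
  by eventually_elim (auto simp: E_def zero_ext_def Omega_delta_def split: split_indicator)

lemma seminorm_delta_E:
  assumes [measurable]: "u \<in> borel_measurable lebesgue"
  shows "seminorm_delta_pow \<delta> s p \<Omega> u = (\<integral>\<^sup>+ z. indicator E z * ennreal (gagliardo p (real DIM('a) + s * p) u z) \<partial>lebesgue2)"
proof -
  have "(\<integral>\<^sup>+ z. indicator E z * ennreal (gagliardo p (real DIM('a) + s * p) u z) \<partial>lebesgue2) =
    (\<integral>\<^sup>+ x. \<integral>\<^sup>+ y. indicator E (x, y) * ennreal (gagliardo p (real DIM('a) + s * p) u (x, y)) \<partial>lebesgue \<partial>lebesgue)"
    by (subst leb.nn_integral_fst[symmetric]) auto
  also have "\<dots> = seminorm_delta_pow \<delta> s p \<Omega> u"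
    unfolding seminorm_delta_pow_def
    by (intro nn_integral_cong) (auto simp: E_def gagliardo_def riesz_ker_def split: split_indicator intro!: nn_integral_cong)
  finally show ?thesis by simp
qed

text \<open>On \<open>E\<close> the function agrees almost everywhere with its extension, and the
  additional pairs contribute 0. After this the domain of integration depends on
  \<open>\<delta>\<close> alone and its complement consists of the distant pairs.\<close>

lemma seminorm_delta_near_diag:
  assumes [measurable]: "u \<in> borel_measurable lebesgue"
    and z: "AE x in lebesgue. x \<in> bdry_delta \<Omega> \<delta> \<longrightarrow> u x = 0"
  shows "seminorm_delta_pow \<delta> s p \<Omega> u = (\<integral>\<^sup>+ z. indicator (near_diag \<delta>) z * ennreal (gagliardo p (real DIM('a) + s * p) (zero_ext \<Omega> u) z) \<partial>lebesgue2)"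
  unfolding seminorm_delta_E[OF assms(1)]
proof (rule nn_integral_cong_AE, use AE_E_zero_ext[OF z] in eventually_elim)
  case (elim z)
  show ?case
  proof (cases "z \<in> E")
    case True
    then have "u (fst z) = zero_ext \<Omega> u (fst z)" "u (snd z) = zero_ext \<Omega> u (snd z)"
      using elim by auto
    then have "gagliardo p (real DIM('a) + s * p) u z = gagliardo p (real DIM('a) + s * p) (zero_ext \<Omega> u) z"
      by (simp only: gagliardo_def)
    then show ?thesis using True E_imp_near_diag[OF True] by simp
  next
    case False
    then show ?thesis
      using near_diag_not_E[of z] p by (cases "z \<in> near_diag \<delta>") (auto simp: gagliardo_def)
  qed
qed

lemma far_cases:
  assumes "z \<notin> near_diag \<delta>"
  obtains "fst z \<notin> \<Omega>" | "snd z \<notin> \<Omega>"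
  using diam[of "fst z" "snd z"] assms by (auto simp: near_diag_def)

text \<open>One of the two values is 0, so \<open>\<bar>a - b\<bar> powr p\<close> equals
  \<open>\<bar>a\<bar> powr p + \<bar>b\<bar> powr p\<close> and nothing is lost.\<close>

lemma gagliardo_far:
  assumes "z \<notin> near_diag \<delta>"
  shows "gagliardo p b (zero_ext \<Omega> u) z = riesz_ker b (fst z) (snd z) * \<bar>zero_ext \<Omega> u (fst z)\<bar> powr p
    + riesz_ker b (fst z) (snd z) * \<bar>zero_ext \<Omega> u (snd z)\<bar> powr p"
  using assms by (rule far_cases) (simp_all add: gagliardo_def)

text \<open>The same splitting; when the first point is outside \<open>\<Omega>\<close>, the oddness
  of \<open>signed_powr\<close> cancels the sign of the second difference.\<close>

lemma weak_density_far:
  assumes "z \<notin> near_diag \<delta>"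
  shows "weak_density p b (zero_ext \<Omega> u) (zero_ext \<Omega> v) z = riesz_ker b (fst z) (snd z) * (signed_powr p (zero_ext \<Omega> u (fst z)) * zero_ext \<Omega> v (fst z))
     + riesz_ker b (fst z) (snd z) * (signed_powr p (zero_ext \<Omega> u (snd z)) * zero_ext \<Omega> v (snd z))"
  using assms by (rule far_cases) (simp_all add: weak_density_def signed_powr_minus)

text \<open>Close pairs give the peridynamic energy. Distant pairs split by which point lies in
  \<open>\<Omega>\<close>; the two halves are equal, whence the factor 2.\<close>

lemma seminorm_inf_zero_ext:
  assumes [measurable]: "u \<in> borel_measurable lebesgue"
    and z: "AE x in lebesgue. x \<in> bdry_delta \<Omega> \<delta> \<longrightarrow> u x = 0"
  shows "seminorm_inf_pow s p (zero_ext \<Omega> u) = seminorm_delta_pow \<delta> s p \<Omega> u + 2 * kernel_tail TYPE('a) (real DIM('a) + s * p) \<delta> * Lp_pow \<Omega> p u"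
proof -
  let ?w = "zero_ext \<Omega> u"
  let ?k = "\<lambda>z. ennreal (riesz_ker (real DIM('a) + s * p) (fst z) (snd z))"
  have "seminorm_inf_pow s p ?w = (\<integral>\<^sup>+ z. indicator (near_diag \<delta>) z * ennreal (gagliardo p (real DIM('a) + s * p) ?w z)
     + (indicator (- near_diag \<delta>) z * (?k z * ennreal (\<bar>?w (fst z)\<bar> powr p))
     + indicator (- near_diag \<delta>) z * (?k z * ennreal (\<bar>?w (snd z)\<bar> powr p))) \<partial>lebesgue2)"
    unfolding seminorm_inf_gagliardo[OF zero_ext_measurable[OF sets_\<Omega> assms(1)]]
    by (intro nn_integral_cong) (auto simp: gagliardo_far ennreal_mult[symmetric] split: split_indicator)
  also have "\<dots> = seminorm_delta_pow \<delta> s p \<Omega> u + (kernel_tail TYPE('a) (real DIM('a) + s * p) \<delta> * Lp_pow \<Omega> p u + kernel_tail TYPE('a) (real DIM('a) + s * p) \<delta> * Lp_pow \<Omega> p u)"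
    unfolding seminorm_delta_near_diag[OF assms] Lp_pow_eq_zero_ext
    by (simp add: nn_integral_add nn_integral_far_fst[of "\<lambda>x. ennreal (\<bar>?w x\<bar> powr p)"]
        nn_integral_far_snd[of "\<lambda>x. ennreal (\<bar>?w x\<bar> powr p)"])
  finally show ?thesis by (simp add: mult_2 distrib_right mult.assoc)
qed

lemma weak_delta_E:
  assumes i: "integrable lebesgue2 (\<lambda>z. indicator E z * weak_density p (real DIM('a) + s * p) u v z)"
  shows "weak_delta \<delta> s p \<Omega> u v = (\<integral> z. indicator E z * weak_density p (real DIM('a) + s * p) u v z \<partial>lebesgue2)"
proof -
  have "(\<integral> z. indicator E z * weak_density p (real DIM('a) + s * p) u v z \<partial>lebesgue2) =
     (\<integral> x. \<integral> y. indicator E (x, y) * weak_density p (real DIM('a) + s * p) u v (x, y) \<partial>lebesgue \<partial>lebesgue)"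
    using leb2.integral_fst'[OF i] by simp
  also have "\<dots> = weak_delta \<delta> s p \<Omega> u v"
    unfolding weak_delta_def set_lebesgue_integral_def
    by (intro Bochner_Integration.integral_cong refl)
      (auto simp: E_def weak_density_def signed_powr_def riesz_ker_def mult.commute[of s] split: split_indicator intro!: Bochner_Integration.integral_cong)
  finally show ?thesis by simp
qed

text \<open>The same division into close and distant pairs. The facts \<open>inear\<close> and
  \<open>ig\<close> allow the signed integral to be split, and \<open>iE\<close> identifies the
  close part with the iterated form. The constant is that of the energy identity, so an eigenvalue
  is merely shifted.\<close>

lemma weak_inf_zero_ext:
  assumes u[measurable]: "u \<in> borel_measurable lebesgue" and uz: "AE x in lebesgue. x \<in> bdry_delta \<Omega> \<delta> \<longrightarrow> u x = 0"
    and v[measurable]: "v \<in> borel_measurable lebesgue" and vz: "AE x in lebesgue. x \<in> bdry_delta \<Omega> \<delta> \<longrightarrow> v x = 0"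
    and fin: "seminorm_delta_pow \<delta> s p \<Omega> u < \<infinity>" "seminorm_delta_pow \<delta> s p \<Omega> v < \<infinity>"
      "Lp_pow \<Omega> p u < \<infinity>" "Lp_pow \<Omega> p v < \<infinity>"
  shows "weak_inf s p (zero_ext \<Omega> u) (zero_ext \<Omega> v) = weak_delta \<delta> s p \<Omega> u v + 2 * enn2real (kernel_tail TYPE('a) (real DIM('a) + s * p) \<delta>) * weak_rhs p \<Omega> u v"
proof -
  let ?u = "zero_ext \<Omega> u" and ?v = "zero_ext \<Omega> v"
  let ?g = "\<lambda>x. signed_powr p (?u x) * ?v x"
  let ?k = "\<lambda>z. riesz_ker (real DIM('a) + s * p) (fst z) (snd z)"
  have iE: "integrable lebesgue2 (\<lambda>z. indicator E z * weak_density p (real DIM('a) + s * p) u v z)"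
    by (rule integrable_weak_density) (use fin p in \<open>auto simp: seminorm_delta_E\<close>)
  have inear: "integrable lebesgue2 (\<lambda>z. indicator (near_diag \<delta>) z * weak_density p (real DIM('a) + s * p) ?u ?v z)"
    by (rule integrable_weak_density) (use fin p in \<open>auto simp: seminorm_delta_near_diag uz vz\<close>)
  have ig: "integrable lebesgue ?g"
    by (rule integrable_signed_powr_mult) (use fin p in \<open>auto simp: Lp_pow_eq_zero_ext\<close>)
  have Tf: "kernel_tail TYPE('a) (real DIM('a) + s * p) \<delta> < \<infinity>" by (rule kernel_tail_finite)
  have "seminorm_inf_pow s p ?u < \<infinity>" "seminorm_inf_pow s p ?v < \<infinity>"
    using fin Tf by (auto simp: seminorm_inf_zero_ext uz vz ennreal_mult_less_top)
  then have "weak_inf s p ?u ?v = (\<integral> z. weak_density p (real DIM('a) + s * p) ?u ?v z \<partial>lebesgue2)"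
    by (intro weak_inf_eq p zero_ext_measurable sets_\<Omega> u v)
  also have "\<dots> = (\<integral> z. indicator (near_diag \<delta>) z * weak_density p (real DIM('a) + s * p) ?u ?v z + (indicator (- near_diag \<delta>) z * (?k z * ?g (fst z))
     + indicator (- near_diag \<delta>) z * (?k z * ?g (snd z))) \<partial>lebesgue2)"
    by (intro Bochner_Integration.integral_cong refl) (auto simp: weak_density_far split: split_indicator)
  also have "\<dots> = (\<integral> z. indicator (near_diag \<delta>) z * weak_density p (real DIM('a) + s * p) ?u ?v z \<partial>lebesgue2)
     + (enn2real (kernel_tail TYPE('a) (real DIM('a) + s * p) \<delta>) * (\<integral> x. ?g x \<partial>lebesgue) + enn2real (kernel_tail TYPE('a) (real DIM('a) + s * p) \<delta>) * (\<integral> x. ?g x \<partial>lebesgue))"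
    using inear integrable_far_fst[OF ig Tf] integrable_far_snd[OF ig Tf]
    by (simp add: integral_far_fst[OF ig Tf] integral_far_snd[OF ig Tf])
  also have "(\<integral> z. indicator (near_diag \<delta>) z * weak_density p (real DIM('a) + s * p) ?u ?v z \<partial>lebesgue2) = (\<integral> z. indicator E z * weak_density p (real DIM('a) + s * p) u v z \<partial>lebesgue2)"
  proof (rule integral_cong_AE)
    show "AE z in lebesgue2. indicator (near_diag \<delta>) z * weak_density p (real DIM('a) + s * p) ?u ?v z = indicator E z * weak_density p (real DIM('a) + s * p) u v z"
      using AE_E_zero_ext[OF uz] AE_E_zero_ext[OF vz]
    proof eventually_elim
      case (elim z)
      show ?case
      proof (cases "z \<in> E")
        case True
        then have "u (fst z) = ?u (fst z)" "u (snd z) = ?u (snd z)" "v (fst z) = ?v (fst z)" "v (snd z) = ?v (snd z)"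
          using elim by auto
        then have "weak_density p (real DIM('a) + s * p) u v z = weak_density p (real DIM('a) + s * p) ?u ?v z"
          by (simp only: weak_density_def)
        then show ?thesis using True E_imp_near_diag[OF True] by simp
      next
        case False
        then show ?thesis
          using near_diag_not_E[of z] by (cases "z \<in> near_diag \<delta>") (auto simp: weak_density_def)
      qed
    qed
  qed measurable
  finally show ?thesis
    by (simp add: weak_delta_E[OF iE] weak_rhs_eq)
qed

end

section \<open>Comparison of the minimax values\<close>

lemma gagliardo_uminus: "gagliardo p a (\<lambda>x. - v x) z = gagliardo p a v z"
  by (simp add: gagliardo_def abs_minus_commute)

lemma gagliardo_diff_le:
  assumes "0 \<le> p"
  shows "gagliardo p a (\<lambda>x. u x - v x) z \<le> 2 powr p * (gagliardo p a u z + gagliardo p a v z)"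
  using gagliardo_add_le[OF assms, of a u "\<lambda>x. - v x" z] by (simp add: gagliardo_uminus)

text \<open>\<open>w\<close> is abstract under a pointwise bound, so that the estimate serves
  differences (\<open>X0_delta_diff\<close>) as well as sums
  (\<open>compact_seminorm_bdd\<close>).\<close>

lemma nn_integral_gagliardo_le:
  assumes w: "\<And>z. gagliardo p a w z \<le> 2 powr p * (gagliardo p a u z + gagliardo p a v z)"
    and [measurable]: "u \<in> borel_measurable lebesgue" "v \<in> borel_measurable lebesgue" "D \<in> sets lebesgue2"
  shows "(\<integral>\<^sup>+ z. indicator D z * ennreal (gagliardo p a w z) \<partial>lebesgue2) \<le>
    ennreal (2 powr p) * ((\<integral>\<^sup>+ z. indicator D z * ennreal (gagliardo p a u z) \<partial>lebesgue2)
      + (\<integral>\<^sup>+ z. indicator D z * ennreal (gagliardo p a v z) \<partial>lebesgue2))"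
proof -
  have "(\<integral>\<^sup>+ z. indicator D z * ennreal (gagliardo p a w z) \<partial>lebesgue2) \<le>
    (\<integral>\<^sup>+ z. ennreal (2 powr p) * (indicator D z * ennreal (gagliardo p a u z) + indicator D z * ennreal (gagliardo p a v z)) \<partial>lebesgue2)"
  proof (intro nn_integral_mono)
    fix z
    show "indicator D z * ennreal (gagliardo p a w z) \<le>
      ennreal (2 powr p) * (indicator D z * ennreal (gagliardo p a u z) + indicator D z * ennreal (gagliardo p a v z))"
      using ennreal_leI[OF w[of z]] by (auto simp: ennreal_mult split: split_indicator)
  qed
  then show ?thesis by (simp add: nn_integral_cmult nn_integral_add)
qed

lemma seminorm_inf_le:
  fixes u :: "'a::euclidean_space \<Rightarrow> real"
  assumes w: "\<And>z. gagliardo p (real DIM('a) + s * p) w z \<le> 2 powr p * (gagliardo p (real DIM('a) + s * p) u z + gagliardo p (real DIM('a) + s * p) v z)"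
    and [measurable]: "u \<in> borel_measurable lebesgue" "v \<in> borel_measurable lebesgue" "w \<in> borel_measurable lebesgue"
  shows "seminorm_inf_pow s p w \<le> ennreal (2 powr p) * (seminorm_inf_pow s p u + seminorm_inf_pow s p v)"
  using nn_integral_gagliardo_le[OF w assms(2,3), of UNIV] sets.top[of "lebesgue2 :: ('a \<times> 'a) measure"]
  by (simp add: seminorm_inf_gagliardo space_pair_measure)

lemma Lp_pow_diff_le:
  assumes p: "0 \<le> p" and [measurable]: "E \<in> sets lebesgue" "u \<in> borel_measurable lebesgue" "v \<in> borel_measurable lebesgue"
  shows "Lp_pow E p (\<lambda>x. u x - v x) \<le> ennreal (2 powr p) * (Lp_pow E p u + Lp_pow E p v)"
proof -
  have "Lp_pow E p (\<lambda>x. u x - v x) \<le> (\<integral>\<^sup>+ x. ennreal (2 powr p) *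
      (indicator E x * ennreal (\<bar>u x\<bar> powr p) + indicator E x * ennreal (\<bar>v x\<bar> powr p)) \<partial>lebesgue)"
    unfolding Lp_pow_def
  proof (intro nn_integral_mono)
    fix x
    have "\<bar>u x - v x\<bar> powr p \<le> 2 powr p * (\<bar>u x\<bar> powr p + \<bar>v x\<bar> powr p)"
      using powr_abs_add_le[OF p, of "u x" "- v x"] by simp
    from ennreal_leI[OF this]
    show "indicator E x * ennreal (\<bar>u x - v x\<bar> powr p) \<le> ennreal (2 powr p) *
      (indicator E x * ennreal (\<bar>u x\<bar> powr p) + indicator E x * ennreal (\<bar>v x\<bar> powr p))"
      by (auto simp: ennreal_mult split: split_indicator)
  qed
  then show ?thesis by (simp add: nn_integral_cmult nn_integral_add Lp_pow_def)
qed

lemma tendsto_powr_zero_iff: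
  fixes f :: "nat \<Rightarrow> real"
  assumes "\<And>n. 0 \<le> f n" "0 < q"
  shows "(\<lambda>n. f n powr q) \<longlonglongrightarrow> 0 \<longleftrightarrow> f \<longlonglongrightarrow> 0"
proof
  assume "f \<longlonglongrightarrow> 0"
  then have "(\<lambda>n. f n powr q) \<longlonglongrightarrow> 0 powr q"
    using assms by (intro tendsto_powr') auto
  then show "(\<lambda>n. f n powr q) \<longlonglongrightarrow> 0" by simp
next
  assume "(\<lambda>n. f n powr q) \<longlonglongrightarrow> 0"
  then have "(\<lambda>n. (f n powr q) powr (1 / q)) \<longlonglongrightarrow> 0 powr (1 / q)"
    using assms by (intro tendsto_powr') auto
  then show "f \<longlonglongrightarrow> 0" using assms by (simp add: powr_powr)
qed

lemma tendsto_add_zero_iff: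
  fixes f g :: "nat \<Rightarrow> real"
  assumes "\<And>n. 0 \<le> f n" "\<And>n. 0 \<le> g n"
  shows "(\<lambda>n. f n + g n) \<longlonglongrightarrow> 0 \<longleftrightarrow> f \<longlonglongrightarrow> 0 \<and> g \<longlonglongrightarrow> 0"
proof
  assume *: "(\<lambda>n. f n + g n) \<longlonglongrightarrow> 0"
  show "f \<longlonglongrightarrow> 0 \<and> g \<longlonglongrightarrow> 0"
    by (intro conjI tendsto_sandwich[OF _ _ tendsto_const *]) (use assms in \<open>auto intro!: always_eventually\<close>)
next
  assume "f \<longlonglongrightarrow> 0 \<and> g \<longlonglongrightarrow> 0"
  then show "(\<lambda>n. f n + g n) \<longlonglongrightarrow> 0" using tendsto_add[of f 0 _ g 0] by simp
qed

lemma cSUP_add_const: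
  fixes f :: "'b \<Rightarrow> real"
  assumes "A \<noteq> {}" "bdd_above (f ` A)"
  shows "(SUP x\<in>A. f x + c) = (SUP x\<in>A. f x) + c"
proof (rule antisym)
  have b: "bdd_above ((\<lambda>x. f x + c) ` A)"
    using assms(2) by (auto simp: bdd_above_def) (metis add_right_mono)
  show "(SUP x\<in>A. f x + c) \<le> (SUP x\<in>A. f x) + c"
    using assms by (intro cSUP_least add_right_mono cSUP_upper) auto
  have "(SUP x\<in>A. f x) \<le> (SUP x\<in>A. f x + c) - c"
  proof (rule cSUP_least[OF assms(1)])
    fix x assume "x \<in> A"
    then show "f x \<le> (SUP x\<in>A. f x + c) - c"
      using cSUP_upper[OF _ b, of x] by linarith
  qed
  then show "(SUP x\<in>A. f x) + c \<le> (SUP x\<in>A. f x + c)" by linarith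
qed

lemma cInf_add_const:
  fixes S :: "real set"
  assumes "S \<noteq> {}" "bdd_below S"
  shows "Inf ((\<lambda>m. m + c) ` S) = Inf S + c"
proof (rule antisym)
  have b: "bdd_below ((\<lambda>m. m + c) ` S)"
    using assms(2) by (auto simp: bdd_below_def) (metis add_right_mono)
  show "Inf S + c \<le> Inf ((\<lambda>m. m + c) ` S)"
    using assms by (intro cINF_greatest add_right_mono cInf_lower) auto
  have "Inf ((\<lambda>m. m + c) ` S) - c \<le> Inf S"
  proof (rule cInf_greatest[OF assms(1)])
    fix x assume "x \<in> S"
    then show "Inf ((\<lambda>m. m + c) ` S) - c \<le> x"
      using cINF_lower[OF b, of x] by linarith
  qed
  then show "Inf ((\<lambda>m. m + c) ` S) \<le> Inf S + c" by linarith
qed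

text \<open>Monotonicity of the genus under odd continuous maps, with the composition left to the
  caller. If \<open>A'\<close> has no sphere map at all, its genus is infinite and the claim is
  trivial.\<close>

lemma genus_mono:
  assumes "\<And>k h. odd_sphere_map d' A' k h \<Longrightarrow> \<exists>h'. odd_sphere_map d A k h'"
  shows "genus d A \<le> genus d' A'"
proof (cases "\<exists>k h. odd_sphere_map d' A' k h")
  case True
  then have "\<exists>h. odd_sphere_map d' A' (LEAST k. \<exists>h. odd_sphere_map d' A' k h) h"
    by (rule LeastI_ex)
  then have "\<exists>h'. odd_sphere_map d A (LEAST k. \<exists>h. odd_sphere_map d' A' k h) h'"
    using assms by blast
  then have "\<exists>k h. odd_sphere_map d A k h"
    "(LEAST k. \<exists>h. odd_sphere_map d A k h) \<le> (LEAST k. \<exists>h. odd_sphere_map d' A' k h)"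
    by (auto intro: Least_le)
  then show ?thesis using True by (auto simp: genus_def)
qed (simp add: genus_def)

text \<open>For \<open>k \<ge> 1\<close> this forces competitors to be nonempty, which the
  real-valued supremum requires.\<close>

lemma genus_empty: "genus d {} = 0"
proof -
  have "odd_sphere_map d {} 0 h" for h
    by (simp add: odd_sphere_map_def)
  then have "(LEAST k. \<exists>h. odd_sphere_map d {} k h) = 0" "\<exists>k h. odd_sphere_map d {} k h"
    by (blast intro: Least_eq_0)+
  then show ?thesis by (simp add: genus_def enat_0)
qed

text \<open>Naming the set of competitor values allows the comparison to be an equality of sets,
  which remains meaningful when there are no competitors.\<close>

definition minimax_delta :: "real \<Rightarrow> real \<Rightarrow> real \<Rightarrow> 'a::euclidean_space set \<Rightarrow> nat \<Rightarrow> real set" where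
  "minimax_delta \<delta> s p \<Omega> k = {m. \<exists>A. A \<subseteq> {u \<in> X0_delta \<delta> s p \<Omega>. Lp_pow \<Omega> p u = 1} \<and>
       symmetric_set A \<and> compact_wrt (dist_delta \<delta> s p \<Omega>) A \<and>
       genus (dist_delta \<delta> s p \<Omega>) A \<ge> enat k \<and>
       m = (SUP v\<in>A. enn2real (seminorm_delta_pow \<delta> s p \<Omega> v))}"

definition minimax_inf :: "real \<Rightarrow> real \<Rightarrow> 'a::euclidean_space set \<Rightarrow> nat \<Rightarrow> real set" where
  "minimax_inf s p \<Omega> k = {m. \<exists>A. A \<subseteq> {u \<in> X0_inf s p \<Omega>. Lp_pow \<Omega> p u = 1} \<and>
       symmetric_set A \<and> compact_wrt (dist_inf s p) A \<and>
       genus (dist_inf s p) A \<ge> enat k \<and>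
       m = (SUP v\<in>A. enn2real (seminorm_inf_pow s p v))}"

section \<open>Transport of competitors between the two problems\<close>

context large_horizon
begin

lemma X0_deltaD:
  assumes "u \<in> X0_delta \<delta> s p \<Omega>"
  shows "u \<in> borel_measurable lebesgue" "AE x in lebesgue. x \<in> bdry_delta \<Omega> \<delta> \<longrightarrow> u x = 0"
    "seminorm_delta_pow \<delta> s p \<Omega> u < \<infinity>" "Lp_pow \<Omega> p u < \<infinity>"
proof -
  show "u \<in> borel_measurable lebesgue" "AE x in lebesgue. x \<in> bdry_delta \<Omega> \<delta> \<longrightarrow> u x = 0"
    "seminorm_delta_pow \<delta> s p \<Omega> u < \<infinity>"
    using assms by (auto simp: X0_delta_def)
  have "Lp_pow \<Omega> p u \<le> Lp_pow \<Omega>\<delta> p u"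
    unfolding Lp_pow_def by (intro nn_integral_mono) (auto simp: Omega_delta_def split: split_indicator)
  then show "Lp_pow \<Omega> p u < \<infinity>" using assms by (auto simp: X0_delta_def)
qed

lemma Lp_pow_Omega_delta:
  assumes "AE x in lebesgue. x \<in> bdry_delta \<Omega> \<delta> \<longrightarrow> u x = 0"
  shows "Lp_pow \<Omega>\<delta> p u = Lp_pow \<Omega> p u"
  unfolding Lp_pow_def
  by (intro nn_integral_cong_AE, use assms in eventually_elim) (auto simp: Omega_delta_def split: split_indicator)

lemma X0_delta_diff:
  assumes "u \<in> X0_delta \<delta> s p \<Omega>" "v \<in> X0_delta \<delta> s p \<Omega>"
  shows "(\<lambda>x. u x - v x) \<in> X0_delta \<delta> s p \<Omega>"
proof -
  note u = X0_deltaD[OF assms(1)] and v = X0_deltaD[OF assms(2)]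
  have [measurable]: "u \<in> borel_measurable lebesgue" "v \<in> borel_measurable lebesgue" using u v by auto
  have z: "AE x in lebesgue. x \<in> bdry_delta \<Omega> \<delta> \<longrightarrow> u x - v x = 0"
    using u(2) v(2) by eventually_elim auto
  have "seminorm_delta_pow \<delta> s p \<Omega> (\<lambda>x. u x - v x) \<le>
      ennreal (2 powr p) * (seminorm_delta_pow \<delta> s p \<Omega> u + seminorm_delta_pow \<delta> s p \<Omega> v)"
    using nn_integral_gagliardo_le[OF gagliardo_diff_le, of p, OF _ u(1) v(1) sets_E] p by (simp add: seminorm_delta_E)
  also have "\<dots> < \<infinity>" using u v by (simp add: ennreal_mult_less_top)
  finally have 1: "seminorm_delta_pow \<delta> s p \<Omega> (\<lambda>x. u x - v x) < \<infinity>" .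
  have "Lp_pow \<Omega> p (\<lambda>x. u x - v x) \<le> ennreal (2 powr p) * (Lp_pow \<Omega> p u + Lp_pow \<Omega> p v)"
    by (intro Lp_pow_diff_le) (use p in auto)
  also have "\<dots> < \<infinity>" using u v by (simp add: ennreal_mult_less_top)
  finally show ?thesis using 1 z by (simp add: X0_delta_def Lp_pow_Omega_delta)
qed

lemma zero_ext_in_X0_inf:
  assumes "u \<in> X0_delta \<delta> s p \<Omega>"
  shows "zero_ext \<Omega> u \<in> X0_inf s p \<Omega>"
proof -
  note u = X0_deltaD[OF assms]
  have "seminorm_inf_pow s p (zero_ext \<Omega> u) < \<infinity>"
    using u kernel_tail_finite by (simp add: seminorm_inf_zero_ext ennreal_mult_less_top)
  then show ?thesis using u(1) by (simp add: X0_inf_def zero_ext_measurable)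
qed

lemma X0_inf_AE_zero_ext:
  assumes "u \<in> X0_inf s p \<Omega>"
  shows "AE x in lebesgue. u x = zero_ext \<Omega> u x"
proof -
  have "AE x in lebesgue. x \<notin> \<Omega> \<longrightarrow> u x = 0" using assms by (auto simp: X0_inf_def)
  then show ?thesis by eventually_elim (auto simp: zero_ext_def split: split_indicator)
qed

lemma seminorm_inf_X0_inf:
  assumes "u \<in> X0_inf s p \<Omega>"
  shows "seminorm_inf_pow s p u = seminorm_delta_pow \<delta> s p \<Omega> u +
    2 * kernel_tail TYPE('a) (real DIM('a) + s * p) \<delta> * Lp_pow \<Omega> p u"
proof -
  have "AE x in lebesgue. x \<notin> \<Omega> \<longrightarrow> u x = 0" using assms by (auto simp: X0_inf_def)
  then have "AE x in lebesgue. x \<in> bdry_delta \<Omega> \<delta> \<longrightarrow> u x = 0"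
    by eventually_elim (auto simp: bdry_delta_def)
  moreover have "u \<in> borel_measurable lebesgue" using assms by (auto simp: X0_inf_def)
  ultimately show ?thesis
    using seminorm_inf_zero_ext[of u] seminorm_inf_cong_AE[OF X0_inf_AE_zero_ext[OF assms]] by simp
qed

text \<open>Membership in \<open>X0_inf\<close> contains no integrability of \<open>u\<close>
  itself. It comes from the energy identity: the positive multiple \<open>2 T(\<delta>)\<close> of
  the norm power is bounded by the finite Gagliardo energy.\<close>

lemma X0_inf_subset: "X0_inf s p \<Omega> \<subseteq> X0_delta \<delta> s p \<Omega>"
proof
  fix u assume u: "u \<in> X0_inf s p \<Omega>"
  then have z: "AE x in lebesgue. x \<notin> \<Omega> \<longrightarrow> u x = 0" by (auto simp: X0_inf_def)
  have z': "AE x in lebesgue. x \<in> bdry_delta \<Omega> \<delta> \<longrightarrow> u x = 0"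
    using z by eventually_elim (auto simp: bdry_delta_def)
  have "seminorm_inf_pow s p u < \<infinity>" using u by (auto simp: X0_inf_def)
  then have f: "seminorm_delta_pow \<delta> s p \<Omega> u < \<infinity>"
    "2 * kernel_tail TYPE('a) (real DIM('a) + s * p) \<delta> * Lp_pow \<Omega> p u < \<infinity>"
    unfolding seminorm_inf_X0_inf[OF u] by (auto simp: less_top)
  then have "Lp_pow \<Omega> p u < \<infinity>"
    using kernel_tail_positive by (auto simp: ennreal_mult_less_top ennreal_mult_eq_top_iff)
  then show "u \<in> X0_delta \<delta> s p \<Omega>"
    using u f z' by (simp add: X0_delta_def X0_inf_def Lp_pow_Omega_delta)
qed

lemma dist_inf_zero_ext:
  assumes "u \<in> X0_inf s p \<Omega>" "v \<in> X0_inf s p \<Omega>"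
  shows "dist_inf s p (zero_ext \<Omega> u) (zero_ext \<Omega> v) = dist_inf s p u v"
proof -
  have "AE x in lebesgue. zero_ext \<Omega> u x - zero_ext \<Omega> v x = u x - v x"
    using X0_inf_AE_zero_ext[OF assms(1)] X0_inf_AE_zero_ext[OF assms(2)] by eventually_elim simp
  then show ?thesis unfolding dist_inf_def by (simp add: seminorm_inf_cong_AE)
qed

lemma enn2real_seminorm_inf_zero_ext:
  assumes "u \<in> X0_delta \<delta> s p \<Omega>"
  shows "enn2real (seminorm_inf_pow s p (zero_ext \<Omega> u)) = enn2real (seminorm_delta_pow \<delta> s p \<Omega> u) +
    2 * enn2real (kernel_tail TYPE('a) (real DIM('a) + s * p) \<delta>) * enn2real (Lp_pow \<Omega> p u)"
  using X0_deltaD[OF assms] kernel_tail_finite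
  by (simp add: seminorm_inf_zero_ext enn2real_plus ennreal_mult_less_top enn2real_mult)

lemma enn2real_kernel_tail_positive: "0 < enn2real (kernel_tail TYPE('a) (real DIM('a) + s * p) \<delta>)"
  using kernel_tail_positive kernel_tail_finite by (simp add: enn2real_positive_iff)

text \<open>For a difference with norm power \<open>L\<close> and energy \<open>S\<close>, one
  distance is \<open>L powr (1 / p) + S powr (1 / p)\<close> and the other
  \<open>(S + c * L) powr (1 / p)\<close> with \<open>c = 2 T(\<delta>) > 0\<close>. Either is a
  null sequence exactly when both \<open>L\<close> and \<open>S\<close> are.\<close>

lemma dist_delta_tendsto_iff:
  assumes f: "\<And>n. f n \<in> X0_delta \<delta> s p \<Omega>" and u: "u \<in> X0_delta \<delta> s p \<Omega>"
  shows "(\<lambda>n. dist_delta \<delta> s p \<Omega> (f n) u) \<longlonglongrightarrow> 0 \<longleftrightarrow> (\<lambda>n. dist_inf s p (zero_ext \<Omega> (f n)) (zero_ext \<Omega> u)) \<longlonglongrightarrow> 0"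
proof -
  define w where "w n = (\<lambda>x. f n x - u x)" for n
  have w: "w n \<in> X0_delta \<delta> s p \<Omega>" for n
    unfolding w_def by (intro X0_delta_diff f u)
  let ?L = "\<lambda>n. enn2real (Lp_pow \<Omega> p (w n))" and ?S = "\<lambda>n. enn2real (seminorm_delta_pow \<delta> s p \<Omega> (w n))"
  let ?c = "2 * enn2real (kernel_tail TYPE('a) (real DIM('a) + s * p) \<delta>)"
  have q: "0 < 1 / p" and c: "0 < ?c" using p enn2real_kernel_tail_positive by auto
  have 1: "dist_delta \<delta> s p \<Omega> (f n) u = ?L n powr (1 / p) + ?S n powr (1 / p)" for n
    unfolding dist_delta_def w_def[symmetric] by (simp add: Lp_pow_Omega_delta X0_deltaD(2)[OF w])
  have 2: "dist_inf s p (zero_ext \<Omega> (f n)) (zero_ext \<Omega> u) = (?S n + ?c * ?L n) powr (1 / p)" for n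
    unfolding dist_inf_def zero_ext_diff[symmetric] w_def[symmetric] by (simp add: enn2real_seminorm_inf_zero_ext[OF w])
  have cL: "(\<lambda>n. ?c * ?L n) \<longlonglongrightarrow> 0 \<longleftrightarrow> ?L \<longlonglongrightarrow> 0"
    using c tendsto_mult_left_iff[of ?c ?L 0] by simp
  show ?thesis
    unfolding 1 2 using q c
    by (simp add: tendsto_powr_zero_iff tendsto_add_zero_iff cL conj_commute)
qed

text \<open>Needed because the supremum is taken in the reals. A sequence of energies above
  \<open>n\<close> would have a subsequence converging in the distance, and the quasi-triangle
  inequality bounds the energies along it.\<close>

lemma compact_seminorm_bdd:
  assumes A: "A \<subseteq> X0_delta \<delta> s p \<Omega>" and c: "compact_wrt (dist_delta \<delta> s p \<Omega>) A"
  shows "bdd_above ((\<lambda>v. enn2real (seminorm_delta_pow \<delta> s p \<Omega> v)) ` A)"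
proof (rule ccontr)
  assume n: "\<not> ?thesis"
  have "\<exists>v\<in>A. real n < enn2real (seminorm_delta_pow \<delta> s p \<Omega> v)" for n
    using n unfolding bdd_above_def by (force simp: not_le)
  then obtain f where f: "\<And>n. f n \<in> A" "\<And>n. real n < enn2real (seminorm_delta_pow \<delta> s p \<Omega> (f n))"
    by metis
  obtain r u where r: "strict_mono r" "u \<in> A" "(\<lambda>n. dist_delta \<delta> s p \<Omega> (f (r n)) u) \<longlonglongrightarrow> 0"
    using c f(1) unfolding compact_wrt_def by metis
  let ?S = "\<lambda>v. enn2real (seminorm_delta_pow \<delta> s p \<Omega> v)"
  have le: "?S (f n) \<le> 2 powr p * (?S (\<lambda>x. f n x - u x) + ?S u)" for n
  proof -
    have fn: "f n \<in> X0_delta \<delta> s p \<Omega>" and u: "u \<in> X0_delta \<delta> s p \<Omega>" using f(1) r(2) A by auto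
    note d = X0_deltaD[OF X0_delta_diff[OF fn u]]
    have g: "gagliardo p b (f n) z \<le> 2 powr p * (gagliardo p b (\<lambda>x. f n x - u x) z + gagliardo p b u z)" for b z
      using gagliardo_add_le[of p b "\<lambda>x. f n x - u x" u z] p by simp
    have "seminorm_delta_pow \<delta> s p \<Omega> (f n) \<le>
      ennreal (2 powr p) * (seminorm_delta_pow \<delta> s p \<Omega> (\<lambda>x. f n x - u x) + seminorm_delta_pow \<delta> s p \<Omega> u)"
      using nn_integral_gagliardo_le[OF g d(1) X0_deltaD(1)[OF u] sets_E] 
      by (simp add: seminorm_delta_E[OF d(1)] seminorm_delta_E[OF X0_deltaD(1)[OF u]] seminorm_delta_E[OF X0_deltaD(1)[OF fn]])
    then have "?S (f n) \<le> enn2real (ennreal (2 powr p) * (seminorm_delta_pow \<delta> s p \<Omega> (\<lambda>x. f n x - u x) + seminorm_delta_pow \<delta> s p \<Omega> u))"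
      using d(3) X0_deltaD(3)[OF u] by (intro enn2real_mono) (auto simp: ennreal_mult_less_top)
    then show ?thesis
      using d(3) X0_deltaD(3)[OF u] by (simp add: enn2real_mult enn2real_plus)
  qed
  have "(\<lambda>n. ?S (\<lambda>x. f (r n) x - u x)) \<longlonglongrightarrow> 0"
  proof -
    have "(\<lambda>n. ?S (\<lambda>x. f (r n) x - u x) powr (1 / p)) \<longlonglongrightarrow> 0"
      by (rule tendsto_sandwich[OF _ _ tendsto_const r(3)])
        (auto simp: dist_delta_def intro!: always_eventually)
    then show ?thesis using p by (simp add: tendsto_powr_zero_iff)
  qed
  then obtain B where B: "\<And>n. ?S (\<lambda>x. f (r n) x - u x) \<le> B"
    using convergent_imp_bounded[of "\<lambda>n. ?S (\<lambda>x. f (r n) x - u x)"] unfolding bounded_iff by fastforce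
  obtain n where n: "2 powr p * (B + ?S u) < real n" using reals_Archimedean2 by blast
  have "real n \<le> real (r n)" using seq_suble[OF r(1)] by simp
  also have "\<dots> \<le> ?S (f (r n))" using f(2)[of "r n"] by simp
  also have "\<dots> \<le> 2 powr p * (?S (\<lambda>x. f (r n) x - u x) + ?S u)" by (rule le)
  also have "\<dots> \<le> 2 powr p * (B + ?S u)" using B by (intro mult_left_mono add_right_mono) auto
  finally show False using n by simp
qed

text \<open>From \<open>\<delta>\<close> to infinity a competitor is replaced by its set of zero
  extensions; in the other direction the same set serves, by \<open>X0_inf_subset\<close>. Since the
  norm is 1 throughout, the energy identity shifts all energies by one constant, which passes
  through the supremum.\<close>

lemma minimax_inf_eq:
  assumes k: "1 \<le> k"
  shows "minimax_inf s p \<Omega> k = (\<lambda>m. m + 2 * enn2real (kernel_tail TYPE('a) (real DIM('a) + s * p) \<delta>)) ` minimax_delta \<delta> s p \<Omega> k"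
    (is "_ = (\<lambda>m. m + ?c) ` _")
proof (intro equalityI subsetI)
  fix m assume "m \<in> (\<lambda>m. m + ?c) ` minimax_delta \<delta> s p \<Omega> k"
  then obtain A where A: "A \<subseteq> X0_delta \<delta> s p \<Omega>" "\<And>u. u \<in> A \<Longrightarrow> Lp_pow \<Omega> p u = 1"
    "symmetric_set A" "compact_wrt (dist_delta \<delta> s p \<Omega>) A" "genus (dist_delta \<delta> s p \<Omega>) A \<ge> enat k"
    and m: "m = (SUP v\<in>A. enn2real (seminorm_delta_pow \<delta> s p \<Omega> v)) + ?c"
    unfolding minimax_delta_def by blast
  have ne: "A \<noteq> {}" using A(5) k by (auto simp: genus_empty zero_enat_def)
  let ?B = "zero_ext \<Omega> ` A"
  have "?B \<subseteq> {u \<in> X0_inf s p \<Omega>. Lp_pow \<Omega> p u = 1}"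
    using A(1,2) zero_ext_in_X0_inf by (auto simp: Lp_pow_zero_ext)
  moreover have "symmetric_set ?B"
    using A(3) unfolding symmetric_set_def by (auto simp: zero_ext_uminus[symmetric])
  moreover have "compact_wrt (dist_inf s p) ?B"
    unfolding compact_wrt_def
  proof (intro allI impI)
    fix g :: "nat \<Rightarrow> 'a \<Rightarrow> real" assume "\<forall>n. g n \<in> ?B"
    then have "\<forall>n. \<exists>f\<in>A. g n = zero_ext \<Omega> f" by blast
    then obtain f where f: "\<And>n. f n \<in> A" "\<And>n. g n = zero_ext \<Omega> (f n)" by metis
    obtain r u where r: "strict_mono r" "u \<in> A" "(\<lambda>n. dist_delta \<delta> s p \<Omega> (f (r n)) u) \<longlonglongrightarrow> 0"
      using A(4) f(1) unfolding compact_wrt_def by metis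
    have "(\<lambda>n. dist_inf s p (g (r n)) (zero_ext \<Omega> u)) \<longlonglongrightarrow> 0"
      unfolding f(2) by (subst dist_delta_tendsto_iff[symmetric]) (use f r A in auto)
    then show "\<exists>r u. strict_mono r \<and> u \<in> ?B \<and> (\<lambda>n. dist_inf s p (g (r n)) u) \<longlonglongrightarrow> 0"
      using r by blast
  qed
  moreover have "enat k \<le> genus (dist_inf s p) ?B"
  \<comment> \<open>Sphere maps are pulled back along \<open>zero_ext \<Omega>\<close>, which is odd
    and continuous for null sequences. Different members of \<open>A\<close> may share an extension
    without harm.\<close>
  proof (rule order_trans[OF A(5)], rule genus_mono, rule exI)
    fix j h assume h: "odd_sphere_map (dist_inf s p) ?B j h"
    show "odd_sphere_map (dist_delta \<delta> s p \<Omega>) A j (\<lambda>u. h (zero_ext \<Omega> u))"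
      unfolding odd_sphere_map_def
    proof (intro conjI ballI)
      fix u assume "u \<in> A"
      then show "\<forall>i\<ge>j. h (zero_ext \<Omega> u) i = 0" "(\<Sum>i<j. (h (zero_ext \<Omega> u) i)\<^sup>2) = 1"
          "h (zero_ext \<Omega> (\<lambda>x. - u x)) = (\<lambda>i. - h (zero_ext \<Omega> u) i)"
        using h unfolding odd_sphere_map_def by (auto simp: zero_ext_uminus)
    next
      show "\<forall>f u. (\<forall>n. f n \<in> A) \<longrightarrow> u \<in> A \<longrightarrow> (\<lambda>n. dist_delta \<delta> s p \<Omega> (f n) u) \<longlonglongrightarrow> 0 \<longrightarrow>
        (\<forall>i<j. (\<lambda>n. h (zero_ext \<Omega> (f n)) i) \<longlonglongrightarrow> h (zero_ext \<Omega> u) i)"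
      proof (intro allI impI)
        fix f u i assume a: "\<forall>n. f n \<in> A" "u \<in> A" "(\<lambda>n. dist_delta \<delta> s p \<Omega> (f n) u) \<longlonglongrightarrow> 0" "i < j"
        have "(\<lambda>n. dist_inf s p (zero_ext \<Omega> (f n)) (zero_ext \<Omega> u)) \<longlonglongrightarrow> 0"
          by (subst dist_delta_tendsto_iff[symmetric]) (use a A in auto)
        moreover have "\<forall>n. zero_ext \<Omega> (f n) \<in> ?B" "zero_ext \<Omega> u \<in> ?B" using a by auto
        ultimately show "(\<lambda>n. h (zero_ext \<Omega> (f n)) i) \<longlonglongrightarrow> h (zero_ext \<Omega> u) i"
          using h a(4) unfolding odd_sphere_map_def by (elim conjE allE[of _ "\<lambda>n. zero_ext \<Omega> (f n)"]) blast
      qed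
    qed
  qed
  moreover have "m = (SUP v\<in>?B. enn2real (seminorm_inf_pow s p v))"
  proof -
    have "(SUP v\<in>?B. enn2real (seminorm_inf_pow s p v)) = (SUP v\<in>A. enn2real (seminorm_delta_pow \<delta> s p \<Omega> v) + ?c)"
      unfolding image_image using A(1,2) by (intro SUP_cong refl) (subst enn2real_seminorm_inf_zero_ext, auto)
    also have "\<dots> = m"
      unfolding m by (rule cSUP_add_const[OF ne compact_seminorm_bdd[OF A(1,4)]])
    finally show ?thesis by simp
  qed
  ultimately show "m \<in> minimax_inf s p \<Omega> k"
    unfolding minimax_inf_def by blast
next
  fix m assume "m \<in> minimax_inf s p \<Omega> k"
  then obtain A where A: "A \<subseteq> X0_inf s p \<Omega>" "\<And>u. u \<in> A \<Longrightarrow> Lp_pow \<Omega> p u = 1"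
    "symmetric_set A" "compact_wrt (dist_inf s p) A" "genus (dist_inf s p) A \<ge> enat k"
    and m: "m = (SUP v\<in>A. enn2real (seminorm_inf_pow s p v))"
    unfolding minimax_inf_def by blast
  have ne: "A \<noteq> {}" using A(5) k by (auto simp: genus_empty zero_enat_def)
  have A': "A \<subseteq> X0_delta \<delta> s p \<Omega>" using A(1) X0_inf_subset by blast
  \<comment> \<open>Members of \<open>X0_inf\<close> agree almost everywhere with their extensions,
    so the two distances have the same null sequences on \<open>A\<close> itself.\<close>
  have conv: "(\<lambda>n. dist_delta \<delta> s p \<Omega> (f n) u) \<longlonglongrightarrow> 0 \<longleftrightarrow> (\<lambda>n. dist_inf s p (f n) u) \<longlonglongrightarrow> 0"
    if "\<forall>n. f n \<in> A" "u \<in> A" for f :: "nat \<Rightarrow> 'a \<Rightarrow> real" and u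
  proof -
    have "dist_inf s p (zero_ext \<Omega> (f n)) (zero_ext \<Omega> u) = dist_inf s p (f n) u" for n
      using that A(1) by (intro dist_inf_zero_ext) auto
    then show ?thesis using that A' by (subst dist_delta_tendsto_iff) auto
  qed
  have comp: "compact_wrt (dist_delta \<delta> s p \<Omega>) A"
    unfolding compact_wrt_def
  proof (intro allI impI)
    fix f :: "nat \<Rightarrow> 'a \<Rightarrow> real"
    assume f: "\<forall>n. f n \<in> A"
    obtain r u where "strict_mono r" "u \<in> A" "(\<lambda>n. dist_inf s p (f (r n)) u) \<longlonglongrightarrow> 0"
      using A(4) f unfolding compact_wrt_def by metis
    with f show "\<exists>r u. strict_mono r \<and> u \<in> A \<and> (\<lambda>n. dist_delta \<delta> s p \<Omega> (f (r n)) u) \<longlonglongrightarrow> 0"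
      using conv[of "\<lambda>n. f (r n)" u] by blast
  qed
  have "genus (dist_inf s p) A \<le> genus (dist_delta \<delta> s p \<Omega>) A"
  proof (rule genus_mono, rule exI)
    fix j h assume "odd_sphere_map (dist_delta \<delta> s p \<Omega>) A j h"
    then show "odd_sphere_map (dist_inf s p) A j h"
      unfolding odd_sphere_map_def using conv by auto
  qed
  then have gen: "enat k \<le> genus (dist_delta \<delta> s p \<Omega>) A" using A(5) by (rule order_trans[rotated])
  have "m = (SUP v\<in>A. enn2real (seminorm_delta_pow \<delta> s p \<Omega> v) + ?c)"
    unfolding m
  proof (intro SUP_cong refl)
    fix v assume v: "v \<in> A"
    have "seminorm_inf_pow s p v = seminorm_inf_pow s p (zero_ext \<Omega> v)"
      using v A(1) by (intro seminorm_inf_cong_AE X0_inf_AE_zero_ext) auto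
    then show "enn2real (seminorm_inf_pow s p v) = enn2real (seminorm_delta_pow \<delta> s p \<Omega> v) + ?c"
      using v A' A(2) enn2real_seminorm_inf_zero_ext[of v] by auto
  qed
  also have "\<dots> = (SUP v\<in>A. enn2real (seminorm_delta_pow \<delta> s p \<Omega> v)) + ?c"
    by (rule cSUP_add_const[OF ne compact_seminorm_bdd[OF A' comp]])
  finally have "m = (SUP v\<in>A. enn2real (seminorm_delta_pow \<delta> s p \<Omega> v)) + ?c" .
  moreover have "(SUP v\<in>A. enn2real (seminorm_delta_pow \<delta> s p \<Omega> v)) \<in> minimax_delta \<delta> s p \<Omega> k"
    unfolding minimax_delta_def using A' A(2,3) comp gen by blast
  ultimately show "m \<in> (\<lambda>m. m + ?c) ` minimax_delta \<delta> s p \<Omega> k" by blast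
qed

lemma minimax_delta_nonneg:
  assumes k: "1 \<le> k" and m: "m \<in> minimax_delta \<delta> s p \<Omega> k"
  shows "0 \<le> m"
proof -
  obtain A where A: "A \<subseteq> X0_delta \<delta> s p \<Omega>"
    "compact_wrt (dist_delta \<delta> s p \<Omega>) A" "genus (dist_delta \<delta> s p \<Omega>) A \<ge> enat k"
    and m: "m = (SUP v\<in>A. enn2real (seminorm_delta_pow \<delta> s p \<Omega> v))"
    using m unfolding minimax_delta_def by blast
  obtain v where v: "v \<in> A" using A(3) k by (cases "A = {}") (auto simp: genus_empty zero_enat_def)
  show ?thesis unfolding m
    by (rule cSUP_upper2[OF compact_seminorm_bdd[OF A(1,2)] v]) simp
qed

lemma lambda_diff_le:
  assumes k: "1 \<le> k"
  shows "\<bar>lambda_delta \<delta> s p \<Omega> k - lambda_inf s p \<Omega> k\<bar> \<le> 2 * enn2real (kernel_tail TYPE('a) (real DIM('a) + s * p) \<delta>)"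
proof -
  have l: "lambda_delta \<delta> s p \<Omega> k = Inf (minimax_delta \<delta> s p \<Omega> k)" "lambda_inf s p \<Omega> k = Inf (minimax_inf s p \<Omega> k)"
    by (simp_all add: lambda_delta_def minimax_delta_def lambda_inf_def minimax_inf_def)
  show ?thesis
  proof (cases "minimax_delta \<delta> s p \<Omega> k = {}")
    case True
    \<comment> \<open>Both eigenvalues are then the unspecified value of the infimum of the empty set.\<close>
    then show ?thesis unfolding l minimax_inf_eq[OF k] by simp
  next
    case False
    have "bdd_below (minimax_delta \<delta> s p \<Omega> k)"
      using minimax_delta_nonneg[OF k] by (auto simp: bdd_below_def)
    then show ?thesis unfolding l minimax_inf_eq[OF k] using False by (simp add: cInf_add_const)
  qed
qed

end

lemma enn2real_kernel_tail_tendsto_0: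
  assumes "0 < \<sigma>"
  shows "((\<lambda>\<delta>. enn2real (kernel_tail TYPE('a::euclidean_space) (real DIM('a) + \<sigma>) \<delta>)) \<longlongrightarrow> 0) at_top"
proof -
  obtain K where K: "0 \<le> K" "\<And>\<delta>. 0 < \<delta> \<Longrightarrow> kernel_tail TYPE('a) (real DIM('a) + \<sigma>) \<delta> \<le> ennreal (K * \<delta> powr (- \<sigma>))"
    using kernel_tail_bound[OF assms] by blast
  have "((\<lambda>\<delta>. K * \<delta> powr (- \<sigma>)) \<longlongrightarrow> K * 0) at_top"
    using assms by (intro tendsto_mult tendsto_const tendsto_neg_powr filterlim_ident) auto
  then have lim: "((\<lambda>\<delta>. K * \<delta> powr (- \<sigma>)) \<longlongrightarrow> 0) at_top" by simp
  have "\<forall>\<^sub>F \<delta> in at_top. enn2real (kernel_tail TYPE('a) (real DIM('a) + \<sigma>) \<delta>) \<le> K * \<delta> powr (- \<sigma>)"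
    using eventually_gt_at_top[of 0]
  proof eventually_elim
    case (elim \<delta>)
    show ?case using enn2real_mono[OF K(2)[OF elim]] K(1) by simp
  qed
  then show ?thesis by (intro tendsto_sandwich[OF _ _ tendsto_const lim]) auto
qed

lemma lambda_delta_tendsto:
  fixes \<Omega> :: "'a::euclidean_space set"
  assumes "open \<Omega>" "bounded \<Omega>" "1 < p" "0 < s" "1 \<le> k"
  shows "((\<lambda>\<delta>. lambda_delta \<delta> s p \<Omega> k) \<longlongrightarrow> lambda_inf s p \<Omega> k) at_top"
proof -
  obtain D where D: "\<And>x y. x \<in> \<Omega> \<Longrightarrow> y \<in> \<Omega> \<Longrightarrow> dist x y \<le> D"
    using bounded_two_points[of \<Omega>] assms(2) by blast
  have "((\<lambda>\<delta>. lambda_delta \<delta> s p \<Omega> k - lambda_inf s p \<Omega> k) \<longlongrightarrow> 0) at_top"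
  proof (rule Lim_null_comparison)
    show "((\<lambda>\<delta>. 2 * enn2real (kernel_tail TYPE('a) (real DIM('a) + s * p) \<delta>)) \<longlongrightarrow> 0) at_top"
      using tendsto_mult[OF tendsto_const enn2real_kernel_tail_tendsto_0[of "s * p", where 'a='a], of 2] assms by simp
    show "\<forall>\<^sub>F \<delta> in at_top. norm (lambda_delta \<delta> s p \<Omega> k - lambda_inf s p \<Omega> k) \<le> 2 * enn2real (kernel_tail TYPE('a) (real DIM('a) + s * p) \<delta>)"
      using eventually_gt_at_top[of "max 0 D"]
    proof eventually_elim
      case (elim \<delta>)
      interpret large_horizon \<Omega> p s \<delta>
        using assms elim D by unfold_locales (auto intro: le_less_trans)
      show ?case using lambda_diff_le[OF assms(5)] by simp
    qed
  qed
  then show ?thesis by (simp add: LIM_zero_iff)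
qed

section \<open>Compactness\<close>

text \<open>The label of a grid cube: its lower corner divided by \<open>h\<close>. The floor makes
  the cubes half-open, so they partition the space.\<close>

definition cell :: "real \<Rightarrow> 'a::euclidean_space \<Rightarrow> 'a" where
  "cell h x = (\<Sum>b\<in>Basis. real_of_int \<lfloor>(x \<bullet> b) / h\<rfloor> *\<^sub>R b)"

lemma cell_inner: "b \<in> Basis \<Longrightarrow> cell h x \<bullet> b = real_of_int \<lfloor>(x \<bullet> b) / h\<rfloor>"
  by (simp add: cell_def)

lemma cell_eq_iff: "cell h x = cell h y \<longleftrightarrow> (\<forall>b\<in>Basis. \<lfloor>(x \<bullet> b) / h\<rfloor> = \<lfloor>(y \<bullet> b) / h\<rfloor>)"
  by (subst euclidean_eq_iff) (simp add: cell_inner)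

lemma cell_dist_le:
  fixes x y :: "'a::euclidean_space"
  assumes h: "0 < h" and eq: "cell h x = cell h y"
  shows "dist x y \<le> real DIM('a) * h"
proof -
  have le: "\<bar>(x - y) \<bullet> b\<bar> \<le> h" if "b \<in> Basis" for b
  proof -
    define m where "m = real_of_int \<lfloor>(x \<bullet> b) / h\<rfloor> * h"
    have m: "m = real_of_int \<lfloor>(y \<bullet> b) / h\<rfloor> * h"
      using eq that unfolding cell_eq_iff m_def by simp
    have "m \<le> x \<bullet> b" "x \<bullet> b < m + h"
      using floor_divide_lower[OF h, of "x \<bullet> b"] floor_divide_upper[OF h, of "x \<bullet> b"]
      by (simp_all only: m_def distrib_right mult_1)
    moreover have "m \<le> y \<bullet> b" "y \<bullet> b < m + h"
      using floor_divide_lower[OF h, of "y \<bullet> b"] floor_divide_upper[OF h, of "y \<bullet> b"]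
      by (simp_all only: m distrib_right mult_1)
    ultimately have "\<bar>x \<bullet> b - y \<bullet> b\<bar> \<le> h" by linarith
    then show ?thesis by (simp only: inner_diff_left)
  qed
  have "dist x y \<le> (\<Sum>b\<in>Basis. \<bar>(x - y) \<bullet> b\<bar>)"
    unfolding dist_norm by (rule norm_le_l1)
  also have "\<dots> \<le> (\<Sum>b\<in>(Basis::'a set). h)"
    by (rule sum_mono) (rule le)
  finally show ?thesis by simp
qed

lemma cell_borel: "{y. cell h y = c} \<in> sets borel"
proof -
  have [measurable]: "cell h \<in> borel_measurable borel"
    unfolding cell_def by measurable
  have "cell h -` {c} \<inter> space borel \<in> sets borel"
    by (rule measurable_sets[where A = borel]) auto
  then show ?thesis by (simp add: vimage_def)
qed

definition cell_at :: "real \<Rightarrow> 'a::euclidean_space \<Rightarrow> 'a set" where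
  "cell_at h c = {y. cell h y = c}"

lemma mem_cell_at [simp]: "y \<in> cell_at h c \<longleftrightarrow> cell h y = c"
  by (simp add: cell_at_def)

lemma cell_at_sets [measurable]: "cell_at h c \<in> sets lebesgue"
  unfolding cell_at_def by (rule sets_completionI_sets) (simp add: cell_borel)

text \<open>The half-open cube lies between an open and a closed box of equal volume.\<close>

lemma emeasure_cell:
  fixes x :: "'a::euclidean_space"
  assumes h: "0 < h"
  shows "emeasure lebesgue {y. cell h y = cell h x} = ennreal (h ^ DIM('a))"
proof -
  define l where "l = h *\<^sub>R cell h x"
  define r where "r = l + h *\<^sub>R (One::'a)"
  have l: "l \<bullet> b = h * real_of_int \<lfloor>(x \<bullet> b) / h\<rfloor>" if "b \<in> Basis" for b
    using that by (simp add: l_def cell_inner)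
  have r: "r \<bullet> b = l \<bullet> b + h" if "b \<in> Basis" for b
    using that by (simp add: r_def inner_add_left)
  have iff: "\<lfloor>(y \<bullet> b) / h\<rfloor> = \<lfloor>(x \<bullet> b) / h\<rfloor> \<longleftrightarrow> l \<bullet> b \<le> y \<bullet> b \<and> y \<bullet> b < r \<bullet> b" if "b \<in> Basis" for y b
    unfolding r[OF that] l[OF that] floor_eq_iff using h by (simp add: field_simps)
  have sub: "box l r \<subseteq> {y. cell h y = cell h x}" "{y. cell h y = cell h x} \<subseteq> cbox l r"
    by (auto simp: cell_eq_iff iff mem_box less_imp_le)
  have lr: "\<And>b. b \<in> Basis \<Longrightarrow> l \<bullet> b \<le> r \<bullet> b" using h by (simp add: r)
  have "(\<Prod>b\<in>Basis. (r - l) \<bullet> b) = h ^ DIM('a)"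
    by (simp add: r inner_diff_left)
  then have vol: "emeasure lborel (box l r) = ennreal (h ^ DIM('a))" "emeasure lborel (cbox l r) = ennreal (h ^ DIM('a))"
    by (simp_all only: emeasure_lborel_box[OF lr] emeasure_lborel_cbox[OF lr])
  have "emeasure lborel (box l r) \<le> emeasure lborel {y. cell h y = cell h x}"
    by (rule emeasure_mono[OF sub(1)]) (simp add: cell_borel)
  moreover have "emeasure lborel {y. cell h y = cell h x} \<le> emeasure lborel (cbox l r)"
    by (rule emeasure_mono[OF sub(2)]) simp
  ultimately have "emeasure lborel {y. cell h y = cell h x} = ennreal (h ^ DIM('a))"
    unfolding vol by (rule antisym[rotated])
  moreover have "emeasure lebesgue {y. cell h y = cell h x} = emeasure lborel {y. cell h y = cell h x}"
    by (subst emeasure_completion) (simp_all only: main_part cell_borel sets_completionI_sets sets_lborel)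
  ultimately show ?thesis by (simp only:)
qed

lemma finite_cells:
  fixes \<Omega> :: "'a::euclidean_space set"
  assumes h: "0 < h" and "bounded \<Omega>"
  shows "finite (cell h ` \<Omega>)"
proof -
  obtain B where B: "\<And>x. x \<in> \<Omega> \<Longrightarrow> norm x \<le> B" using assms(2) by (auto simp: bounded_iff)
  let ?F = "(Basis :: 'a set) \<rightarrow>\<^sub>E {\<lfloor>- B / h\<rfloor>..\<lfloor>B / h\<rfloor>}"
  have "cell h ` \<Omega> \<subseteq> (\<lambda>f. \<Sum>b\<in>Basis. real_of_int (f b) *\<^sub>R b) ` ?F"
  proof (rule image_subsetI)
    fix x assume x: "x \<in> \<Omega>"
    have "\<lfloor>(x \<bullet> b) / h\<rfloor> \<in> {\<lfloor>- B / h\<rfloor>..\<lfloor>B / h\<rfloor>}" if "b \<in> Basis" for b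
    proof -
      have "\<bar>x \<bullet> b\<bar> \<le> B" using Basis_le_norm[OF that, of x] B[OF x] by simp
      then have "- B / h \<le> (x \<bullet> b) / h" "(x \<bullet> b) / h \<le> B / h"
        using divide_right_mono[of "- B" "x \<bullet> b" h] divide_right_mono[of "x \<bullet> b" B h] h by auto
      then show ?thesis by (simp add: floor_mono)
    qed
    then have "restrict (\<lambda>b. \<lfloor>(x \<bullet> b) / h\<rfloor>) Basis \<in> ?F" by auto
    moreover have "cell h x = (\<Sum>b\<in>Basis. real_of_int (restrict (\<lambda>b. \<lfloor>(x \<bullet> b) / h\<rfloor>) Basis b) *\<^sub>R b)"
      unfolding cell_def by (intro sum.cong) auto
    ultimately show "cell h x \<in> (\<lambda>f. \<Sum>b\<in>Basis. real_of_int (f b) *\<^sub>R b) ` ?F" by blast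
  qed
  then show ?thesis by (rule finite_subset) (intro finite_imageI finite_PiE, auto)
qed

text \<open>If \<open>b > t\<close> then \<open>b = b powr (1 - p) * b powr p\<close>, and the first
  factor is below \<open>t powr (1 - p)\<close>. With \<open>t\<close> free this takes the place of
  Hoelder and Jensen.\<close>

lemma young_linear:
  fixes b t p :: real
  assumes "0 < t" "1 < p" "0 \<le> b"
  shows "b \<le> t + t powr (1 - p) * b powr p"
proof (cases "b \<le> t")
  case True
  then show ?thesis by (simp add: add_increasing2)
next
  case False
  have "b = b powr (1 - p) * b powr p"
    using False assms by (subst powr_add[symmetric]) auto
  also have "\<dots> \<le> t powr (1 - p) * b powr p"
    using False assms by (intro mult_right_mono powr_mono2') auto
  finally show ?thesis using assms by simp
qed

lemma (in finite_measure) integrable_of_powr: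
  assumes p: "1 < p" and [measurable]: "w \<in> borel_measurable M"
    and fin: "(\<integral>\<^sup>+ y. ennreal (\<bar>w y\<bar> powr p) \<partial>M) < \<infinity>"
  shows "integrable M (w :: 'a \<Rightarrow> real)"
proof (rule Bochner_Integration.integrable_bound)
  have "integrable M (\<lambda>y. \<bar>w y\<bar> powr p)"
    using fin by (intro integrableI_bounded) auto
  then show "integrable M (\<lambda>y. 1 + \<bar>w y\<bar> powr p)" by simp
  show "AE y in M. norm (w y) \<le> norm (1 + \<bar>w y\<bar> powr p)"
    using young_linear[of 1 p] p by (auto simp: abs_of_nonneg add_nonneg_nonneg)
qed simp

text \<open>Here \<open>c\<close> will be the value of \<open>w\<close> at a point of a cube. One
  factor \<open>2 powr p\<close> comes from splitting \<open>c\<close> into the mean and the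
  deviation from it, the other from bounding that deviation by the oscillation; together they make
  \<open>4 powr p\<close>.\<close>

lemma (in finite_measure) powr_abs_le_mean_oscillation:
  fixes w :: "'a \<Rightarrow> real" and c :: real
  assumes p: "1 < p" and [measurable]: "w \<in> borel_measurable M" and q: "measure M (space M) = q" "0 < q"
    and fin: "(\<integral>\<^sup>+ y. ennreal (\<bar>w y\<bar> powr p) \<partial>M) < \<infinity>"
  shows "ennreal (\<bar>c\<bar> powr p) \<le> ennreal (4 powr p / q) * (\<integral>\<^sup>+ y. ennreal (\<bar>c - w y\<bar> powr p) \<partial>M)
     + ennreal (2 powr p * \<bar>(\<integral> y. w y \<partial>M) / q\<bar> powr p)"
proof (cases "(\<integral>\<^sup>+ y. ennreal (\<bar>c - w y\<bar> powr p) \<partial>M) = \<infinity>")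
  case True
  then show ?thesis using q by (simp add: ennreal_mult_top)
next
  case False
  define J where "J = (\<integral> y. w y \<partial>M)"
  define i where "i = (\<integral> y. \<bar>c - w y\<bar> powr p \<partial>M)"
  have int: "integrable M (\<lambda>y. \<bar>c - w y\<bar> powr p)"
    using False by (intro integrableI_bounded) (auto simp: less_top)
  have i: "(\<integral>\<^sup>+ y. ennreal (\<bar>c - w y\<bar> powr p) \<partial>M) = ennreal i" "0 \<le> i"
    unfolding i_def using int by (auto intro: nn_integral_eq_integral)
  have w: "integrable M w" using p assms(2) fin by (rule integrable_of_powr)
  have osc: "\<bar>c - J / q\<bar> \<le> t + t powr (1 - p) * (i / q)" if t: "0 < t" for t
  proof -
    have "\<bar>c * q - J\<bar> = \<bar>\<integral> y. c - w y \<partial>M\<bar>"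
      using w q by (simp add: J_def mult.commute)
    also have "\<dots> \<le> (\<integral> y. \<bar>c - w y\<bar> \<partial>M)" by (rule integral_abs_bound)
    also have "\<dots> \<le> (\<integral> y. t + t powr (1 - p) * \<bar>c - w y\<bar> powr p \<partial>M)"
      using w int young_linear[OF t p] by (intro integral_mono) auto
    also have "\<dots> = t * q + t powr (1 - p) * i"
      using int q by (simp add: i_def mult.commute)
    finally have "\<bar>(c * q - J) / q\<bar> \<le> (t * q + t powr (1 - p) * i) / q"
      using q by (simp add: divide_right_mono)
    then show ?thesis using q by (simp add: field_simps)
  qed
  have "\<bar>c - J / q\<bar> powr p \<le> 2 powr p * (i / q)"
  proof (cases "i = 0")
    \<comment> \<open>There is no balancing \<open>t\<close> in this case, so \<open>t\<close> tends
      to 0.\<close>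
    case True
    have "\<bar>c - J / q\<bar> \<le> 0 + t" if "0 < t" for t
      using osc[OF that] True by simp
    then have "\<bar>c - J / q\<bar> \<le> 0" by (rule field_le_epsilon)
    then show ?thesis using True by simp
  next
    case False
    \<comment> \<open>This choice makes the two terms of \<open>osc\<close> equal, for a total of
      \<open>2 * t\<close>.\<close>
    define t where "t = (i / q) powr (1 / p)"
    have t: "0 < t" "t powr p = i / q" using False i q p by (auto simp: t_def powr_powr)
    have "t powr (1 - p) * t powr p = t"
      using t by (subst powr_add[symmetric]) simp
    then have "\<bar>c - J / q\<bar> \<le> 2 * t" using osc[OF t(1)] t(2) by simp
    then have "\<bar>c - J / q\<bar> powr p \<le> (2 * t) powr p" using p by (intro powr_mono2) auto
    then show ?thesis using t by (simp add: powr_mult)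
  qed
  then have "2 powr p * (\<bar>c - J / q\<bar> powr p + \<bar>J / q\<bar> powr p) \<le> 2 powr p * (2 powr p * (i / q) + \<bar>J / q\<bar> powr p)"
    by (intro mult_left_mono add_right_mono) auto
  moreover have "\<bar>c\<bar> powr p \<le> 2 powr p * (\<bar>c - J / q\<bar> powr p + \<bar>J / q\<bar> powr p)"
    using powr_abs_add_le[of p "c - J / q" "J / q"] p by simp
  ultimately have "\<bar>c\<bar> powr p \<le> 2 powr p * (2 powr p * (i / q) + \<bar>J / q\<bar> powr p)"
    by linarith
  also have "\<dots> = 4 powr p / q * i + 2 powr p * \<bar>J / q\<bar> powr p"
    using powr_mult[of 2 2 p] by (simp add: algebra_simps)
  finally have "ennreal (\<bar>c\<bar> powr p) \<le> ennreal (4 powr p / q * i + 2 powr p * \<bar>J / q\<bar> powr p)"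
    by (rule ennreal_leI)
  also have "\<dots> = ennreal (4 powr p / q) * ennreal i + ennreal (2 powr p * \<bar>J / q\<bar> powr p)"
    using q i(2) by (simp add: ennreal_mult[symmetric])
  finally show ?thesis by (simp add: i(1) J_def)
qed

text \<open>Two points of a cube are at distance at most \<open>N * h\<close>, so the kernel is at
  least \<open>(N * h) powr (- a)\<close> off the diagonal and the oscillation over the cube is
  bounded by its share of the Gagliardo energy. The rest depends on the mean alone.\<close>

lemma nn_integral_cell_le:
  fixes w :: "'a::euclidean_space \<Rightarrow> real"
  assumes p: "1 < p" and h: "0 < h" and a: "0 \<le> a" and [measurable]: "w \<in> borel_measurable lebesgue"
    and fin: "(\<integral>\<^sup>+ y. ennreal (\<bar>w y\<bar> powr p) \<partial>lebesgue) < \<infinity>" and c: "c \<in> range (cell h)"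
  shows "(\<integral>\<^sup>+ x. indicator (cell_at h c) x * ennreal (\<bar>w x\<bar> powr p) \<partial>lebesgue) \<le>
    ennreal (4 powr p / h ^ DIM('a) * (real DIM('a) * h) powr a) *
      (\<integral>\<^sup>+ z. indicator (cell_at h c \<times> cell_at h c) z * ennreal (gagliardo p a w z) \<partial>lebesgue2)
    + ennreal (2 powr p * \<bar>(LINT y:cell_at h c|lebesgue. w y) / h ^ DIM('a)\<bar> powr p * h ^ DIM('a))"
proof -
  let ?N = "DIM('a)"
  let ?Q = "cell_at h c :: 'a set" and ?q = "h ^ ?N"
  let ?J = "LINT y:?Q|lebesgue. w y"
  have q: "0 < ?q" using h by simp
  obtain x0 where x0: "c = cell h x0" using c by blast
  have emQ: "emeasure lebesgue ?Q = ennreal ?q" unfolding x0 cell_at_def by (rule emeasure_cell[OF h])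
  let ?M = "lebesgue_on ?Q"
  interpret finite_measure ?M
    by (rule finite_measure_lebesgue_on, rule fmeasurableI, rule cell_at_sets) (simp only: emQ ennreal_less_top infinity_ennreal_def)
  have wM: "w \<in> borel_measurable ?M" by (rule measurable_restrict_space1) simp
  have mQ: "measure ?M (space ?M) = ?q"
  proof -
    have "measure ?M (space ?M) = measure lebesgue ?Q"
      by (subst measure_restrict_space) auto
    also have "\<dots> = ?q"
      unfolding measure_def emQ using q by simp
    finally show ?thesis .
  qed
  have nnM: "(\<integral>\<^sup>+ y. f y \<partial>?M) = (\<integral>\<^sup>+ y. indicator ?Q y * f y \<partial>lebesgue)" for f :: "'a \<Rightarrow> ennreal"
    by (subst nn_integral_restrict_space) (auto simp: mult.commute)
  have "(\<integral>\<^sup>+ y. ennreal (\<bar>w y\<bar> powr p) \<partial>?M) \<le> (\<integral>\<^sup>+ y. ennreal (\<bar>w y\<bar> powr p) \<partial>lebesgue)"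
    unfolding nnM by (intro nn_integral_mono) (auto split: split_indicator)
  then have finM: "(\<integral>\<^sup>+ y. ennreal (\<bar>w y\<bar> powr p) \<partial>?M) < \<infinity>" using fin by simp
  have JM: "(\<integral> y. w y \<partial>?M) = ?J"
    by (subst integral_restrict_space) (auto simp: set_lebesgue_integral_def)
  have "(\<integral>\<^sup>+ x. indicator ?Q x * (\<integral>\<^sup>+ y. indicator ?Q y * ennreal (\<bar>w x - w y\<bar> powr p) \<partial>lebesgue) \<partial>lebesgue)
     = (\<integral>\<^sup>+ x. \<integral>\<^sup>+ y. indicator (?Q \<times> ?Q) (x, y) * ennreal (\<bar>w x - w y\<bar> powr p) \<partial>lebesgue \<partial>lebesgue)"
    by (intro nn_integral_cong) (auto split: split_indicator intro!: nn_integral_cong)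
  also have "\<dots> = (\<integral>\<^sup>+ z. indicator (?Q \<times> ?Q) z * ennreal (\<bar>w (fst z) - w (snd z)\<bar> powr p) \<partial>lebesgue2)"
    by (subst leb.nn_integral_fst[symmetric]) auto
  also have "\<dots> \<le> (\<integral>\<^sup>+ z. ennreal ((real ?N * h) powr a) * (indicator (?Q \<times> ?Q) z * ennreal (gagliardo p a w z)) \<partial>lebesgue2)"
  proof (intro nn_integral_mono)
    fix z :: "'a \<times> 'a"
    have "\<bar>w (fst z) - w (snd z)\<bar> powr p \<le> (real ?N * h) powr a * gagliardo p a w z" if z: "z \<in> ?Q \<times> ?Q"
    \<comment> \<open>The lower bound for the kernel fails on the diagonal, where it is 0, but there
      the difference vanishes too.\<close>
    proof (cases "fst z = snd z")
      case False
      have "dist (fst z) (snd z) powr a \<le> (real ?N * h) powr a"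
        using z a by (intro powr_mono2 cell_dist_le h) auto
      then have "1 \<le> (real ?N * h) powr a * riesz_ker a (fst z) (snd z)"
        using False by (simp add: riesz_ker_def divide_simps)
      from mult_left_mono[OF this, of "\<bar>w (fst z) - w (snd z)\<bar> powr p"] show ?thesis
        by (simp add: gagliardo_def mult_ac)
    qed (simp add: gagliardo_def)
    from ennreal_leI[OF this]
    show "indicator (?Q \<times> ?Q) z * ennreal (\<bar>w (fst z) - w (snd z)\<bar> powr p) \<le>
        ennreal ((real ?N * h) powr a) * (indicator (?Q \<times> ?Q) z * ennreal (gagliardo p a w z))"
      by (auto simp: ennreal_mult split: split_indicator)
  qed
  also have "\<dots> = ennreal ((real ?N * h) powr a) * (\<integral>\<^sup>+ z. indicator (?Q \<times> ?Q) z * ennreal (gagliardo p a w z) \<partial>lebesgue2)"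
    by (intro nn_integral_cmult) measurable
  finally have osc: "(\<integral>\<^sup>+ x. indicator ?Q x * (\<integral>\<^sup>+ y. indicator ?Q y * ennreal (\<bar>w x - w y\<bar> powr p) \<partial>lebesgue) \<partial>lebesgue)
    \<le> ennreal ((real ?N * h) powr a) * (\<integral>\<^sup>+ z. indicator (?Q \<times> ?Q) z * ennreal (gagliardo p a w z) \<partial>lebesgue2)" .
  have "(\<integral>\<^sup>+ x. indicator ?Q x * ennreal (\<bar>w x\<bar> powr p) \<partial>lebesgue) \<le>
      (\<integral>\<^sup>+ x. ennreal (4 powr p / ?q) * (indicator ?Q x * (\<integral>\<^sup>+ y. indicator ?Q y * ennreal (\<bar>w x - w y\<bar> powr p) \<partial>lebesgue))
       + ennreal (2 powr p * \<bar>?J / ?q\<bar> powr p) * indicator ?Q x \<partial>lebesgue)"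
    using powr_abs_le_mean_oscillation[OF p wM mQ q finM]
    by (intro nn_integral_mono) (auto simp: nnM JM split: split_indicator)
  also have "\<dots> = ennreal (4 powr p / ?q) * (\<integral>\<^sup>+ x. indicator ?Q x * (\<integral>\<^sup>+ y. indicator ?Q y * ennreal (\<bar>w x - w y\<bar> powr p) \<partial>lebesgue) \<partial>lebesgue)
       + ennreal (2 powr p * \<bar>?J / ?q\<bar> powr p) * ennreal ?q"
    by (simp add: nn_integral_add nn_integral_cmult emQ nn_integral_cmult_indicator)
  also have "\<dots> \<le> ennreal (4 powr p / ?q) * (ennreal ((real ?N * h) powr a) * (\<integral>\<^sup>+ z. indicator (?Q \<times> ?Q) z * ennreal (gagliardo p a w z) \<partial>lebesgue2))
       + ennreal (2 powr p * \<bar>?J / ?q\<bar> powr p) * ennreal ?q"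
    by (intro add_right_mono mult_left_mono osc) simp
  also have "\<dots> = ennreal (4 powr p / ?q * (real ?N * h) powr a) * (\<integral>\<^sup>+ z. indicator (?Q \<times> ?Q) z * ennreal (gagliardo p a w z) \<partial>lebesgue2)
       + ennreal (2 powr p * \<bar>?J / ?q\<bar> powr p * ?q)"
    using q by (simp only: ennreal_mult[symmetric] mult.assoc[symmetric] divide_nonneg_pos powr_ge_zero mult_nonneg_nonneg less_imp_le zero_le_numeral)
  finally show ?thesis .
qed

text \<open>The squares \<open>Q c \<times> Q c\<close> are disjoint, so the energies of the cubes
  add up to at most the full energy. The volume in the denominator cancels against the order of the
  kernel: \<open>h^(-N) * h powr (N + s * p) = h powr (s * p)\<close>. What remains depends on
  finitely many numbers.\<close>

lemma Lp_le_seminorm_plus_cell_means: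
  fixes w :: "'a::euclidean_space \<Rightarrow> real"
  assumes p: "1 < p" and s: "0 < s" and h: "0 < h" and b: "bounded \<Omega>" and [measurable]: "w \<in> borel_measurable lebesgue"
    and z: "\<And>x. x \<notin> \<Omega> \<Longrightarrow> w x = 0"
    and fin: "(\<integral>\<^sup>+ y. ennreal (\<bar>w y\<bar> powr p) \<partial>lebesgue) < \<infinity>"
  shows "(\<integral>\<^sup>+ x. ennreal (\<bar>w x\<bar> powr p) \<partial>lebesgue) \<le>
    ennreal (4 powr p * real DIM('a) powr (real DIM('a) + s * p) * h powr (s * p)) * seminorm_inf_pow s p w
    + (\<Sum>c\<in>cell h ` \<Omega>. ennreal (2 powr p * \<bar>(LINT y:cell_at h c|lebesgue. w y) / h ^ DIM('a)\<bar> powr p * h ^ DIM('a)))"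
proof -
  let ?N = "DIM('a)"
  let ?a = "real ?N + s * p"
  let ?Q = "\<lambda>c. cell_at h c :: 'a set" and ?C = "cell h ` \<Omega>"
  let ?K = "4 powr p / h ^ ?N * (real ?N * h) powr ?a"
  let ?m = "\<lambda>c. ennreal (2 powr p * \<bar>(LINT y:?Q c|lebesgue. w y) / h ^ ?N\<bar> powr p * h ^ ?N)"
  have C: "finite ?C" using finite_cells[OF h b] .
  have K: "?K = 4 powr p * real ?N powr ?a * h powr (s * p)"
    using h by (simp add: powr_mult powr_add powr_realpow)
  have "(\<Sum>c\<in>?C. \<integral>\<^sup>+ z. indicator (?Q c \<times> ?Q c) z * ennreal (gagliardo p ?a w z) \<partial>lebesgue2)
      = (\<integral>\<^sup>+ z. (\<Sum>c\<in>?C. indicator (?Q c \<times> ?Q c) z * ennreal (gagliardo p ?a w z)) \<partial>lebesgue2)"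
    by (rule nn_integral_sum[symmetric]) measurable
  also have "\<dots> \<le> (\<integral>\<^sup>+ z. ennreal (gagliardo p ?a w z) \<partial>lebesgue2)"
  proof (intro nn_integral_mono)
    fix z :: "'a \<times> 'a"
    have "(\<Sum>c\<in>?C. indicator (?Q c \<times> ?Q c) z * ennreal (gagliardo p ?a w z)) \<le>
        (\<Sum>c\<in>?C. if c = cell h (fst z) then ennreal (gagliardo p ?a w z) else 0)"
      by (intro sum_mono) (auto split: split_indicator)
    also have "\<dots> \<le> ennreal (gagliardo p ?a w z)"
      using C by (simp add: sum.delta)
    finally show "(\<Sum>c\<in>?C. indicator (?Q c \<times> ?Q c) z * ennreal (gagliardo p ?a w z)) \<le> ennreal (gagliardo p ?a w z)" .
  qed
  also have "\<dots> = seminorm_inf_pow s p w" by (simp add: seminorm_inf_gagliardo)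
  finally have sum: "(\<Sum>c\<in>?C. \<integral>\<^sup>+ z. indicator (?Q c \<times> ?Q c) z * ennreal (gagliardo p ?a w z) \<partial>lebesgue2) \<le> seminorm_inf_pow s p w" .
  have "(\<integral>\<^sup>+ x. ennreal (\<bar>w x\<bar> powr p) \<partial>lebesgue) \<le> (\<integral>\<^sup>+ x. (\<Sum>c\<in>?C. indicator (?Q c) x * ennreal (\<bar>w x\<bar> powr p)) \<partial>lebesgue)"
  proof (intro nn_integral_mono)
    fix x
    show "ennreal (\<bar>w x\<bar> powr p) \<le> (\<Sum>c\<in>?C. indicator (?Q c) x * ennreal (\<bar>w x\<bar> powr p))"
    proof (cases "x \<in> \<Omega>")
      case True
      then show ?thesis
        using member_le_sum[of "cell h x" ?C "\<lambda>c. indicator (?Q c) x * ennreal (\<bar>w x\<bar> powr p)"] C by simp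
    qed (simp add: z)
  qed
  also have "\<dots> = (\<Sum>c\<in>?C. \<integral>\<^sup>+ x. indicator (?Q c) x * ennreal (\<bar>w x\<bar> powr p) \<partial>lebesgue)"
    by (rule nn_integral_sum) measurable
  also have "\<dots> \<le> (\<Sum>c\<in>?C. ennreal ?K * (\<integral>\<^sup>+ z. indicator (?Q c \<times> ?Q c) z * ennreal (gagliardo p ?a w z) \<partial>lebesgue2) + ?m c)"
    using s p by (intro sum_mono nn_integral_cell_le p h fin) auto
  also have "\<dots> = ennreal ?K * (\<Sum>c\<in>?C. \<integral>\<^sup>+ z. indicator (?Q c \<times> ?Q c) z * ennreal (gagliardo p ?a w z) \<partial>lebesgue2) + (\<Sum>c\<in>?C. ?m c)"
    by (simp add: sum.distrib sum_distrib_left)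
  also have "\<dots> \<le> ennreal ?K * seminorm_inf_pow s p w + (\<Sum>c\<in>?C. ?m c)"
    by (intro add_right_mono mult_left_mono sum) simp
  finally show ?thesis unfolding K .
qed

text \<open>The bound 2 is the volume of a cube, at most 1 because \<open>h \<le> 1\<close>, plus
  the norm power, by \<open>\<bar>w\<bar> \<le> 1 + \<bar>w\<bar> powr p\<close>. Bounded cell
  integrals are what the diagonal argument needs.\<close>

lemma cell_integral:
  fixes w :: "'a::euclidean_space \<Rightarrow> real"
  assumes p: "1 < p" and h: "0 < h" "h \<le> 1" and [measurable]: "w \<in> borel_measurable lebesgue"
    and w: "(\<integral>\<^sup>+ y. ennreal (\<bar>w y\<bar> powr p) \<partial>lebesgue) \<le> 1" and c: "c \<in> range (cell h)"
  shows "set_integrable lebesgue (cell_at h c) w" "\<bar>LINT y:cell_at h c|lebesgue. w y\<bar> \<le> 2"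
proof -
  let ?Q = "cell_at h c"
  let ?F = "\<lambda>y. indicator ?Q y + \<bar>w y\<bar> powr p"
  obtain x0 where x0: "c = cell h x0" using c by blast
  have emQ: "emeasure lebesgue ?Q = ennreal (h ^ DIM('a))"
    unfolding x0 cell_at_def by (rule emeasure_cell[OF h(1)])
  have "(\<integral>\<^sup>+ y. ennreal (?F y) \<partial>lebesgue) = (\<integral>\<^sup>+ y. indicator ?Q y + ennreal (\<bar>w y\<bar> powr p) \<partial>lebesgue)"
    by (intro nn_integral_cong) (auto split: split_indicator)
  also have "\<dots> = (\<integral>\<^sup>+ y. indicator ?Q y \<partial>lebesgue) + (\<integral>\<^sup>+ y. ennreal (\<bar>w y\<bar> powr p) \<partial>lebesgue)"
    by (rule nn_integral_add) measurable
  also have "(\<integral>\<^sup>+ y. indicator ?Q y \<partial>lebesgue) = ennreal (h ^ DIM('a))"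
    unfolding emQ[symmetric] by (rule nn_integral_indicator) measurable
  also have "ennreal (h ^ DIM('a)) + (\<integral>\<^sup>+ y. ennreal (\<bar>w y\<bar> powr p) \<partial>lebesgue) \<le> ennreal 1 + 1"
    using h w by (intro add_mono ennreal_leI power_le_one) auto
  finally have F2: "(\<integral>\<^sup>+ y. ennreal (?F y) \<partial>lebesgue) \<le> 2" by simp
  have nn: "0 \<le> ?F y" for y by simp
  have F: "integrable lebesgue ?F"
  proof (rule integrableI_bounded)
    show "(\<integral>\<^sup>+ y. ennreal (norm (?F y)) \<partial>lebesgue) < \<infinity>"
      using F2 nn by (simp add: abs_of_nonneg le_less_trans)
  qed measurable
  have le: "norm (indicator ?Q y *\<^sub>R w y) \<le> ?F y" for y
    using young_linear[of 1 p "\<bar>w y\<bar>"] p by (auto split: split_indicator)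
  show int: "set_integrable lebesgue ?Q w"
    unfolding set_integrable_def
  proof (rule Bochner_Integration.integrable_bound[OF F])
    have "norm (indicator ?Q y *\<^sub>R w y) \<le> norm (?F y)" for y
      using le[of y] nn[of y] by (simp only: real_norm_def[of "?F y"] abs_of_nonneg)
    then show "AE y in lebesgue. norm (indicator ?Q y *\<^sub>R w y) \<le> norm (?F y)"
      by (rule AE_I2)
  qed measurable
  have "\<bar>LINT y:?Q|lebesgue. w y\<bar> \<le> (\<integral> y. norm (indicator ?Q y *\<^sub>R w y) \<partial>lebesgue)"
    unfolding set_lebesgue_integral_def real_norm_def[symmetric] by (rule integral_norm_bound)
  also have "\<dots> \<le> (\<integral> y. ?F y \<partial>lebesgue)"
    using int F le unfolding set_integrable_def by (intro integral_mono integrable_norm) auto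
  also have "\<dots> = enn2real (\<integral>\<^sup>+ y. ennreal (?F y) \<partial>lebesgue)"
    by (rule integral_eq_nn_integral) auto
  also have "\<dots> \<le> enn2real 2"
    using F2 by (rule enn2real_mono) simp
  finally show "\<bar>LINT y:?Q|lebesgue. w y\<bar> \<le> 2" by simp
qed

text \<open>The mesh is fixed first, so fine that the energy term is below \<open>e / 2\<close> for
  all differences at once. On that mesh only finitely many means remain, and these are Cauchy along
  the subsequence.\<close>

lemma fractional_rellich_cauchy:
  fixes u :: "nat \<Rightarrow> 'a::euclidean_space \<Rightarrow> real"
  assumes p: "1 < p" and s: "0 < s" and b: "bounded \<Omega>"
    and u[measurable]: "\<And>n. u n \<in> borel_measurable lebesgue" and z: "\<And>n x. x \<notin> \<Omega> \<Longrightarrow> u n x = 0"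
    and Lp: "\<And>n. (\<integral>\<^sup>+ x. ennreal (\<bar>u n x\<bar> powr p) \<partial>lebesgue) \<le> 1"
    and C: "\<And>n. seminorm_inf_pow s p (u n) \<le> ennreal C" "0 \<le> C"
  obtains r :: "nat \<Rightarrow> nat" where "strict_mono r"
    "\<And>e. 0 < e \<Longrightarrow> \<exists>M. \<forall>m\<ge>M. \<forall>n\<ge>M. (\<integral>\<^sup>+ x. ennreal (\<bar>u (r m) x - u (r n) x\<bar> powr p) \<partial>lebesgue) \<le> ennreal e"
proof -
  define h where "h j = 1 / real (Suc j)" for j
  have h: "0 < h j" "h j \<le> 1" for j by (auto simp: h_def)
  define J where "J n jc = (LINT y:cell_at (h (fst jc)) (snd jc)|lebesgue. u n y)" for n and jc :: "nat \<times> 'a"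
  define S where "S = (\<Union>j. Pair j ` cell (h j) ` \<Omega>)"
  have "countable S"
    unfolding S_def
    by (rule countable_UN[OF countableI_type]) (rule countable_finite[OF finite_imageI[OF finite_cells[OF h(1) b]]])
  moreover have "norm (J n jc) \<le> 2" if "jc \<in> S" for n jc
    using that cell_integral(2)[OF p h u Lp] unfolding S_def J_def by auto
  \<comment> \<open>A diagonal subsequence along which the cell integrals of all meshes
    \<open>1 / (j + 1)\<close> converge simultaneously.\<close>
  ultimately obtain r where r: "strict_mono r" "\<And>jc. jc \<in> S \<Longrightarrow> \<exists>l. (\<lambda>n. J (r n) jc) \<longlonglongrightarrow> l"
    by (rule function_convergent_subsequence[of S J 2]) blast+
  show ?thesis
  proof (rule that[OF r(1)])
    fix e :: real assume e: "0 < e"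
    let ?N = "DIM('a)"
    define A where "A = 4 powr p * real ?N powr (real ?N + s * p)"
    define D where "D = 2 powr p * (C + C)"
    have AD: "0 \<le> A" "0 \<le> D" using C(2) by (auto simp: A_def D_def)
    have "(\<lambda>j. A * h j powr (s * p) * D) \<longlonglongrightarrow> A * 0 powr (s * p) * D"
      unfolding h_def using s p
      by (intro tendsto_mult tendsto_const tendsto_powr' LIMSEQ_inverse_real_of_nat[unfolded inverse_eq_divide]) auto
    then have "(\<lambda>j. A * h j powr (s * p) * D) \<longlonglongrightarrow> 0" by simp
    then have "\<forall>\<^sub>F j in sequentially. A * h j powr (s * p) * D < e / 2"
      using e by (intro order_tendstoD) auto
    then obtain j where j: "A * h j powr (s * p) * D < e / 2"
      by (auto simp: eventually_sequentially)
    let ?q = "h j ^ ?N" and ?C = "cell (h j) ` \<Omega>"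
    have q: "0 < ?q" using h by simp
    \<comment> \<open>The admissible \<open>p\<close>-th power of the difference of two means:
      summed over all cubes it costs at most \<open>e / 2\<close>. The added 1 covers an empty set
      of cubes.\<close>
    define X where "X = (e / 2) / (real (card ?C) * (2 powr p * ?q) + 1)"
    have X: "0 < X" "real (card ?C) * (2 powr p * ?q) * X \<le> e / 2"
    proof -
      have "0 < real (card ?C) * (2 powr p * ?q) + 1" using q by (intro add_nonneg_pos mult_nonneg_nonneg) auto
      then show "0 < X" "real (card ?C) * (2 powr p * ?q) * X \<le> e / 2"
        using e by (auto simp: X_def field_simps)
    qed
    \<comment> \<open>The same tolerance for integrals over a cube instead of means:
      \<open>(\<eta> / q) powr p = X\<close> for the volume \<open>q\<close>.\<close>
    define \<eta> where "\<eta> = ?q * X powr (1 / p)"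
    have \<eta>: "0 < \<eta>" using q X by (simp add: \<eta>_def)
    have "\<forall>c\<in>?C. \<exists>M. \<forall>m\<ge>M. \<forall>n\<ge>M. \<bar>J (r m) (j, c) - J (r n) (j, c)\<bar> < \<eta>"
    proof
      fix c assume "c \<in> ?C"
      then have "(j, c) \<in> S" by (auto simp: S_def)
      then have "Cauchy (\<lambda>n. J (r n) (j, c))" using r(2) by (auto intro: LIMSEQ_imp_Cauchy)
      from metric_CauchyD[OF this \<eta>] show "\<exists>M. \<forall>m\<ge>M. \<forall>n\<ge>M. \<bar>J (r m) (j, c) - J (r n) (j, c)\<bar> < \<eta>"
        by (simp add: dist_real_def)
    qed
    then obtain M where M: "\<And>c m n. c \<in> ?C \<Longrightarrow> M c \<le> m \<Longrightarrow> M c \<le> n \<Longrightarrow> \<bar>J (r m) (j, c) - J (r n) (j, c)\<bar> < \<eta>"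
      by metis
    have finC: "finite ?C" using finite_cells[OF h(1) b] .
    have "(\<integral>\<^sup>+ x. ennreal (\<bar>u (r m) x - u (r n) x\<bar> powr p) \<partial>lebesgue) \<le> ennreal e"
      if mn: "Max (insert 0 (M ` ?C)) \<le> m" "Max (insert 0 (M ` ?C)) \<le> n" for m n
    proof -
      let ?w = "\<lambda>x. u (r m) x - u (r n) x"
      have "Lp_pow UNIV p ?w \<le> ennreal (2 powr p) * (Lp_pow UNIV p (u (r m)) + Lp_pow UNIV p (u (r n)))"
        using p by (intro Lp_pow_diff_le) auto
      also have "\<dots> < \<infinity>"
        using Lp[of "r m"] Lp[of "r n"] by (auto simp: Lp_pow_def ennreal_mult_less_top intro: le_less_trans)
      finally have fin: "(\<integral>\<^sup>+ x. ennreal (\<bar>?w x\<bar> powr p) \<partial>lebesgue) < \<infinity>" by (simp add: Lp_pow_def)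
      have "seminorm_inf_pow s p ?w \<le> ennreal (2 powr p) * (seminorm_inf_pow s p (u (r m)) + seminorm_inf_pow s p (u (r n)))"
        using p by (intro seminorm_inf_le gagliardo_diff_le) auto
      also have "\<dots> \<le> ennreal (2 powr p) * (ennreal C + ennreal C)"
        by (intro mult_left_mono add_mono C) auto
      also have "\<dots> = ennreal D"
        using C(2) by (simp add: D_def ennreal_mult flip: ennreal_plus)
      finally have D: "seminorm_inf_pow s p ?w \<le> ennreal D" .
      have cell_le: "2 powr p * \<bar>(LINT y:cell_at (h j) c|lebesgue. ?w y) / ?q\<bar> powr p * ?q \<le> 2 powr p * ?q * X" if c: "c \<in> ?C" for c
      proof -
        have c': "c \<in> range (cell (h j))" using c by auto
        have Mc: "M c \<le> m" "M c \<le> n"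
          using mn c finC by (auto intro: order_trans[OF Max_ge])
        have "(LINT y:cell_at (h j) c|lebesgue. ?w y) = J (r m) (j, c) - J (r n) (j, c)"
          unfolding J_def using cell_integral(1)[OF p h u Lp c'] by (simp add: set_integral_diff)
        then have "\<bar>(LINT y:cell_at (h j) c|lebesgue. ?w y) / ?q\<bar> \<le> \<eta> / ?q"
          using M[OF c Mc] q by (simp add: abs_divide divide_right_mono)
        then have "\<bar>(LINT y:cell_at (h j) c|lebesgue. ?w y) / ?q\<bar> powr p \<le> (\<eta> / ?q) powr p"
          using p by (intro powr_mono2) auto
        also have "\<dots> = X" using h(1)[of j] X p by (simp add: \<eta>_def powr_powr)
        finally have "\<bar>(LINT y:cell_at (h j) c|lebesgue. ?w y) / ?q\<bar> powr p \<le> X" .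
        from mult_left_mono[OF this, of "2 powr p * ?q"] show ?thesis
          using q by (simp only: mult_ac) simp
      qed
      have "(\<integral>\<^sup>+ x. ennreal (\<bar>?w x\<bar> powr p) \<partial>lebesgue) \<le> ennreal (A * h j powr (s * p)) * seminorm_inf_pow s p ?w
        + (\<Sum>c\<in>?C. ennreal (2 powr p * \<bar>(LINT y:cell_at (h j) c|lebesgue. ?w y) / ?q\<bar> powr p * ?q))"
        unfolding A_def by (rule Lp_le_seminorm_plus_cell_means[OF p s h(1) b _ _ fin]) (auto simp: z)
      also have "\<dots> \<le> ennreal (A * h j powr (s * p)) * ennreal D + (\<Sum>c\<in>?C. ennreal (2 powr p * ?q * X))"
        by (intro add_mono mult_left_mono D sum_mono ennreal_leI cell_le) auto
      also have "\<dots> = ennreal (A * h j powr (s * p) * D) + ennreal (real (card ?C) * (2 powr p * ?q) * X)"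
        using AD X q by (simp add: ennreal_mult mult.assoc ennreal_of_nat_eq_real_of_nat)
      also have "\<dots> = ennreal (A * h j powr (s * p) * D + real (card ?C) * (2 powr p * ?q) * X)"
        using AD X q by (intro ennreal_plus[symmetric]) auto
      also have "\<dots> \<le> ennreal e"
        using j X(2) by (intro ennreal_leI) linarith
      finally show ?thesis .
    qed
    then show "\<exists>M. \<forall>m\<ge>M. \<forall>n\<ge>M. (\<integral>\<^sup>+ x. ennreal (\<bar>u (r m) x - u (r n) x\<bar> powr p) \<partial>lebesgue) \<le> ennreal e"
      by blast
  qed
qed

section \<open>Completeness of the Lebesgue spaces and continuity of the norm\<close>

lemma nn_integral_Fatou_le:
  fixes f :: "nat \<Rightarrow> 'b \<Rightarrow> real"
  assumes [measurable]: "\<And>n. f n \<in> borel_measurable M" and lim: "AE x in M. (\<lambda>n. f n x) \<longlonglongrightarrow> g x"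
    and le: "\<And>n. n0 \<le> n \<Longrightarrow> (\<integral>\<^sup>+ x. ennreal (f n x) \<partial>M) \<le> B"
  shows "(\<integral>\<^sup>+ x. ennreal (g x) \<partial>M) \<le> B"
proof -
  have "(\<integral>\<^sup>+ x. ennreal (g x) \<partial>M) = (\<integral>\<^sup>+ x. liminf (\<lambda>n. ennreal (f n x)) \<partial>M)"
  proof (rule nn_integral_cong_AE, use lim in eventually_elim)
    case (elim x)
    then have "(\<lambda>n. ennreal (f n x)) \<longlonglongrightarrow> ennreal (g x)" by (rule tendsto_ennrealI)
    then show ?case by (simp add: lim_imp_Liminf)
  qed
  also have "\<dots> \<le> liminf (\<lambda>n. \<integral>\<^sup>+ x. ennreal (f n x) \<partial>M)"
    by (rule nn_integral_liminf) measurable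
  also have "\<dots> \<le> liminf (\<lambda>n. B)"
    by (rule Liminf_mono) (use le in \<open>auto simp: eventually_sequentially\<close>)
  finally show ?thesis by (simp add: Liminf_const)
qed

text \<open>Riesz-Fischer: a rapidly Cauchy subsequence has an absolutely convergent telescoping
  series almost everywhere. Fatou in the second index of the Cauchy condition then turns pointwise
  convergence into convergence of the norms of the differences.\<close>

lemma Lp_Cauchy_convergent:
  fixes u :: "nat \<Rightarrow> 'b \<Rightarrow> real"
  assumes p: "1 < p" and u[measurable]: "\<And>n. u n \<in> borel_measurable M"
    and cau: "\<And>e. 0 < e \<Longrightarrow> \<exists>k. \<forall>m\<ge>k. \<forall>n\<ge>k. (\<integral>\<^sup>+ x. ennreal (\<bar>u m x - u n x\<bar> powr p) \<partial>M) \<le> ennreal e"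
  obtains r :: "nat \<Rightarrow> nat" and g where "strict_mono r" "g \<in> borel_measurable M"
    "AE x in M. (\<lambda>n. u (r n) x) \<longlonglongrightarrow> g x"
    "(\<lambda>n. \<integral>\<^sup>+ x. ennreal (\<bar>u (r n) x - g x\<bar> powr p) \<partial>M) \<longlonglongrightarrow> 0"
proof -
  define t where "t j = (1 / 2 :: real) ^ j" for j
  have t: "0 < t j" for j by (simp add: t_def)
  have "\<forall>j. \<exists>k. \<forall>m\<ge>k. \<forall>n\<ge>k. (\<integral>\<^sup>+ x. ennreal (\<bar>u m x - u n x\<bar> powr p) \<partial>M) \<le> ennreal (t j powr p)"
  proof
    fix j
    have "0 < t j powr p" using t[of j] by simp
    then show "\<exists>k. \<forall>m\<ge>k. \<forall>n\<ge>k. (\<integral>\<^sup>+ x. ennreal (\<bar>u m x - u n x\<bar> powr p) \<partial>M) \<le> ennreal (t j powr p)"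
      by (rule cau)
  qed
  then obtain k where k: "\<And>j m n. k j \<le> m \<Longrightarrow> k j \<le> n \<Longrightarrow> (\<integral>\<^sup>+ x. ennreal (\<bar>u m x - u n x\<bar> powr p) \<partial>M) \<le> ennreal (t j powr p)"
    by metis
  \<comment> \<open>The recursion makes \<open>r\<close> strictly increasing while keeping
    \<open>r j\<close> beyond the threshold \<open>k j\<close>.\<close>
  define r where "r = rec_nat (k 0) (\<lambda>j a. max (Suc a) (k (Suc j)))"
  have r0: "r 0 = k 0" and rS: "r (Suc j) = max (Suc (r j)) (k (Suc j))" for j
    by (simp_all add: r_def)
  have r: "strict_mono r" by (rule strict_monoI_Suc) (simp add: rS)
  have rk: "k j \<le> r j" for j by (cases j) (simp_all add: r0 rS)
  define d where "d j x = u (r (Suc j)) x - u (r j) x" for j x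
  have [measurable]: "d j \<in> borel_measurable M" for j unfolding d_def by measurable
  \<comment> \<open>By \<open>young_linear\<close>,
    \<open>\<bar>d j x\<bar> \<le> t j + E j x\<close>, and the weight is such that
    \<open>E j\<close> has integral at most \<open>t j powr (1 - p) * t j powr p = t j\<close>. Both
    parts are summable for almost every \<open>x\<close>.\<close>
  define E where "E j x = t j powr (1 - p) * \<bar>d j x\<bar> powr p" for j x
  have Em[measurable]: "E j \<in> borel_measurable M" for j unfolding E_def by measurable
  have E0: "0 \<le> E j x" for j x by (simp add: E_def)
  have "(\<integral>\<^sup>+ x. ennreal (E j x) \<partial>M) \<le> ennreal (t j)" for j
  proof -
    have "(\<integral>\<^sup>+ x. ennreal (E j x) \<partial>M) = ennreal (t j powr (1 - p)) * (\<integral>\<^sup>+ x. ennreal (\<bar>d j x\<bar> powr p) \<partial>M)"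
      unfolding E_def by (simp add: ennreal_mult nn_integral_cmult)
    also have "\<dots> \<le> ennreal (t j powr (1 - p)) * ennreal (t j powr p)"
      unfolding d_def using rk[of j] rS[of j] by (intro mult_left_mono k) auto
    also have "\<dots> = ennreal (t j)"
      using t[of j] by (simp flip: ennreal_mult powr_add)
    finally show ?thesis .
  qed
  then have "(\<Sum>j. \<integral>\<^sup>+ x. ennreal (E j x) \<partial>M) \<le> (\<Sum>j. ennreal (t j))"
    by (intro suminf_le) auto
  also have "\<dots> = ennreal 2"
    by (rule suminf_ennreal_eq) (use t geometric_sums[of "1 / 2 :: real"] in \<open>auto simp: t_def less_imp_le\<close>)
  finally have "(\<integral>\<^sup>+ x. (\<Sum>j. ennreal (E j x)) \<partial>M) \<noteq> \<infinity>"
    by (subst nn_integral_suminf) (auto simp: top_unique)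
  then have "AE x in M. (\<Sum>j. ennreal (E j x)) \<noteq> \<infinity>"
    by (intro nn_integral_noteq_infinite) auto
  then have conv: "AE x in M. convergent (\<lambda>n. u (r n) x)"
  proof eventually_elim
    case (elim x)
    have "summable (\<lambda>j. E j x)"
      using elim E0 by (intro summable_suminf_not_top) auto
    moreover have "summable t" unfolding t_def by (rule summable_geometric) simp
    ultimately have "summable (\<lambda>j. t j + E j x)" by (intro summable_add)
    then have "summable (\<lambda>j. d j x)"
    proof (rule summable_comparison_test')
      show "norm (d j x) \<le> t j + E j x" if "0 \<le> j" for j
        using young_linear[OF t p, of "\<bar>d j x\<bar>" j] by (simp add: E_def)
    qed
    then have "(\<lambda>n. (\<Sum>j<n. d j x) + u (r 0) x) \<longlonglongrightarrow> (\<Sum>j. d j x) + u (r 0) x"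
      by (intro tendsto_add tendsto_const summable_LIMSEQ)
    moreover have "(\<Sum>j<n. d j x) + u (r 0) x = u (r n) x" for n
      using sum_lessThan_telescope[of "\<lambda>j. u (r j) x" n] by (simp add: d_def)
    ultimately show ?case by (auto simp: convergent_def)
  qed
  define g where "g x = lim (\<lambda>n. u (r n) x)" for x
  have g[measurable]: "g \<in> borel_measurable M" unfolding g_def by measurable
  have lim: "AE x in M. (\<lambda>n. u (r n) x) \<longlonglongrightarrow> g x"
    using conv by eventually_elim (simp add: g_def convergent_LIMSEQ_iff)
  have le: "\<exists>k. \<forall>n\<ge>k. (\<integral>\<^sup>+ x. ennreal (\<bar>u (r n) x - g x\<bar> powr p) \<partial>M) \<le> ennreal e" if e: "0 < e" for e
  proof -
    obtain k where k: "\<And>m n. k \<le> m \<Longrightarrow> k \<le> n \<Longrightarrow> (\<integral>\<^sup>+ x. ennreal (\<bar>u m x - u n x\<bar> powr p) \<partial>M) \<le> ennreal e"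
      using cau[OF e] by blast
    have rge: "k \<le> r n" if "k \<le> n" for n using seq_suble[OF r, of n] that by simp
    have "(\<integral>\<^sup>+ x. ennreal (\<bar>u (r n) x - g x\<bar> powr p) \<partial>M) \<le> ennreal e" if n: "k \<le> n" for n
    proof (rule nn_integral_Fatou_le)
      show "(\<integral>\<^sup>+ x. ennreal (\<bar>u (r n) x - u (r m) x\<bar> powr p) \<partial>M) \<le> ennreal e" if "k \<le> m" for m
        using k rge n that by simp
      show "AE x in M. (\<lambda>m. \<bar>u (r n) x - u (r m) x\<bar> powr p) \<longlonglongrightarrow> \<bar>u (r n) x - g x\<bar> powr p"
        using lim
      proof eventually_elim
        case (elim x)
        then show ?case using p by (intro tendsto_powr' tendsto_rabs tendsto_diff tendsto_const) auto
      qed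
    qed measurable
    then show ?thesis by blast
  qed
  have "(\<lambda>n. \<integral>\<^sup>+ x. ennreal (\<bar>u (r n) x - g x\<bar> powr p) \<partial>M) \<longlonglongrightarrow> 0"
  proof (rule order_tendstoI)
    fix a :: ennreal assume a: "0 < a"
    obtain e where e: "0 < e" "ennreal e < a"
    proof (cases a)
      case (real x)
      then show ?thesis using a by (intro that[of "x / 2"]) (auto simp: ennreal_less_iff)
    next
      case top
      then show ?thesis by (intro that[of 1]) auto
    qed
    show "\<forall>\<^sub>F n in sequentially. (\<integral>\<^sup>+ x. ennreal (\<bar>u (r n) x - g x\<bar> powr p) \<partial>M) < a"
      using le[OF e(1)] e(2) by (auto simp: eventually_sequentially intro: le_less_trans)
  qed simp
  with r g lim show ?thesis by (rule that)
qed

text \<open>Fatou gives one inequality. For the other, \<open>powr_abs_add_convex\<close> is applied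
  to \<open>u n = g + (u n - g)\<close>: first \<open>n\<close> tends to infinity with
  \<open>t\<close> fixed, then \<open>t\<close> to 0, and the remaining factor
  \<open>(1 - t) powr (1 - p)\<close> tends to 1.\<close>

lemma Lp_norm_limit:
  fixes u :: "nat \<Rightarrow> 'b \<Rightarrow> real"
  assumes p: "1 < p" and u[measurable]: "\<And>n. u n \<in> borel_measurable M" and g[measurable]: "g \<in> borel_measurable M"
    and lim: "AE x in M. (\<lambda>n. u n x) \<longlonglongrightarrow> g x"
    and conv: "(\<lambda>n. \<integral>\<^sup>+ x. ennreal (\<bar>u n x - g x\<bar> powr p) \<partial>M) \<longlonglongrightarrow> 0"
    and one: "\<And>n. (\<integral>\<^sup>+ x. ennreal (\<bar>u n x\<bar> powr p) \<partial>M) = 1"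
  shows "(\<integral>\<^sup>+ x. ennreal (\<bar>g x\<bar> powr p) \<partial>M) = 1"
proof (rule antisym)
  show le: "(\<integral>\<^sup>+ x. ennreal (\<bar>g x\<bar> powr p) \<partial>M) \<le> 1"
  proof (rule nn_integral_Fatou_le)
    show "AE x in M. (\<lambda>n. \<bar>u n x\<bar> powr p) \<longlonglongrightarrow> \<bar>g x\<bar> powr p"
      using lim
    proof eventually_elim
      case (elim x)
      then show ?case using p by (intro tendsto_powr' tendsto_rabs tendsto_const) auto
    qed
  qed (auto simp: one)
  have key: "1 \<le> ennreal ((1 - t) powr (1 - p)) * (\<integral>\<^sup>+ x. ennreal (\<bar>g x\<bar> powr p) \<partial>M)" if t: "0 < t" "t < 1" for t
  proof (rule tendsto_lowerbound)
    let ?G = "\<integral>\<^sup>+ x. ennreal (\<bar>g x\<bar> powr p) \<partial>M" and ?D = "\<lambda>n. \<integral>\<^sup>+ x. ennreal (\<bar>u n x - g x\<bar> powr p) \<partial>M"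
    have "(\<lambda>n. ennreal (t powr (1 - p)) * ?D n) \<longlonglongrightarrow> ennreal (t powr (1 - p)) * 0"
      by (intro ennreal_tendsto_cmult conv) simp
    then show "(\<lambda>n. ennreal ((1 - t) powr (1 - p)) * ?G + ennreal (t powr (1 - p)) * ?D n) \<longlonglongrightarrow> ennreal ((1 - t) powr (1 - p)) * ?G"
      using tendsto_add[OF tendsto_const[of "ennreal ((1 - t) powr (1 - p)) * ?G"]] by fastforce
    show "\<forall>\<^sub>F n in sequentially. 1 \<le> ennreal ((1 - t) powr (1 - p)) * ?G + ennreal (t powr (1 - p)) * ?D n"
    proof (rule always_eventually, rule allI)
      fix n
      have "(\<integral>\<^sup>+ x. ennreal (\<bar>u n x\<bar> powr p) \<partial>M) \<le> (\<integral>\<^sup>+ x. ennreal ((1 - t) powr (1 - p)) * ennreal (\<bar>g x\<bar> powr p)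
          + ennreal (t powr (1 - p)) * ennreal (\<bar>u n x - g x\<bar> powr p) \<partial>M)"
      proof (rule nn_integral_mono)
        fix x
        have "\<bar>u n x\<bar> powr p \<le> (1 - t) powr (1 - p) * \<bar>g x\<bar> powr p + t powr (1 - p) * \<bar>u n x - g x\<bar> powr p"
          using powr_abs_add_convex[of p t "g x" "u n x - g x"] p t by simp
        from ennreal_leI[OF this]
        show "ennreal (\<bar>u n x\<bar> powr p) \<le> ennreal ((1 - t) powr (1 - p)) * ennreal (\<bar>g x\<bar> powr p)
          + ennreal (t powr (1 - p)) * ennreal (\<bar>u n x - g x\<bar> powr p)"
          by (simp add: ennreal_mult)
      qed
      then show "1 \<le> ennreal ((1 - t) powr (1 - p)) * ?G + ennreal (t powr (1 - p)) * ?D n"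
        by (simp add: one nn_integral_add nn_integral_cmult)
    qed
  qed simp
  obtain G where G: "(\<integral>\<^sup>+ x. ennreal (\<bar>g x\<bar> powr p) \<partial>M) = ennreal G" "0 \<le> G"
    using le by (metis ennreal_cases ennreal_one_neq_top top_unique)
  \<comment> \<open>The values \<open>t = 1 / (n + 2)\<close> stay strictly between 0 and 1.\<close>
  have "1 \<le> (1 - 1 / real (Suc (Suc n))) powr (1 - p) * G" for n
    using key[of "1 / real (Suc (Suc n))"] G by (simp flip: ennreal_mult ennreal_1)
  moreover have "(\<lambda>n. (1 - 1 / real (Suc (Suc n))) powr (1 - p) * G) \<longlonglongrightarrow> (1 - 0) powr (1 - p) * G"
    by (intro tendsto_mult tendsto_const tendsto_powr tendsto_diff LIMSEQ_Suc[OF LIMSEQ_inverse_real_of_nat[unfolded inverse_eq_divide]]) simp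
  ultimately have "1 \<le> (1 - 0) powr (1 - p) * G"
    by (intro LIMSEQ_le_const) auto
  then show "1 \<le> (\<integral>\<^sup>+ x. ennreal (\<bar>g x\<bar> powr p) \<partial>M)"
    unfolding G(1) by (simp flip: ennreal_1)
qed

section \<open>Passing to the limit\<close>

text \<open>Measure and weight are abstract because the limit is taken twice: on pairs of points,
  with the kernel as weight and differences as functions, and on the space itself with weight 1.
  Only the energies of \<open>U n\<close> are bounded, with no common majorant; Young's inequality
  moves the burden onto the fixed \<open>V\<close>.\<close>

lemma signed_powr_weak_limit:
  fixes U :: "nat \<Rightarrow> 'b \<Rightarrow> real"
  assumes p: "1 < p" and [measurable]: "\<And>n. U n \<in> borel_measurable M" "W \<in> borel_measurable M" "V \<in> borel_measurable M" "k \<in> borel_measurable M"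
    and k: "\<And>x. 0 \<le> k x" and lim: "AE x in M. (\<lambda>n. U n x) \<longlonglongrightarrow> W x"
    and B: "\<And>n. (\<integral>\<^sup>+ x. ennreal (k x * \<bar>U n x\<bar> powr p) \<partial>M) \<le> ennreal B" "0 \<le> B"
    and V: "(\<integral>\<^sup>+ x. ennreal (k x * \<bar>V x\<bar> powr p) \<partial>M) < \<infinity>"
  shows "(\<lambda>n. \<integral> x. k x * (signed_powr p (U n x) * V x) \<partial>M) \<longlonglongrightarrow> (\<integral> x. k x * (signed_powr p (W x) * V x) \<partial>M)"
proof -
  have BW: "(\<integral>\<^sup>+ x. ennreal (k x * \<bar>W x\<bar> powr p) \<partial>M) \<le> ennreal B"
  proof (rule nn_integral_Fatou_le)
    show "AE x in M. (\<lambda>n. k x * \<bar>U n x\<bar> powr p) \<longlonglongrightarrow> k x * \<bar>W x\<bar> powr p"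
      using lim
    proof eventually_elim
      case (elim x)
      then show ?case using p by (intro tendsto_mult tendsto_powr' tendsto_rabs tendsto_const) auto
    qed
  qed (auto intro: B)
  have int: "integrable M (\<lambda>x. k x * \<bar>f x\<bar> powr p)" "(\<integral> x. k x * \<bar>f x\<bar> powr p \<partial>M) \<le> B"
    if [measurable]: "f \<in> borel_measurable M" and f: "(\<integral>\<^sup>+ x. ennreal (k x * \<bar>f x\<bar> powr p) \<partial>M) \<le> ennreal B" for f :: "'b \<Rightarrow> real"
  proof -
    show "integrable M (\<lambda>x. k x * \<bar>f x\<bar> powr p)"
      using f k by (intro integrableI_bounded) (auto simp: abs_mult intro: le_less_trans)
    have "(\<integral> x. k x * \<bar>f x\<bar> powr p \<partial>M) = enn2real (\<integral>\<^sup>+ x. ennreal (k x * \<bar>f x\<bar> powr p) \<partial>M)"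
      using k by (intro integral_eq_nn_integral) auto
    also have "\<dots> \<le> enn2real (ennreal B)" using f by (rule enn2real_mono) simp
    finally show "(\<integral> x. k x * \<bar>f x\<bar> powr p \<partial>M) \<le> B" using B(2) by simp
  qed
  have iU: "integrable M (\<lambda>x. k x * \<bar>U n x\<bar> powr p)" and bU: "(\<integral> x. k x * \<bar>U n x\<bar> powr p \<partial>M) \<le> B" for n
    by (intro int B(1) assms)+
  have iW: "integrable M (\<lambda>x. k x * \<bar>W x\<bar> powr p)" and bW: "(\<integral> x. k x * \<bar>W x\<bar> powr p \<partial>M) \<le> B"
    by (intro int BW assms)+
  have iV: "integrable M (\<lambda>x. k x * \<bar>V x\<bar> powr p)"
    using V k by (intro integrableI_bounded) (auto simp: abs_mult)
  have young: "\<bar>k x * (signed_powr p a * V x)\<bar> \<le> e * (k x * \<bar>a\<bar> powr p) + e powr (1 - p) * (k x * \<bar>V x\<bar> powr p)" if "0 < e" for e a x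
  proof -
    have "\<bar>k x * (signed_powr p a * V x)\<bar> = k x * \<bar>signed_powr p a * V x\<bar>" using k[of x] by (simp add: abs_mult)
    also have "\<dots> \<le> k x * (e * \<bar>a\<bar> powr p + e powr (1 - p) * \<bar>V x\<bar> powr p)"
      using k[of x] signed_powr_young[OF p that] by (intro mult_left_mono) auto
    finally show ?thesis by (simp add: algebra_simps)
  qed
  have ispow: "integrable M (\<lambda>x. k x * (signed_powr p (f x) * V x))"
    if [measurable]: "f \<in> borel_measurable M" and f: "integrable M (\<lambda>x. k x * \<bar>f x\<bar> powr p)" for f
  proof (rule Bochner_Integration.integrable_bound)
    show "integrable M (\<lambda>x. k x * \<bar>f x\<bar> powr p + k x * \<bar>V x\<bar> powr p)" using f iV by simp
    have "\<bar>k x * (signed_powr p (f x) * V x)\<bar> \<le> \<bar>k x * \<bar>f x\<bar> powr p + k x * \<bar>V x\<bar> powr p\<bar>" for x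
      using young[of 1 x "f x"] by simp
    then show "AE x in M. norm (k x * (signed_powr p (f x) * V x)) \<le> norm (k x * \<bar>f x\<bar> powr p + k x * \<bar>V x\<bar> powr p)"
      by simp
  qed measurable
  define F where "F n x = k x * (signed_powr p (U n x) * V x)" for n x
  define G where "G x = k x * (signed_powr p (W x) * V x)" for x
  have FG: "integrable M (F n)" "integrable M G" for n
    unfolding F_def G_def by (intro ispow iU iW assms)+
  have Fm[measurable]: "F n \<in> borel_measurable M" "G \<in> borel_measurable M" for n
    unfolding F_def G_def by measurable
  have limF: "AE x in M. (\<lambda>n. F n x) \<longlonglongrightarrow> G x"
    using lim unfolding F_def G_def
  proof eventually_elim
    case (elim x)
    then show ?case by (intro tendsto_mult tendsto_const tendsto_signed_powr p)
  qed
  have "(\<lambda>n. \<integral> x. F n x \<partial>M) \<longlonglongrightarrow> (\<integral> x. G x \<partial>M)"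
  proof (rule LIMSEQ_I)
    fix \<epsilon> :: real assume \<epsilon>: "0 < \<epsilon>"
    \<comment> \<open>The integral of \<open>A n\<close> will be at most \<open>2 * B * e\<close>
      and that of \<open>H n\<close> below \<open>e\<close>, together less than
      \<open>\<epsilon>\<close>.\<close>
    define e where "e = \<epsilon> / (2 * B + 2)"
    have e: "0 < e" "e * (2 * B + 2) = \<epsilon>" using \<epsilon> B(2) by (auto simp: e_def)
    define A where "A n x = e * (k x * \<bar>U n x\<bar> powr p) + e * (k x * \<bar>W x\<bar> powr p)" for n x
    have A0: "0 \<le> A n x" for n x using e k[of x] by (simp add: A_def)
    have iA: "integrable M (A n)" for n unfolding A_def using iU iW by simp
    have bA: "(\<integral> x. A n x \<partial>M) \<le> 2 * B * e" for n
    proof -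
      have "(\<integral> x. A n x \<partial>M) = e * (\<integral> x. k x * \<bar>U n x\<bar> powr p \<partial>M) + e * (\<integral> x. k x * \<bar>W x\<bar> powr p \<partial>M)"
        unfolding A_def using iU iW by simp
      also have "\<dots> \<le> e * B + e * B" using e bU bW by (intro add_mono mult_left_mono) auto
      finally show ?thesis by simp
    qed
    have [measurable]: "A n \<in> borel_measurable M" for n using iA by (rule borel_measurable_integrable)
    \<comment> \<open>By Young's inequality the part of the difference exceeding the small term \<open>A n\<close> is dominated
      by a multiple of \<open>k * \<bar>V\<bar> powr p\<close>, uniformly in \<open>n\<close>.\<close>
    define H where "H n x = max 0 (\<bar>F n x - G x\<bar> - A n x)" for n x
    have Hm[measurable]: "H n \<in> borel_measurable M" for n unfolding H_def by measurable
    have Hb: "\<bar>H n x\<bar> \<le> 2 * (e powr (1 - p) * (k x * \<bar>V x\<bar> powr p))" for n x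
    proof -
      have "\<bar>F n x - G x\<bar> \<le> \<bar>F n x\<bar> + \<bar>G x\<bar>" by simp
      also have "\<dots> \<le> A n x + 2 * (e powr (1 - p) * (k x * \<bar>V x\<bar> powr p))"
        using young[OF e(1), of x "U n x"] young[OF e(1), of x "W x"] unfolding F_def G_def A_def by linarith
      finally show ?thesis using k[of x] by (simp add: H_def)
    qed
    have limH: "AE x in M. (\<lambda>n. H n x) \<longlonglongrightarrow> 0"
      using limF
    proof eventually_elim
      case (elim x)
      have "(\<lambda>n. \<bar>F n x - G x\<bar>) \<longlonglongrightarrow> 0"
        using tendsto_rabs[OF tendsto_diff[OF elim tendsto_const[of "G x"]]] by simp
      then show ?case
        by (rule tendsto_sandwich[OF _ _ tendsto_const, rotated 2]) (use A0 in \<open>auto simp: H_def intro!: always_eventually\<close>)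
    qed
    have iH: "integrable M (\<lambda>x. 2 * (e powr (1 - p) * (k x * \<bar>V x\<bar> powr p)))" using iV by simp
    have "(\<lambda>n. \<integral> x. H n x \<partial>M) \<longlonglongrightarrow> (\<integral> x. 0 \<partial>M)"
      by (rule integral_dominated_convergence[OF _ _ iH limH]) (use Hb in auto)
    then have "(\<lambda>n. \<integral> x. H n x \<partial>M) \<longlonglongrightarrow> 0" by simp
    then have "\<forall>\<^sub>F n in sequentially. (\<integral> x. H n x \<partial>M) < e"
      using e(1) by (rule order_tendstoD)
    then obtain n0 where n0: "\<And>n. n0 \<le> n \<Longrightarrow> (\<integral> x. H n x \<partial>M) < e"
      by (auto simp: eventually_sequentially)
    have "norm ((\<integral> x. F n x \<partial>M) - (\<integral> x. G x \<partial>M)) < \<epsilon>" if "n0 \<le> n" for n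
    proof -
      have iHn: "integrable M (H n)"
        by (rule Bochner_Integration.integrable_bound[OF iH]) (use Hb in \<open>auto intro: order_trans[OF _ abs_ge_self]\<close>)
      have "norm ((\<integral> x. F n x \<partial>M) - (\<integral> x. G x \<partial>M)) = \<bar>\<integral> x. F n x - G x \<partial>M\<bar>"
        using FG by simp
      also have "\<dots> \<le> (\<integral> x. \<bar>F n x - G x\<bar> \<partial>M)" by (rule integral_abs_bound)
      also have "\<dots> \<le> (\<integral> x. H n x + A n x \<partial>M)"
        using FG iHn iA by (intro integral_mono) (auto simp: H_def)
      also have "\<dots> = (\<integral> x. H n x \<partial>M) + (\<integral> x. A n x \<partial>M)" using iHn iA by simp
      also have "\<dots> < e + 2 * B * e" using n0[OF that] bA by (intro add_less_le_mono)
      also have "\<dots> \<le> \<epsilon>" using e by (simp add: algebra_simps)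
      finally show ?thesis .
    qed
    then show "\<exists>n0. \<forall>n\<ge>n0. norm ((\<integral> x. F n x \<partial>M) - (\<integral> x. G x \<partial>M)) < \<epsilon>" by blast
  qed
  then show ?thesis by (simp add: F_def G_def)
qed

lemma weak_inf_cong_AE:
  fixes u v v' :: "'a::euclidean_space \<Rightarrow> real"
  assumes p: "1 < p" and u: "u \<in> borel_measurable lebesgue" "seminorm_inf_pow s p u < \<infinity>"
    and v: "v \<in> borel_measurable lebesgue" "seminorm_inf_pow s p v < \<infinity>"
    and v': "v' \<in> borel_measurable lebesgue" and eq: "AE x in lebesgue. v x = v' x"
  shows "weak_inf s p u v = weak_inf s p u v'"
proof -
  have fin: "seminorm_inf_pow s p v' < \<infinity>" using v(2) seminorm_inf_cong_AE[OF eq] by simp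
  have "AE z in lebesgue2. weak_density p (real DIM('a) + s * p) u v z = weak_density p (real DIM('a) + s * p) u v' z"
    using AE_lebesgue2_fst[OF eq] AE_lebesgue2_snd[OF eq] by eventually_elim (simp add: weak_density_def)
  then show ?thesis
    unfolding weak_inf_eq[OF p u v] weak_inf_eq[OF p u v' fin]
    using u v v' by (intro integral_cong_AE) auto
qed

context large_horizon
begin

text \<open>The shifted equation is tested only with zero extensions. Every member of
  \<open>X0_inf\<close> is one almost everywhere, so this suffices for the fractional
  problem.\<close>

lemma eigenfunction_zero_ext:
  assumes e: "eigenfunction_delta \<delta> s p \<Omega> lam \<phi>" and v: "v \<in> X0_delta \<delta> s p \<Omega>"
  shows "weak_inf s p (zero_ext \<Omega> \<phi>) (zero_ext \<Omega> v) =
    (lam + 2 * enn2real (kernel_tail TYPE('a) (real DIM('a) + s * p) \<delta>)) * weak_rhs p \<Omega> \<phi> v"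
proof -
  have \<phi>: "\<phi> \<in> X0_delta \<delta> s p \<Omega>" and eq: "weak_delta \<delta> s p \<Omega> \<phi> v = lam * weak_rhs p \<Omega> \<phi> v"
    using e v by (auto simp: eigenfunction_delta_def weak_delta_def weak_rhs_def)
  show ?thesis
    using weak_inf_zero_ext[OF X0_deltaD(1,2)[OF \<phi>] X0_deltaD(1,2)[OF v] X0_deltaD(3)[OF \<phi>] X0_deltaD(3)[OF v]
        X0_deltaD(4)[OF \<phi>] X0_deltaD(4)[OF v]] eq
    by (simp add: algebra_simps)
qed

text \<open>Testing the equation with the eigenfunction itself makes the right side the shifted
  eigenvalue times the norm power 1. A convergent sequence of eigenvalues thus bounds the
  energies.\<close>

lemma eigenfunction_zero_ext_seminorm:
  assumes e: "eigenfunction_delta \<delta> s p \<Omega> lam \<phi>" and one: "Lp_pow \<Omega> p \<phi> = 1"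
  shows "seminorm_inf_pow s p (zero_ext \<Omega> \<phi>) = ennreal (lam + 2 * enn2real (kernel_tail TYPE('a) (real DIM('a) + s * p) \<delta>))"
proof -
  have \<phi>: "\<phi> \<in> X0_delta \<delta> s p \<Omega>" using e by (auto simp: eigenfunction_delta_def)
  note X = zero_ext_in_X0_inf[OF \<phi>]
  have m: "zero_ext \<Omega> \<phi> \<in> borel_measurable lebesgue" and fin: "seminorm_inf_pow s p (zero_ext \<Omega> \<phi>) < \<infinity>"
    using X by (auto simp: X0_inf_def)
  have "weak_rhs p \<Omega> \<phi> \<phi> = (\<integral> x. \<bar>zero_ext \<Omega> \<phi> x\<bar> powr p \<partial>lebesgue)"
    by (simp add: weak_rhs_eq signed_powr_mult_self)
  also have "\<dots> = enn2real (Lp_pow \<Omega> p \<phi>)"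
    unfolding Lp_pow_eq_zero_ext using m by (intro integral_eq_nn_integral) auto
  finally have "weak_rhs p \<Omega> \<phi> \<phi> = 1" using one by simp
  then have "enn2real (seminorm_inf_pow s p (zero_ext \<Omega> \<phi>)) = lam + 2 * enn2real (kernel_tail TYPE('a) (real DIM('a) + s * p) \<delta>)"
    using eigenfunction_zero_ext[OF e \<phi>] weak_inf_self[OF p m fin] by simp
  moreover have "seminorm_inf_pow s p (zero_ext \<Omega> \<phi>) = ennreal (enn2real (seminorm_inf_pow s p (zero_ext \<Omega> \<phi>)))"
    using fin by simp
  ultimately show ?thesis by (simp only:)
qed

end

text \<open>The functions \<open>w n\<close> vanish everywhere off \<open>\<Omega>\<close>, so norms
  over \<open>\<Omega>\<close> and over the space coincide. Convergence almost everywhere on the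
  space carries over to differences on pairs, and this is enough to pass to the limit in the
  nonlinear form.\<close>

lemma eigenfunction_limit:
  fixes w :: "nat \<Rightarrow> 'a::euclidean_space \<Rightarrow> real"
  assumes p: "1 < p" and s: "0 < s" and open_\<Omega>: "open \<Omega>" and b: "bounded \<Omega>"
    and w: "\<And>n. w n \<in> X0_inf s p \<Omega>" and z: "\<And>n x. x \<notin> \<Omega> \<Longrightarrow> w n x = 0"
    and one: "\<And>n. Lp_pow \<Omega> p (w n) = 1"
    and \<mu>: "\<And>n. seminorm_inf_pow s p (w n) = ennreal (\<mu> n)" "\<mu> \<longlonglongrightarrow> lam"
    and eq: "\<And>n v. v \<in> X0_inf s p \<Omega> \<Longrightarrow> weak_inf s p (w n) (zero_ext \<Omega> v) = \<mu> n * weak_rhs p \<Omega> (w n) v"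
  obtains r g where "strict_mono r" "eigenfunction_inf s p \<Omega> lam g" "Lp_pow \<Omega> p g = 1"
    "(\<lambda>n. Lp_pow \<Omega> p (\<lambda>x. w (r n) x - g x)) \<longlonglongrightarrow> 0"
proof -
  have sets_\<Omega>[measurable]: "\<Omega> \<in> sets lebesgue" using open_\<Omega> by auto
  have wm[measurable]: "w n \<in> borel_measurable lebesgue" for n using w[of n] by (simp add: X0_inf_def)
  have zw: "zero_ext \<Omega> (w n) = w n" for n using z by (auto simp: zero_ext_def fun_eq_iff split: split_indicator)
  have one': "(\<integral>\<^sup>+ x. ennreal (\<bar>w n x\<bar> powr p) \<partial>lebesgue) = 1" for n
    using one[of n] unfolding Lp_pow_eq_zero_ext zw .
  obtain C where C: "\<And>n. \<mu> n \<le> C" "0 \<le> C"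
  proof -
    obtain C where "\<And>n. norm (\<mu> n) \<le> C"
      using convergent_imp_bounded[OF \<mu>(2)] unfolding bounded_iff by auto
    then have "\<And>n. \<mu> n \<le> C" "0 \<le> C"
      by (auto intro: order_trans[OF abs_ge_self] order_trans[OF abs_ge_zero[of "\<mu> 0"]])
    then show ?thesis by (rule that)
  qed
  have semi: "seminorm_inf_pow s p (w n) \<le> ennreal C" for n
    unfolding \<mu>(1) using C(1) by (rule ennreal_leI)
  obtain r1 :: "nat \<Rightarrow> nat" where r1: "strict_mono r1"
    "\<And>e. 0 < e \<Longrightarrow> \<exists>M. \<forall>m\<ge>M. \<forall>n\<ge>M. (\<integral>\<^sup>+ x. ennreal (\<bar>w (r1 m) x - w (r1 n) x\<bar> powr p) \<partial>lebesgue) \<le> ennreal e"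
    by (rule fractional_rellich_cauchy[of p s \<Omega> w C, OF p s b wm z eq_refl[OF one'] semi C(2)]) (assumption, rule that)
  obtain r2 :: "nat \<Rightarrow> nat" and g0 where r2: "strict_mono r2" and g0[measurable]: "g0 \<in> borel_measurable lebesgue"
    and lim0: "AE x in lebesgue. (\<lambda>n. w (r1 (r2 n)) x) \<longlonglongrightarrow> g0 x"
    and conv0: "(\<lambda>n. \<integral>\<^sup>+ x. ennreal (\<bar>w (r1 (r2 n)) x - g0 x\<bar> powr p) \<partial>lebesgue) \<longlonglongrightarrow> 0"
    by (rule Lp_Cauchy_convergent[of p "\<lambda>n. w (r1 n)" lebesgue, OF p wm r1(2)]) (assumption, rule that)
  define r where "r n = r1 (r2 n)" for n
  \<comment> \<open>This changes the limit only on a null set, because all \<open>w n\<close> vanish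
    off \<open>\<Omega>\<close>.\<close>
  define g where "g = zero_ext \<Omega> g0"
  have r: "strict_mono r" using r1(1) r2 by (auto simp: r_def strict_mono_def)
  have gm[measurable]: "g \<in> borel_measurable lebesgue" unfolding g_def by measurable
  have zg: "zero_ext \<Omega> g = g" unfolding g_def by (rule zero_ext_zero_ext)
  have gg0: "AE x in lebesgue. g0 x = g x"
    using lim0
  proof eventually_elim
    case (elim x)
    show ?case
    proof (cases "x \<in> \<Omega>")
      case False
      then have "(\<lambda>n. 0) \<longlonglongrightarrow> g0 x" using elim by (simp add: z)
      then have "g0 x = 0" by (simp add: LIMSEQ_const_iff)
      then show ?thesis using False by (simp add: g_def)
    qed (simp add: g_def)
  qed
  have lim: "AE x in lebesgue. (\<lambda>n. w (r n) x) \<longlonglongrightarrow> g x"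
    using lim0 gg0 by eventually_elim (simp add: r_def)
  have "(\<integral>\<^sup>+ x. ennreal (\<bar>w (r n) x - g0 x\<bar> powr p) \<partial>lebesgue) = (\<integral>\<^sup>+ x. ennreal (\<bar>w (r n) x - g x\<bar> powr p) \<partial>lebesgue)" for n
    by (intro nn_integral_cong_AE, use gg0 in eventually_elim) simp
  then have conv: "(\<lambda>n. \<integral>\<^sup>+ x. ennreal (\<bar>w (r n) x - g x\<bar> powr p) \<partial>lebesgue) \<longlonglongrightarrow> 0"
    using conv0 unfolding r_def[symmetric] by simp
  have g1: "(\<integral>\<^sup>+ x. ennreal (\<bar>g x\<bar> powr p) \<partial>lebesgue) = 1"
    by (rule Lp_norm_limit[OF p _ gm lim conv]) (auto simp: one')
  have Lg: "Lp_pow \<Omega> p g = 1" unfolding Lp_pow_eq_zero_ext zg by (rule g1)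
  have lim2: "AE z in lebesgue2. (\<lambda>n. w (r n) (fst z) - w (r n) (snd z)) \<longlonglongrightarrow> g (fst z) - g (snd z)"
    using AE_lebesgue2_fst[OF lim] AE_lebesgue2_snd[OF lim] by eventually_elim (intro tendsto_diff)
  let ?a = "real DIM('a) + s * p"
  have gagliardo_bound: "(\<integral>\<^sup>+ z. ennreal (gagliardo p ?a (w n) z) \<partial>lebesgue2) \<le> ennreal C" for n
    using semi[of n] by (simp add: seminorm_inf_gagliardo)
  have "(\<integral>\<^sup>+ z. ennreal (gagliardo p ?a g z) \<partial>lebesgue2) \<le> ennreal C"
  proof (rule nn_integral_Fatou_le)
    show "AE z in lebesgue2. (\<lambda>n. gagliardo p ?a (w (r n)) z) \<longlonglongrightarrow> gagliardo p ?a g z"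
      using lim2
    proof eventually_elim
      case (elim z)
      then show ?case unfolding gagliardo_def using p
        by (intro tendsto_mult tendsto_powr' tendsto_rabs tendsto_const) auto
    qed
  qed (auto intro: gagliardo_bound)
  then have gfin: "seminorm_inf_pow s p g < \<infinity>"
    by (simp add: seminorm_inf_gagliardo le_less_trans)
  have gX: "g \<in> X0_inf s p \<Omega>"
    using gfin by (simp add: X0_inf_def g_def)
  have weak: "weak_inf s p g v = lam * weak_rhs p \<Omega> g v" if v: "v \<in> X0_inf s p \<Omega>" for v
  proof -
    have vm[measurable]: "v \<in> borel_measurable lebesgue" and vfin: "seminorm_inf_pow s p v < \<infinity>"
      and "AE x in lebesgue. x \<notin> \<Omega> \<longrightarrow> v x = 0"
      using v by (auto simp: X0_inf_def)
    then have vz: "AE x in lebesgue. v x = zero_ext \<Omega> v x"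
      by (elim AE_mp) (auto intro!: AE_I2 simp: zero_ext_def split: split_indicator)
    let ?v = "zero_ext \<Omega> v"
    have vfin': "seminorm_inf_pow s p ?v < \<infinity>" using vfin seminorm_inf_cong_AE[OF vz] by simp
    have vm': "?v \<in> borel_measurable lebesgue" by measurable
    have wfin: "seminorm_inf_pow s p (w n) < \<infinity>" for n using w[of n] by (simp add: X0_inf_def)
    have Lv: "(\<integral>\<^sup>+ x. ennreal (\<bar>?v x\<bar> powr p) \<partial>lebesgue) < \<infinity>"
    proof -
      \<comment> \<open>Any one admissible horizon suffices here: through
        \<open>X0_inf_subset\<close> it shows that the test function has finite norm on
        \<open>\<Omega>\<close>.\<close>
      obtain D where D: "\<And>x y. x \<in> \<Omega> \<Longrightarrow> y \<in> \<Omega> \<Longrightarrow> dist x y \<le> D"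
        using bounded_two_points[of \<Omega>] b by blast
      interpret large_horizon \<Omega> p s "\<bar>D\<bar> + 1"
        using open_\<Omega> p s D by unfold_locales (auto intro: le_less_trans[OF D] simp: abs_if)
      have "v \<in> X0_delta (\<bar>D\<bar> + 1) s p \<Omega>" using X0_inf_subset v by blast
      then show ?thesis using X0_deltaD(4) unfolding Lp_pow_eq_zero_ext by blast
    qed
    have "(\<lambda>n. \<integral> z. riesz_ker ?a (fst z) (snd z) * (signed_powr p (w (r n) (fst z) - w (r n) (snd z)) * (?v (fst z) - ?v (snd z))) \<partial>lebesgue2)
      \<longlonglongrightarrow> (\<integral> z. riesz_ker ?a (fst z) (snd z) * (signed_powr p (g (fst z) - g (snd z)) * (?v (fst z) - ?v (snd z))) \<partial>lebesgue2)"
      by (rule signed_powr_weak_limit[OF p _ _ _ _ _ lim2 _ C(2)])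
        (use gagliardo_bound vfin' in \<open>auto simp: gagliardo_def seminorm_inf_gagliardo mult.commute\<close>)
    then have "(\<lambda>n. weak_inf s p (w (r n)) ?v) \<longlonglongrightarrow> weak_inf s p g ?v"
      unfolding weak_inf_eq[OF p wm wfin vm' vfin'] weak_inf_eq[OF p gm gfin vm' vfin'] weak_density_def
      by (simp add: mult_ac)
    moreover have "(\<lambda>n. \<integral> x. 1 * (signed_powr p (w (r n) x) * ?v x) \<partial>lebesgue) \<longlonglongrightarrow> (\<integral> x. 1 * (signed_powr p (g x) * ?v x) \<partial>lebesgue)"
      by (rule signed_powr_weak_limit[OF p _ _ _ _ _ lim, where B = 1]) (use one' Lv in auto)
    then have "(\<lambda>n. weak_rhs p \<Omega> (w (r n)) v) \<longlonglongrightarrow> weak_rhs p \<Omega> g v"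
      unfolding weak_rhs_eq zw zg by simp
    then have "(\<lambda>n. \<mu> (r n) * weak_rhs p \<Omega> (w (r n)) v) \<longlonglongrightarrow> lam * weak_rhs p \<Omega> g v"
      using LIMSEQ_subseq_LIMSEQ[OF \<mu>(2) r] by (intro tendsto_mult) (auto simp: o_def)
    ultimately have "weak_inf s p g ?v = lam * weak_rhs p \<Omega> g v"
      unfolding eq[OF v] by (rule LIMSEQ_unique)
    then show ?thesis using weak_inf_cong_AE[OF p gm gfin vm vfin vm' vz] by simp
  qed
  have "\<not> (AE x in lebesgue. g x = 0)"
  proof
    assume "AE x in lebesgue. g x = 0"
    then have "(\<integral>\<^sup>+ x. ennreal (\<bar>g x\<bar> powr p) \<partial>lebesgue) = (\<integral>\<^sup>+ (x::'a). 0 \<partial>lebesgue)"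
      by (intro nn_integral_cong_AE) (auto elim: AE_mp)
    then show False using g1 by simp
  qed
  then have "eigenfunction_inf s p \<Omega> lam g"
    using gX weak by (simp add: eigenfunction_inf_def weak_inf_def weak_rhs_def)
  moreover have "(\<lambda>n. Lp_pow \<Omega> p (\<lambda>x. w (r n) x - g x)) \<longlonglongrightarrow> 0"
    unfolding Lp_pow_eq_zero_ext zero_ext_diff zw zg by (rule conv)
  ultimately show ?thesis using r Lg that by blast
qed

theorem theorem2p6:
  fixes \<Omega> :: "'a::euclidean_space set" and p s :: real and k :: nat
  assumes "open \<Omega>" and "bounded \<Omega>" and "lipschitz_boundary \<Omega>"
    and "1 < p" and "0 < s" and "s < 1" and "1 \<le> k"
  shows "((\<lambda>\<delta>. lambda_delta \<delta> s p \<Omega> k) \<longlongrightarrow> lambda_inf s p \<Omega> k) at_top \<and>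
    (\<forall>\<phi> :: real \<Rightarrow> 'a \<Rightarrow> real.
       (\<forall>\<delta>>0. eigenfunction_delta \<delta> s p \<Omega> (lambda_delta \<delta> s p \<Omega> k) (\<phi> \<delta>) \<and>
               Lp_pow \<Omega> p (\<phi> \<delta>) = 1) \<longrightarrow>
       (\<exists>\<delta>s :: nat \<Rightarrow> real. \<exists>\<phi>inf :: 'a \<Rightarrow> real.
          (\<forall>j. 0 < \<delta>s j) \<and> filterlim \<delta>s at_top sequentially \<and>
          eigenfunction_inf s p \<Omega> (lambda_inf s p \<Omega> k) \<phi>inf \<and> Lp_pow \<Omega> p \<phi>inf = 1 \<and>
          (\<lambda>j. Lp_pow \<Omega> p (\<lambda>x. \<phi> (\<delta>s j) x - \<phi>inf x)) \<longlonglongrightarrow> 0))"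
proof (intro conjI allI impI)
  show lam: "((\<lambda>\<delta>. lambda_delta \<delta> s p \<Omega> k) \<longlongrightarrow> lambda_inf s p \<Omega> k) at_top"
    using assms by (intro lambda_delta_tendsto) auto
  fix \<phi> :: "real \<Rightarrow> 'a \<Rightarrow> real"
  assume \<phi>: "\<forall>\<delta>>0. eigenfunction_delta \<delta> s p \<Omega> (lambda_delta \<delta> s p \<Omega> k) (\<phi> \<delta>) \<and> Lp_pow \<Omega> p (\<phi> \<delta>) = 1"
  obtain D where D: "\<And>x y. x \<in> \<Omega> \<Longrightarrow> y \<in> \<Omega> \<Longrightarrow> dist x y \<le> D"
    using bounded_two_points[of \<Omega>] assms(2) by blast
  \<comment> \<open>Every horizon of this sequence exceeds the diameter of \<open>\<Omega>\<close>,
    so the exact identities hold from the first index on.\<close>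
  define \<delta> where "\<delta> n = \<bar>D\<bar> + 1 + real n" for n
  have \<delta>: "0 < \<delta> n" for n by (simp add: \<delta>_def)
  have lh: "large_horizon \<Omega> p s (\<delta> n)" for n
  proof
    show "dist x y < \<delta> n" if "x \<in> \<Omega>" "y \<in> \<Omega>" for x y
      using D[OF that] by (simp add: \<delta>_def)
  qed (use assms \<delta> in auto)
  have \<delta>_top: "filterlim \<delta> at_top sequentially"
    unfolding \<delta>_def by (intro filterlim_tendsto_add_at_top[OF tendsto_const] filterlim_real_sequentially)
  have \<phi>e: "eigenfunction_delta (\<delta> n) s p \<Omega> (lambda_delta (\<delta> n) s p \<Omega> k) (\<phi> (\<delta> n))" and \<phi>1: "Lp_pow \<Omega> p (\<phi> (\<delta> n)) = 1" for n
    using \<phi> \<delta> by auto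
  have \<phi>X: "\<phi> (\<delta> n) \<in> X0_delta (\<delta> n) s p \<Omega>" for n using \<phi>e[of n] by (simp add: eigenfunction_delta_def)
  \<comment> \<open>The shifted eigenvalue, equal to the Gagliardo energy of the extended
    eigenfunction; its limit is that of the eigenvalues since the tail vanishes.\<close>
  define \<mu> where "\<mu> n = lambda_delta (\<delta> n) s p \<Omega> k + 2 * enn2real (kernel_tail TYPE('a) (real DIM('a) + s * p) (\<delta> n))" for n
  have "\<mu> \<longlonglongrightarrow> lambda_inf s p \<Omega> k + 2 * 0"
    unfolding \<mu>_def using assms
    by (intro tendsto_add tendsto_mult tendsto_const filterlim_compose[OF lam \<delta>_top]
        filterlim_compose[OF enn2real_kernel_tail_tendsto_0 \<delta>_top]) auto
  then have \<mu>: "\<mu> \<longlonglongrightarrow> lambda_inf s p \<Omega> k" by simp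
  let ?w = "\<lambda>n. zero_ext \<Omega> (\<phi> (\<delta> n))"
  have rhs: "weak_rhs p \<Omega> (?w n) v = weak_rhs p \<Omega> (\<phi> (\<delta> n)) v" for n v
    unfolding weak_rhs_eq zero_ext_zero_ext ..
  obtain r g where r: "strict_mono r" and g: "eigenfunction_inf s p \<Omega> (lambda_inf s p \<Omega> k) g" "Lp_pow \<Omega> p g = 1"
    and conv: "(\<lambda>n. Lp_pow \<Omega> p (\<lambda>x. ?w (r n) x - g x)) \<longlonglongrightarrow> 0"
  proof (rule eigenfunction_limit[of p s \<Omega> ?w \<mu>])
    show "?w n \<in> X0_inf s p \<Omega>" for n
      using large_horizon.zero_ext_in_X0_inf[OF lh \<phi>X] .
    show "seminorm_inf_pow s p (?w n) = ennreal (\<mu> n)" for n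
      unfolding \<mu>_def by (rule large_horizon.eigenfunction_zero_ext_seminorm[OF lh \<phi>e \<phi>1])
    show "weak_inf s p (?w n) (zero_ext \<Omega> v) = \<mu> n * weak_rhs p \<Omega> (?w n) v" if "v \<in> X0_inf s p \<Omega>" for n v
      unfolding \<mu>_def rhs using that large_horizon.X0_inf_subset[OF lh[of n]]
      by (intro large_horizon.eigenfunction_zero_ext[OF lh \<phi>e]) auto
  qed (use assms \<mu> in \<open>auto simp: Lp_pow_zero_ext \<phi>1\<close>)
  have "Lp_pow \<Omega> p (\<lambda>x. ?w (r n) x - g x) = Lp_pow \<Omega> p (\<lambda>x. \<phi> (\<delta> (r n)) x - g x)" for n
    unfolding Lp_pow_def by (intro nn_integral_cong) (auto split: split_indicator)
  with conv have "(\<lambda>n. Lp_pow \<Omega> p (\<lambda>x. \<phi> (\<delta> (r n)) x - g x)) \<longlonglongrightarrow> 0" by simp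
  moreover have "filterlim (\<lambda>n. \<delta> (r n)) at_top sequentially"
    using filterlim_compose[OF \<delta>_top filterlim_subseq[OF r]] .
  ultimately show "\<exists>\<delta>s \<phi>inf. (\<forall>j. 0 < \<delta>s j) \<and> filterlim \<delta>s at_top sequentially \<and>
          eigenfunction_inf s p \<Omega> (lambda_inf s p \<Omega> k) \<phi>inf \<and> Lp_pow \<Omega> p \<phi>inf = 1 \<and>
          (\<lambda>j. Lp_pow \<Omega> p (\<lambda>x. \<phi> (\<delta>s j) x - \<phi>inf x)) \<longlonglongrightarrow> 0"
    using g \<delta> by (intro exI[of _ "\<lambda>n. \<delta> (r n)"] exI[of _ g]) auto
qed

end
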